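(* Let $H$ be a Hermitian operator on an $N$-dimensional Hilbert space $\mathcal H$, $P$ an orthogonal projector of rank $d$, $Q=I-P$, and use the approximate effective Hamiltonians $\widetilde H_{\mathrm{eff}},\hat H_{\mathrm{eff}}$ and approximate wave operator $\widetilde\Omega$ of the context. Define $$\varepsilon_{\mathrm{app}}:=\varepsilon_{\mathrm{est}}+\|H_{QP}\|^2\varepsilon_f,\qquad \varepsilon:=\varepsilon_{\mathrm{est}}+\varepsilon_{\mathrm{app}}+\alpha\|H_{QP}\|\varepsilon_f .$$ Assume that the fixed-point routine returns approximate eigenpairs $(\hat\lambda_k,|\hat\phi_k\rangle)$, i.e. $|\hat\phi_k\rangle\in P\mathcal H$ is normalized, $\hat H_{\mathrm{eff}}(\hat\lambda_k)|\hat\phi_k\rangle=\hat\xi_k|\hat\phi_k\rangle$ and $|\hat\xi_k-\hat\lambda_k|\le\varepsilon_{\mathrm{app}}$, and that $$\eta_k:=\bigl\|\widetilde\Omega(\hat\lambda_k)|\hat\phi_k\rangle\bigr\|^{-2}=\mathcal O(p_k),\qquad p_k:=\langle\Psi_k|P|\Psi_k\rangle,$$ where $|\Psi_k\rangle$ is the normalized target eigenvector. Let $|\widetilde\Psi_k\rangle:=\sqrt{\eta_k}\,\widetilde\Omega(\hat\lambda_k)|\hat\phi_k\rangle$. 1. (Non-degenerate case.) Let the target eigenvalue $\lambda_k$ of $H$ be simple and $\Delta:=\mathrm{dist}\bigl(\hat\lambda_k,\mathrm{spec}(H)\setminus\{\lambda_k\}\bigr)>0$. Then the fidelity $F(\Psi_k,\widetilde\Psi_k):=|\langle\Psi_k|\widetilde\Psi_k\rangle|^2$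 satisfies $$1-F(\Psi_k,\widetilde\Psi_k)=\mathcal O\Bigl(\frac{p_k\varepsilon^2}{\Delta^2}\Bigr).$$ 2. (Subspace case.) Let $\mathcal S$ be an $m$-dimensional target spectral subspace of $H$ (spanned by eigenvectors $|\Psi_1\rangle,\dots,|\Psi_m\rangle$), let $\hat\lambda$ be a common working energy ($\hat\lambda_k=\hat\lambda$ for all $k$), and let $\Phi=[|\hat\phi_1\rangle,\dots,|\hat\phi_m\rangle]$, $\Phi^\dagger\Phi=I_m$, contain the selected eigenvectors of $\hat H_{\mathrm{eff}}(\hat\lambda)$, with $\hat H_{\mathrm{eff}}(\hat\lambda)\Phi=\Phi\hat\Xi$ and $\|\hat\Xi-\hat\lambda I_m\|\le\varepsilon_{\mathrm{app}}$. Let $\Delta:=\mathrm{dist}\bigl(\hat\lambda,\mathrm{spec}(H|_{\mathcal S^\perp})\bigr)>0$. If $\widetilde B=[|\widetilde\Psi_1\rangle,\dots,|\widetilde\Psi_m\rangle]$ has Gram matrix $G:=\widetilde B^\dagger\widetilde B\succ0$, then the Löwdin-orthonormalized basis $B=\widetilde BG^{-1/2}$ satisfies $$1-F_{\min}=\mathcal O\Bigl(\frac{\|G^{-1}\|\,p_{\max}\,\varepsilon^2}{\Delta^2}\Bigr),\qquad 1-F_{\mathrm{avg}}=\mathcal O\Bigl(\frac{\|G^{-1}\|\,p_{\mathrm{avg}}\,\varepsilon^2}{\Delta^2}\Bigr),$$ where $p_{\max}:=\max_{1\le k\le m}p_k$, $p_{\mathrm{avg}}:=\frac1m\sum_{k=1}^mp_k$,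 and $F_{\min},F_{\mathrm{avg}}$ are the subspace fidelities between $\mathcal S$ and the column span of $B$.
   Context: **Blocks.** $H_{PP}=PHP|_{P\mathcal H}$, $H_{QQ}=QHQ|_{Q\mathcal H}$, $H_{QP}=QHP:P\mathcal H\to Q\mathcal H$, $H_{PQ}=H_{QP}^\dagger$; $\|\cdot\|$ is the Euclidean/operator norm. **Approximations.** Let $g>0$. All working energies $\lambda\in\{\hat\lambda_k\}$ or $\lambda=\hat\lambda$ lie in the safe region $\mathrm{dist}(\lambda,\mathrm{spec}(H_{QQ}))\ge g/2$. For such $\lambda$, $\alpha_\lambda=\mathcal O(\alpha)$ is a block-encoding normalization, so $\|H_{QQ}-\lambda I_Q\|\le\alpha_\lambda$, and $f$ is a real polynomial with $|f(x)-1/x|\le\varepsilon_f$ for all $x\in[-\alpha_\lambda,\alpha_\lambda]\setminus(-g/2,g/2)$. Set $\widetilde H_{\mathrm{eff}}(\lambda)=H_{PP}-H_{PQ}f(H_{QQ}-\lambda I_Q)H_{QP}$, and for $|\phi\rangle\in P\mathcal H$, $\widetilde\Omega(\lambda)|\phi\rangle=|\phi\rangle-f(H_{QQ}-\lambda I_Q)H_{QP}|\phi\rangle$. $\hat H_{\mathrm{eff}}(\lambda)$ is a Hermitian estimate on $P\mathcal H$ with $\|\hat H_{\mathrm{eff}}(\lambda)-\widetilde H_{\mathrm{eff}}(\lambda)\|\le\varepsilon_{\mathrm{est}}$ at each working energy. **Subspace fidelities.** For two $m$-dimensional subspaces with orthonormal basis matrices $A,B\in\mathbb C^{N\times m}$,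 write the singular value decomposition $A^\dagger B=U\,\mathrm{diag}(\cos\theta_1,\dots,\cos\theta_m)V^\dagger$; $\theta_j\in[0,\pi/2]$ are the principal angles. Then $F_{\mathrm{avg}}:=\frac1m\sum_j\cos^2\theta_j$ and $F_{\min}:=\cos^2\theta_{\max}$, $\theta_{\max}=\max_j\theta_j$. A spectral subspace of $H$ is an $H$-invariant subspace spanned by eigenvectors. *)

theory Defs
  imports
    Complex_Main "HOL-Library.Extended_Real"
    "Jordan_Normal_Form.Spectral_Radius"
    "Jordan_Normal_Form.Schur_Decomposition"
    "Jordan_Normal_Form.DL_Rank"
begin

(* The Hilbert space of dimension N is C^N, with operators as N x N matrices of
   Jordan_Normal_Form, so that the constants hidden in the O-notation can be quantified before
   all dimensions.  Note that "v \<bullet>c w" is the inner product <w|v>.  An operator between the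
   ranges of two projectors E, F is represented by the N x N matrix A with A = F A E; operator
   norms are not affected by this extension by zero. *)

definition vec_norm2 :: "complex vec \<Rightarrow> real" where
  "vec_norm2 v = sqrt (\<Sum>i<dim_vec v. (cmod (v $ i))\<^sup>2)"

definition op_norm :: "complex mat \<Rightarrow> real" where
  "op_norm A = (SUP x\<in>{x \<in> carrier_vec (dim_col A). vec_norm2 x \<le> 1}. vec_norm2 (A *\<^sub>v x))"

definition hermitian_mat :: "complex mat \<Rightarrow> bool" where
  "hermitian_mat A \<longleftrightarrow> square_mat A \<and> mat_adjoint A = A"

definition pos_def_mat :: "complex mat \<Rightarrow> bool" where
  "pos_def_mat A \<longleftrightarrow> hermitian_mat A \<and>
     (\<forall>x \<in> carrier_vec (dim_col A). x \<noteq> 0\<^sub>v (dim_col A) \<longrightarrow> 0 < Re ((A *\<^sub>v x) \<bullet>c x))"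

definition unitary_mat :: "nat \<Rightarrow> complex mat \<Rightarrow> bool" where
  "unitary_mat n U \<longleftrightarrow> U \<in> carrier_mat n n \<and>
     mat_adjoint U * U = 1\<^sub>m n \<and> U * mat_adjoint U = 1\<^sub>m n"

definition column_span :: "complex mat \<Rightarrow> complex vec set" where
  "column_span A = {A *\<^sub>v x | x. x \<in> carrier_vec (dim_col A)}"

definition orth_complement :: "nat \<Rightarrow> complex vec set \<Rightarrow> complex vec set" where
  "orth_complement n S = {v \<in> carrier_vec n. \<forall>w\<in>S. v \<bullet>c w = 0}"

definition orth_projector :: "nat \<Rightarrow> nat \<Rightarrow> complex mat \<Rightarrow> bool" where
  "orth_projector n d P \<longleftrightarrow> P \<in> carrier_mat n n \<and> hermitian_mat P \<and> P * P = P \<and>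
     vec_space.rank n P = d"

definition compl_proj :: "complex mat \<Rightarrow> complex mat" where
  "compl_proj P = 1\<^sub>m (dim_row P) - P"

definition spectrum_on :: "complex mat \<Rightarrow> complex vec set \<Rightarrow> complex set" where
  "spectrum_on A W = {\<mu>. \<exists>v\<in>W. eigenvector A v \<mu>}"

(* The distance to the empty set is infinity; the empty spectrum occurs for Q = 0, for N = 1 in
   the non-degenerate case, and for a target subspace equal to the whole space. *)
definition spec_dist :: "real \<Rightarrow> complex set \<Rightarrow> ereal" where
  "spec_dist lam X = (INF \<mu>\<in>X. ereal (cmod (complex_of_real lam - \<mu>)))"

(* f(A) for an operator A on the range of the projector E: the constant coefficient multiplies E. *)
definition poly_on :: "complex mat \<Rightarrow> real poly \<Rightarrow> complex mat \<Rightarrow> complex mat" where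
  "poly_on E f A = mat (dim_row A) (dim_row A)
     (\<lambda>(i, j). \<Sum>k\<le>degree f. complex_of_real (coeff f k) * (E * A ^\<^sub>m k) $$ (i, j))"

definition H_PP :: "complex mat \<Rightarrow> complex mat \<Rightarrow> complex mat" where
  "H_PP H P = P * H * P"

definition H_QP :: "complex mat \<Rightarrow> complex mat \<Rightarrow> complex mat" where
  "H_QP H P = compl_proj P * H * P"

definition H_PQ :: "complex mat \<Rightarrow> complex mat \<Rightarrow> complex mat" where
  "H_PQ H P = mat_adjoint (H_QP H P)"

definition H_QQ :: "complex mat \<Rightarrow> complex mat \<Rightarrow> complex mat" where
  "H_QQ H P = compl_proj P * H * compl_proj P"

definition H_QQ_shift :: "complex mat \<Rightarrow> complex mat \<Rightarrow> real \<Rightarrow> complex mat" where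
  "H_QQ_shift H P lam = H_QQ H P - complex_of_real lam \<cdot>\<^sub>m compl_proj P"

definition Heff_poly :: "complex mat \<Rightarrow> complex mat \<Rightarrow> real poly \<Rightarrow> real \<Rightarrow> complex mat" where
  "Heff_poly H P f lam =
     H_PP H P - H_PQ H P * poly_on (compl_proj P) f (H_QQ_shift H P lam) * H_QP H P"

definition wave_op :: "complex mat \<Rightarrow> complex mat \<Rightarrow> real poly \<Rightarrow> real \<Rightarrow> complex vec \<Rightarrow> complex vec" where
  "wave_op H P f lam \<phi> =
     \<phi> - (poly_on (compl_proj P) f (H_QQ_shift H P lam) * H_QP H P) *\<^sub>v \<phi>"

definition eps_app :: "complex mat \<Rightarrow> complex mat \<Rightarrow> real \<Rightarrow> real \<Rightarrow> real" where
  "eps_app H P \<epsilon>est \<epsilon>f = \<epsilon>est + (op_norm (H_QP H P))\<^sup>2 * \<epsilon>f"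

definition eps_total :: "complex mat \<Rightarrow> complex mat \<Rightarrow> real \<Rightarrow> real \<Rightarrow> real \<Rightarrow> real" where
  "eps_total H P \<alpha> \<epsilon>est \<epsilon>f =
     \<epsilon>est + eps_app H P \<epsilon>est \<epsilon>f + \<alpha> * op_norm (H_QP H P) * \<epsilon>f"

(* \<alpha>\<^sub>W lam is the normalization at the working energy lam, c\<alpha> the constant in its bound
   O(\<alpha>), and W is the set of working energies. *)
definition approx_setting ::
    "real \<Rightarrow> nat \<Rightarrow> nat \<Rightarrow> complex mat \<Rightarrow> complex mat \<Rightarrow> real \<Rightarrow> real \<Rightarrow> (real \<Rightarrow> real) \<Rightarrow> real poly
     \<Rightarrow> real \<Rightarrow> real \<Rightarrow> (real \<Rightarrow> complex mat) \<Rightarrow> real set \<Rightarrow> bool" where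
  "approx_setting c\<alpha> N d H P g \<alpha> \<alpha>\<^sub>W f \<epsilon>f \<epsilon>est Hhat W \<longleftrightarrow>
     H \<in> carrier_mat N N \<and> hermitian_mat H \<and> orth_projector N d P \<and> 0 < g \<and>
     (\<forall>lam\<in>W.
        ereal (g / 2) \<le> spec_dist lam (spectrum_on (H_QQ H P) (column_span (compl_proj P))) \<and>
        \<alpha>\<^sub>W lam \<le> c\<alpha> * \<alpha> \<and>
        op_norm (H_QQ_shift H P lam) \<le> \<alpha>\<^sub>W lam \<and>
        (\<forall>x \<in> {- \<alpha>\<^sub>W lam .. \<alpha>\<^sub>W lam} - {- (g / 2) <..< g / 2}. \<bar>poly f x - 1 / x\<bar> \<le> \<epsilon>f) \<and>
        Hhat lam \<in> carrier_mat N N \<and> hermitian_mat (Hhat lam) \<and> P * Hhat lam * P = Hhat lam \<and>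
        op_norm (Hhat lam - Heff_poly H P f lam) \<le> \<epsilon>est)"

definition \<eta>_wave :: "complex mat \<Rightarrow> complex mat \<Rightarrow> real poly \<Rightarrow> real \<Rightarrow> complex vec \<Rightarrow> real" where
  "\<eta>_wave H P f lam \<phi> = 1 / (vec_norm2 (wave_op H P f lam \<phi>))\<^sup>2"

definition lifted_state :: "complex mat \<Rightarrow> complex mat \<Rightarrow> real poly \<Rightarrow> real \<Rightarrow> complex vec \<Rightarrow> complex vec" where
  "lifted_state H P f lam \<phi> =
     complex_of_real (sqrt (\<eta>_wave H P f lam \<phi>)) \<cdot>\<^sub>v wave_op H P f lam \<phi>"

definition P_weight :: "complex mat \<Rightarrow> complex vec \<Rightarrow> real" where
  "P_weight P \<psi> = Re ((P *\<^sub>v \<psi>) \<bullet>c \<psi>)"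

(* Pairs are indexed by k < m; c\<eta> is the constant in \<eta>_k = O(p_k). *)
definition approx_eigenpairs ::
    "real \<Rightarrow> nat \<Rightarrow> nat \<Rightarrow> complex mat \<Rightarrow> complex mat \<Rightarrow> real poly \<Rightarrow> real \<Rightarrow> real \<Rightarrow> (real \<Rightarrow> complex mat)
     \<Rightarrow> (nat \<Rightarrow> real) \<Rightarrow> (nat \<Rightarrow> complex vec) \<Rightarrow> (nat \<Rightarrow> real) \<Rightarrow> (nat \<Rightarrow> real) \<Rightarrow> (nat \<Rightarrow> complex vec)
     \<Rightarrow> bool" where
  "approx_eigenpairs c\<eta> N m H P f \<epsilon>f \<epsilon>est Hhat lhat \<phi> \<xi> lam \<Psi> \<longleftrightarrow>
     (\<forall>k<m.
        \<phi> k \<in> column_span P \<and> vec_norm2 (\<phi> k) = 1 \<and>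
        Hhat (lhat k) *\<^sub>v \<phi> k = complex_of_real (\<xi> k) \<cdot>\<^sub>v \<phi> k \<and>
        \<bar>\<xi> k - lhat k\<bar> \<le> eps_app H P \<epsilon>est \<epsilon>f \<and>
        eigenvector H (\<Psi> k) (complex_of_real (lam k)) \<and> vec_norm2 (\<Psi> k) = 1 \<and>
        \<eta>_wave H P f (lhat k) (\<phi> k) \<le> c\<eta> * P_weight P (\<Psi> k))"

definition simple_eigenvalue :: "complex mat \<Rightarrow> complex \<Rightarrow> bool" where
  "simple_eigenvalue A \<mu> \<longleftrightarrow> Polynomial.order \<mu> (char_poly A) = 1"

definition fidelity :: "complex vec \<Rightarrow> complex vec \<Rightarrow> real" where
  "fidelity \<psi> \<phi> = (cmod (\<phi> \<bullet>c \<psi>))\<^sup>2"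

definition columns :: "nat \<Rightarrow> nat \<Rightarrow> (nat \<Rightarrow> complex vec) \<Rightarrow> complex mat" where
  "columns N m v = mat_of_cols N (map v [0..<m])"

definition orthonormal_basis_mat :: "nat \<Rightarrow> nat \<Rightarrow> complex vec set \<Rightarrow> complex mat \<Rightarrow> bool" where
  "orthonormal_basis_mat N m S A \<longleftrightarrow>
     A \<in> carrier_mat N m \<and> mat_adjoint A * A = 1\<^sub>m m \<and> column_span A = S"

(* The singular values do not depend on the chosen bases, so \<theta> is determined up to a permutation of
   its first m values, and F_avg and F_min below do not depend on the order. *)
definition principal_angles ::
    "nat \<Rightarrow> nat \<Rightarrow> complex vec set \<Rightarrow> complex vec set \<Rightarrow> (nat \<Rightarrow> real) \<Rightarrow> bool" where
  "principal_angles N m S T \<theta> \<longleftrightarrow>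
     (\<forall>j<m. 0 \<le> \<theta> j \<and> \<theta> j \<le> pi / 2) \<and>
     (\<exists>A B U V. orthonormal_basis_mat N m S A \<and> orthonormal_basis_mat N m T B \<and>
        unitary_mat m U \<and> unitary_mat m V \<and>
        mat_adjoint A * B = U * mat_diag m (\<lambda>j. complex_of_real (cos (\<theta> j))) * mat_adjoint V)"

definition F_avg :: "nat \<Rightarrow> (nat \<Rightarrow> real) \<Rightarrow> real" where
  "F_avg m \<theta> = (\<Sum>j<m. (cos (\<theta> j))\<^sup>2) / real m"

definition F_min :: "nat \<Rightarrow> (nat \<Rightarrow> real) \<Rightarrow> real" where
  "F_min m \<theta> = (cos (Max (\<theta> ` {..<m})))\<^sup>2"

(* For positive definite G there is exactly one such pair: Ginv = G^(-1), R = G^(-1/2). *)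
definition inv_sqrt_mat :: "complex mat \<Rightarrow> complex mat \<Rightarrow> complex mat \<Rightarrow> bool" where
  "inv_sqrt_mat G Ginv R \<longleftrightarrow>
     inverts_mat G Ginv \<and> inverts_mat Ginv G \<and>
     R \<in> carrier_mat (dim_row G) (dim_row G) \<and> pos_def_mat R \<and> R * R = Ginv"

end

(* Let b = Omega(l) phi and r = (H - l) b.  The P-part of r is (H_eff(l) - l) phi and its Q-part is
   (1 - A f(A)) H_QP phi with A = H_QQ - l; the error parameters bound both, so that
   |r| <= max 1 c_alpha * epsilon * |phi|.  The target space is H-invariant, so the part w of b
   orthogonal to it satisfies |(H - l) w| <= |r|, and there |H - l| is at least Delta.  After
   normalisation, 1 - F = |w|^2 <= eta |r|^2 / Delta^2 with eta <= c_eta * p.  For a subspace, the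
   principal vectors of the span of B are B_t R x_j with orthonormal x_j.  The factor |Ginv| comes from
   |R x|^2 <= |Ginv| |x|^2 for F_min, and for F_avg from Parseval: the sum over j of |(R x_j)_k|^2 is
   |R e_k|^2 <= |Ginv|. *)
theory Submission
  imports Defs "HOL-Analysis.L2_Norm"
begin

section \<open>Euclidean norm and operator norm\<close>

text \<open>Blocks are extended by zero to all of C^N, so the shifted block \<open>A\<close>
  acquires the eigenvalue 0 on the range of \<open>P\<close>, where no polynomial approximates 1/x.
  Every statement about \<open>f(A)\<close> is therefore restricted to eigenvectors with a nonzero
  component in the range of \<open>Q\<close>; the safe region keeps their eigenvalues away from 0.
  Signs are not given: \<open>\<epsilon>f\<close> and \<open>\<alpha>\<close> occur in the error
  without being assumed nonnegative, and the approximation condition can be vacuous. Their signs are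
  recovered from an existing eigenvalue or a norm, or else the terms that contain them vanish. The
  gap may be infinite, namely when no spectrum is left. The estimates are proved for every
  nonnegative real number up to the gap, and the passage to the quotient comes last. The gap
  concerns only a part of the spectrum, while the spectral theorem gives an eigenbasis of the whole
  space that need not respect the target subspace; projecting eigenvectors onto the complement
  bridges the two.\<close>

lemma mat_adjoint_dim [simp]:
  "dim_row (mat_adjoint A) = dim_col A" "dim_col (mat_adjoint A) = dim_row A"
  by (auto simp: mat_adjoint_def)

lemma mat_adjoint_carrier [simp]: "A \<in> carrier_mat n m \<Longrightarrow> mat_adjoint A \<in> carrier_mat m n"
  by (intro carrier_matI) auto

lemma mat_adjoint_index [simp]:
  fixes A :: "complex mat"
  shows "i < dim_col A \<Longrightarrow> j < dim_row A \<Longrightarrow> mat_adjoint A $$ (i, j) = cnj (A $$ (j, i))"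
  by (auto simp: mat_adjoint_def mat_of_rows_def)

lemma mat_adjoint_adjoint [simp]: "mat_adjoint (mat_adjoint A) = (A :: complex mat)"
  by (rule eq_matI) auto

lemma mat_adjoint_mult:
  fixes A B :: "complex mat"
  assumes "A \<in> carrier_mat n m" "B \<in> carrier_mat m k"
  shows "mat_adjoint (A * B) = mat_adjoint B * mat_adjoint A"
  using assms by (intro eq_matI) (auto simp: scalar_prod_def mult.commute)

lemma mat_adjoint_minus:
  fixes A B :: "complex mat"
  assumes "A \<in> carrier_mat n m" "B \<in> carrier_mat n m"
  shows "mat_adjoint (A - B) = mat_adjoint A - mat_adjoint B"
  using assms by (intro eq_matI) auto

lemma mat_adjoint_one [simp]: "mat_adjoint (1\<^sub>m n) = (1\<^sub>m n :: complex mat)"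
  by (rule eq_matI) auto

lemma mat_adjoint_smult: "mat_adjoint (c \<cdot>\<^sub>m A) = cnj c \<cdot>\<^sub>m mat_adjoint (A :: complex mat)"
  by (rule eq_matI) auto

lemma cscalar_prod_sum: "v \<bullet>c w = (\<Sum>i<dim_vec w. v $ i * cnj (w $ i))"
  by (simp add: scalar_prod_def atLeast0LessThan)

lemma cscalar_prod_commute:
  fixes v w :: "complex vec"
  assumes "v \<in> carrier_vec n" "w \<in> carrier_vec n"
  shows "w \<bullet>c v = cnj (v \<bullet>c w)"
  using assms by (auto simp: cscalar_prod_sum mult.commute)

lemma cscalar_prod_adjoint:
  fixes A :: "complex mat"
  assumes A: "A \<in> carrier_mat n m" and x: "x \<in> carrier_vec m" and y: "y \<in> carrier_vec n"
  shows "(A *\<^sub>v x) \<bullet>c y = x \<bullet>c (mat_adjoint A *\<^sub>v y)"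
proof -
  have "(A *\<^sub>v x) \<bullet>c y = (\<Sum>i<n. \<Sum>j<m. A $$ (i, j) * x $ j * cnj (y $ i))"
    using assms by (auto simp: cscalar_prod_sum scalar_prod_def sum_distrib_right
        atLeast0LessThan intro!: sum.cong)
  also have "\<dots> = (\<Sum>j<m. \<Sum>i<n. A $$ (i, j) * x $ j * cnj (y $ i))"
    by (rule sum.swap)
  also have "\<dots> = x \<bullet>c (mat_adjoint A *\<^sub>v y)"
    using assms by (auto simp: cscalar_prod_sum scalar_prod_def sum_distrib_left
        atLeast0LessThan ac_simps intro!: sum.cong)
  finally show ?thesis .
qed

section \<open>Euclidean norm, Cauchy-Schwarz and isometries\<close>

lemma vec_norm2_L2: "vec_norm2 v = L2_set (\<lambda>i. cmod (v $ i)) {..<dim_vec v}"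
  by (simp add: vec_norm2_def L2_set_def)

lemma vec_norm2_nonneg [simp]: "0 \<le> vec_norm2 v"
  by (simp add: vec_norm2_def sum_nonneg)

lemma vec_norm2_sq_sum: "(vec_norm2 v)\<^sup>2 = (\<Sum>i<dim_vec v. (cmod (v $ i))\<^sup>2)"
  by (simp add: vec_norm2_def sum_nonneg)

lemma vec_norm2_sq: "complex_of_real ((vec_norm2 v)\<^sup>2) = v \<bullet>c v"
  unfolding vec_norm2_sq_sum cscalar_prod_sum of_real_sum
  by (simp add: complex_norm_square del: of_real_power)

lemma vec_norm2_sq_Re: "(vec_norm2 v)\<^sup>2 = Re (v \<bullet>c v)"
  by (metis Re_complex_of_real vec_norm2_sq)

lemma vec_norm2_zero [simp]: "vec_norm2 (0\<^sub>v n) = 0"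
  by (simp add: vec_norm2_def)

lemma vec_norm2_eq_0: "v \<in> carrier_vec n \<Longrightarrow> vec_norm2 v = 0 \<longleftrightarrow> v = 0\<^sub>v n"
  by (auto simp: vec_norm2_L2 L2_set_eq_0_iff)

lemma vec_norm2_triangle:
  assumes "v \<in> carrier_vec n" "w \<in> carrier_vec n"
  shows "vec_norm2 (v + w) \<le> vec_norm2 v + vec_norm2 w"
proof -
  have "vec_norm2 (v + w) \<le> L2_set (\<lambda>i. cmod (v $ i) + cmod (w $ i)) {..<n}"
    using assms by (auto simp: vec_norm2_L2 intro!: L2_set_mono norm_triangle_ineq)
  also have "\<dots> \<le> vec_norm2 v + vec_norm2 w"
    using assms L2_set_triangle_ineq[of "\<lambda>i. cmod (v $ i)" "\<lambda>i. cmod (w $ i)" "{..<n}"]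
    by (auto simp: vec_norm2_L2)
  finally show ?thesis .
qed

lemma vec_norm2_smult: "vec_norm2 (c \<cdot>\<^sub>v v) = cmod c * vec_norm2 v"
  
proof -
  have "(vec_norm2 (c \<cdot>\<^sub>v v))\<^sup>2 = (cmod c * vec_norm2 v)\<^sup>2"
    by (simp add: vec_norm2_sq_sum power_mult_distrib norm_mult sum_distrib_left)
  then show ?thesis by (simp only: power2_eq_iff_nonneg vec_norm2_nonneg mult_nonneg_nonneg norm_ge_zero)
qed

lemma Cauchy_Schwarz_vec:
  assumes "v \<in> carrier_vec n" "w \<in> carrier_vec n"
  shows "cmod (v \<bullet>c w) \<le> vec_norm2 v * vec_norm2 w"
proof -
  have "cmod (v \<bullet>c w) \<le> (\<Sum>i<n. \<bar>cmod (v $ i)\<bar> * \<bar>cmod (w $ i)\<bar>)"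
    using assms norm_sum[of "\<lambda>i. v $ i * cnj (w $ i)" "{..<n}"]
    by (auto simp: cscalar_prod_sum norm_mult)
  also have "\<dots> \<le> vec_norm2 v * vec_norm2 w"
    using assms L2_set_mult_ineq[of "\<lambda>i. cmod (v $ i)" "\<lambda>i. cmod (w $ i)" "{..<n}"]
    by (auto simp: vec_norm2_L2)
  finally show ?thesis .
qed

lemma isometry_norm:
  assumes A: "A \<in> carrier_mat n m" and iso: "mat_adjoint A * A = 1\<^sub>m m" and x: "x \<in> carrier_vec m"
  shows "vec_norm2 (A *\<^sub>v x) = vec_norm2 x"
proof -
  have "(A *\<^sub>v x) \<bullet>c (A *\<^sub>v x) = x \<bullet>c ((mat_adjoint A * A) *\<^sub>v x)"
    using cscalar_prod_adjoint[OF A x, of "A *\<^sub>v x"] A x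
    by (simp add: assoc_mult_mat_vec[of _ m n _ m])
  then have "(vec_norm2 (A *\<^sub>v x))\<^sup>2 = (vec_norm2 x)\<^sup>2"
    using x by (simp add: vec_norm2_sq_Re iso)
  then show ?thesis by simp
qed

lemma unitary_matD:
  assumes "unitary_mat n U"
  shows "U \<in> carrier_mat n n" "mat_adjoint U \<in> carrier_mat n n"
    "mat_adjoint U * U = 1\<^sub>m n" "U * mat_adjoint U = 1\<^sub>m n"
  using assms by (auto simp: unitary_mat_def)

lemma unitary_matI:
  assumes "U \<in> carrier_mat n n" "mat_adjoint U * U = 1\<^sub>m n"
  shows "unitary_mat n U"
  using assms mat_mult_left_right_inverse[of "mat_adjoint U" n U] by (auto simp: unitary_mat_def)

text \<open>A supremum of reals is informative only for a set that is bounded above. The sum of the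
  row norms is a crude bound, uniform on the unit ball, by Cauchy-Schwarz in each entry.\<close>

lemma op_norm_bdd:
  "bdd_above ((\<lambda>x. vec_norm2 (A *\<^sub>v x)) ` {x \<in> carrier_vec (dim_col A). vec_norm2 x \<le> 1})"
proof (rule bdd_aboveI2)
  fix x assume "x \<in> {x \<in> carrier_vec (dim_col A). vec_norm2 x \<le> 1}"
  then have x: "x \<in> carrier_vec (dim_col A)" and x1: "vec_norm2 x \<le> 1" by auto
  have "vec_norm2 (A *\<^sub>v x) \<le> (\<Sum>i<dim_row A. cmod ((A *\<^sub>v x) $ i))"
    unfolding vec_norm2_L2 dim_mult_mat_vec by (rule L2_set_le_sum) auto
  also have "\<dots> \<le> (\<Sum>i<dim_row A. vec_norm2 (row (map_mat cnj A) i))"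
  proof (rule sum_mono)
    fix i assume "i \<in> {..<dim_row A}"
    \<comment> \<open>The row is conjugated because \<open>\<bullet>c\<close> conjugates its second
      argument.\<close>
    then have "(A *\<^sub>v x) $ i = x \<bullet>c row (map_mat cnj A) i"
      using x by (auto simp: cscalar_prod_sum scalar_prod_def atLeast0LessThan mult.commute
          intro!: sum.cong)
    then have "cmod ((A *\<^sub>v x) $ i) \<le> vec_norm2 x * vec_norm2 (row (map_mat cnj A) i)"
      using Cauchy_Schwarz_vec[OF x, of "row (map_mat cnj A) i"] by (simp add: carrier_vecI)
    also have "\<dots> \<le> 1 * vec_norm2 (row (map_mat cnj A) i)"
      by (intro mult_right_mono x1) auto
    finally show "cmod ((A *\<^sub>v x) $ i) \<le> vec_norm2 (row (map_mat cnj A) i)" by simp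
  qed
  finally show "vec_norm2 (A *\<^sub>v x) \<le> (\<Sum>i<dim_row A. vec_norm2 (row (map_mat cnj A) i))" .
qed

lemma op_norm_nonneg [simp]: "0 \<le> op_norm A"
proof -
  have "vec_norm2 (A *\<^sub>v 0\<^sub>v (dim_col A)) \<le> op_norm A"
    unfolding op_norm_def by (intro cSUP_upper op_norm_bdd) auto
  then show ?thesis
    by (rule order_trans[OF vec_norm2_nonneg])
qed

lemma op_norm_bound:
  assumes A: "A \<in> carrier_mat n m" and x: "x \<in> carrier_vec m"
  shows "vec_norm2 (A *\<^sub>v x) \<le> op_norm A * vec_norm2 x"
proof (cases "vec_norm2 x = 0")
  case True
  then have "x = 0\<^sub>v m" using vec_norm2_eq_0[OF x] by simp
  moreover have "A *\<^sub>v 0\<^sub>v m = 0\<^sub>v n" using A by auto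
  ultimately show ?thesis by simp
next
  case False
  then have pos: "0 < vec_norm2 x" using vec_norm2_nonneg[of x] by linarith
  define y where "y = complex_of_real (1 / vec_norm2 x) \<cdot>\<^sub>v x"
  have y: "y \<in> carrier_vec m" "vec_norm2 y = 1"
    using x pos by (auto simp: y_def vec_norm2_smult norm_divide)
  have "vec_norm2 (A *\<^sub>v y) \<le> op_norm A"
    unfolding op_norm_def using A y by (intro cSUP_upper op_norm_bdd) auto
  also have "A *\<^sub>v y = complex_of_real (1 / vec_norm2 x) \<cdot>\<^sub>v (A *\<^sub>v x)"
    unfolding y_def by (rule mult_mat_vec[OF A x])
  also have "vec_norm2 \<dots> = vec_norm2 (A *\<^sub>v x) / vec_norm2 x"
    using pos by (simp only: vec_norm2_smult norm_of_real) simp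
  finally show ?thesis
    using pos by (simp only: pos_divide_le_eq)
qed

lemma op_norm_zero_mat: "op_norm (0\<^sub>m n m) = 0"
proof -
  have "op_norm (0\<^sub>m n m) \<le> 0"
    unfolding op_norm_def
  proof (rule cSUP_least)
    show "{x \<in> carrier_vec (dim_col (0\<^sub>m n m :: complex mat)). vec_norm2 x \<le> 1} \<noteq> {}"
      by (auto intro: exI[of _ "0\<^sub>v m"])
    show "vec_norm2 (0\<^sub>m n m *\<^sub>v x) \<le> 0"
      if "x \<in> {x \<in> carrier_vec (dim_col (0\<^sub>m n m :: complex mat)). vec_norm2 x \<le> 1}" for x
    proof -
      have "0\<^sub>m n m *\<^sub>v x = 0\<^sub>v n"
        using that by (intro eq_vecI) (auto simp: scalar_prod_def)
      then show ?thesis by simp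
    qed
  qed
  then show ?thesis using op_norm_nonneg[of "0\<^sub>m n m"] by linarith
qed

section \<open>Unitary diagonalization of Hermitian matrices\<close>

lemma mat_adjoint_mult_index:
  fixes A B :: "complex mat"
  assumes "A \<in> carrier_mat n m" "B \<in> carrier_mat n k" "i < m" "j < k"
  shows "(mat_adjoint A * B) $$ (i, j) = col B j \<bullet>c col A i"
  using assms by (auto simp: cscalar_prod_sum scalar_prod_def atLeast0LessThan mult.commute
      intro!: sum.cong)

text \<open>The deflation step of the spectral theorem needs a unitary whose first column is a
  prescribed unit vector. Gram-Schmidt leaves the head of its input unchanged and yields orthogonal
  but not normalized vectors, so each one is divided by its norm; the head already has norm
  1.\<close>

lemma unitary_completion:
  assumes v: "v \<in> carrier_vec n" and v1: "vec_norm2 v = 1"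
  obtains W where "unitary_mat n W" "0 < n" "col W 0 = v"
proof -
  have v0: "v \<noteq> 0\<^sub>v n" using v1 by auto
  then have n: "0 < n" using v by (cases n) auto
  interpret cof_vec_space n "TYPE(complex)" .
  note bc = basis_completion[OF v v0]
  define ws where "ws = gram_schmidt n (basis_completion v)"
  note gs = gram_schmidt_result[OF bc(2,4,5) ws_def]
  have len: "length ws = n" using gs(4) bc(6) by simp
  have wsc: "ws ! i \<in> carrier_vec n" if "i < n" for i
    using gs(3) len that by auto
  have "ws ! 0 = v"
  proof -
    obtain vs where vs: "basis_completion v = v # vs"
      using bc(6,7) n by (cases "basis_completion v") auto
    have "hd ws = v" using gram_schmidt_hd[OF v, of vs] unfolding ws_def vs by simp
    then show ?thesis using len n by (cases ws) auto
  qed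
  have orth: "ws ! i \<bullet>c ws ! j = 0 \<longleftrightarrow> i \<noteq> j" if "i < n" "j < n" for i j
    using corthogonalD[OF gs(2)] that len by auto
  define u where "u i = complex_of_real (1 / vec_norm2 (ws ! i)) \<cdot>\<^sub>v ws ! i" for i
  define W where "W = mat_of_cols n (map u [0..<n])"
  have W: "W \<in> carrier_mat n n" by (auto simp: W_def)
  have uc: "u i \<in> carrier_vec n" if "i < n" for i using wsc[OF that] by (simp add: u_def)
  have colW: "col W i = u i" if "i < n" for i
    using that uc by (simp add: W_def)
  have "u j \<bullet>c u i = (if i = j then 1 else 0)" if ij: "i < n" "j < n" for i j
  proof (cases "i = j")
    case True
    have "(vec_norm2 (ws ! i))\<^sup>2 \<noteq> 0"
      using orth[of i i] ij vec_norm2_sq[of "ws ! i"] by auto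
    then have "vec_norm2 (u i) = 1"
      by (simp add: u_def vec_norm2_smult norm_divide)
    then show ?thesis using vec_norm2_sq[of "u i"] True by simp
  next
    case False
    then have "ws ! j \<bullet>c ws ! i = 0" using orth ij by auto
    then show ?thesis using False wsc[OF ij(1)] wsc[OF ij(2)]
      by (simp add: u_def conjugate_smult_vec)
  qed
  then have "mat_adjoint W * W = 1\<^sub>m n"
    using W by (intro eq_matI) (auto simp: mat_adjoint_mult_index[OF W W] colW simp del: index_mult_mat(1))
  then have "unitary_mat n W" by (rule unitary_matI[OF W])
  moreover have "col W 0 = v"
    using colW[OF n] \<open>ws ! 0 = v\<close> v1 by (simp add: u_def)
  ultimately show ?thesis using that n by blast
qed

lemma mat_adjoint_four_block_diag:
  fixes A D :: "complex mat"
  assumes "A \<in> carrier_mat k k" "D \<in> carrier_mat n n"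
  shows "mat_adjoint (four_block_mat A (0\<^sub>m k n) (0\<^sub>m n k) D) =
    four_block_mat (mat_adjoint A) (0\<^sub>m k n) (0\<^sub>m n k) (mat_adjoint D)"
  using assms by (intro eq_matI) auto

text \<open>Induction by deflation. A unitary with a unit eigenvector as first column clears the
  rest of the first column of \<open>H\<close>, and self-adjointness then clears the first row, so
  the problem splits into a real scalar and a Hermitian block of size \<open>n\<close>.\<close>

lemma hermitian_unitary_diagonalization:
  fixes H :: "complex mat"
  assumes "H \<in> carrier_mat n n" "mat_adjoint H = H"
  shows "\<exists>U. unitary_mat n U \<and> diagonal_mat (mat_adjoint U * H * U)"
  using assms
proof (induction n arbitrary: H)
  case 0
  then show ?case
    by (intro exI[of _ "1\<^sub>m 0"]) (auto simp: unitary_mat_def diagonal_mat_def)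
next
  case (Suc n)
  note H = Suc.prems(1)
  obtain e where "e \<in> spectrum H" using spectrum_non_empty[OF H] by auto
  then obtain v0 where "eigenvector H v0 e" by (auto simp: spectrum_def eigenvalue_def)
  then have v0: "v0 \<in> carrier_vec (Suc n)" "v0 \<noteq> 0\<^sub>v (Suc n)" "H *\<^sub>v v0 = e \<cdot>\<^sub>v v0"
    using H by (auto simp: eigenvector_def)
  define v where "v = complex_of_real (1 / vec_norm2 v0) \<cdot>\<^sub>v v0"
  have v: "v \<in> carrier_vec (Suc n)" using v0 by (simp add: v_def)
  have v1: "vec_norm2 v = 1"
    using v0 vec_norm2_eq_0[OF v0(1)] by (simp add: v_def vec_norm2_smult norm_divide)
  have Hv: "H *\<^sub>v v = e \<cdot>\<^sub>v v"
    unfolding v_def mult_mat_vec[OF H v0(1)] v0(3) by (simp add: smult_smult_assoc mult.commute)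
  obtain W where W: "unitary_mat (Suc n) W" and W0: "col W 0 = v"
    using unitary_completion[OF v v1] by blast
  note Wd = unitary_matD[OF W]
  define K where "K = mat_adjoint W * (H * W)"
  have K: "K \<in> carrier_mat (Suc n) (Suc n)" using Wd H by (auto simp: K_def)
  have Kadj: "mat_adjoint K = K"
    unfolding K_def using Wd H Suc.prems(2)
    by (simp add: mat_adjoint_mult[of _ "Suc n" "Suc n" _ "Suc n"]
        assoc_mult_mat[of _ "Suc n" "Suc n" _ "Suc n" _ "Suc n"])
  have K0: "K $$ (i, 0) = (if i = 0 then e else 0)" if i: "i < Suc n" for i
  proof -
    have "K $$ (i, 0) = col (H * W) 0 \<bullet>c col W i"
      unfolding K_def using Wd H i by (intro mat_adjoint_mult_index) auto
    also have "col (H * W) 0 = e \<cdot>\<^sub>v col W 0"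
      using Wd H Hv W0 by (subst col_mult2[of _ "Suc n" "Suc n" _ "Suc n"]) auto
    also have "\<dots> \<bullet>c col W i = e * (mat_adjoint W * W) $$ (i, 0)"
      using Wd i by (subst mat_adjoint_mult_index[of _ "Suc n" "Suc n" _ "Suc n"]) auto
    finally show ?thesis using Wd i by simp
  qed
  have K0': "K $$ (0, j) = (if j = 0 then cnj e else 0)" if "j < Suc n" for j
  proof -
    have "K $$ (0, j) = mat_adjoint K $$ (0, j)" by (simp only: Kadj)
    also have "\<dots> = cnj (K $$ (j, 0))" using K that by (intro mat_adjoint_index) auto
    finally show ?thesis using K0[OF that] by simp
  qed
  \<comment> \<open>The corner entry is read off from the first column and from the first row; their
    agreement shows that the eigenvalue is real.\<close>
  have ce: "cnj e = e" using K0[of 0] K0'[of 0] by simp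
  define K' where "K' = mat n n (\<lambda>(i, j). K $$ (Suc i, Suc j))"
  have K': "K' \<in> carrier_mat n n" by (simp add: K'_def)
  have "mat_adjoint K' = K'"
  proof (rule eq_matI)
    fix i j assume "i < dim_row K'" "j < dim_col K'"
    then have ij: "i < n" "j < n" by (auto simp: K'_def)
    have "cnj (K $$ (Suc j, Suc i)) = mat_adjoint K $$ (Suc i, Suc j)"
      using K ij by (intro mat_adjoint_index[symmetric]) auto
    then show "mat_adjoint K' $$ (i, j) = K' $$ (i, j)"
      using ij by (simp add: K'_def Kadj)
  qed (auto simp: K'_def)
  from Suc.IH[OF K' this] obtain V where V: "unitary_mat n V"
    and dV: "diagonal_mat (mat_adjoint V * K' * V)" by blast
  note Vd = unitary_matD[OF V]
  have Kb: "K = four_block_mat (mat 1 1 (\<lambda>_. e)) (0\<^sub>m 1 n) (0\<^sub>m n 1) K'"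
    using K by (intro eq_matI) (auto simp: K'_def K0 K0' ce)
  \<comment> \<open>The diagonalizer \<open>V\<close> of the block acts on the last \<open>n\<close>
    coordinates and fixes the first one, so \<open>W * X\<close> diagonalizes
    \<open>H\<close>.\<close>
  define X where "X = four_block_mat (1\<^sub>m 1) (0\<^sub>m 1 n) (0\<^sub>m n 1) V"
  have X: "X \<in> carrier_mat (Suc n) (Suc n)" using Vd by (intro carrier_matI) (auto simp: X_def)
  have Xa: "mat_adjoint X = four_block_mat (1\<^sub>m 1) (0\<^sub>m 1 n) (0\<^sub>m n 1) (mat_adjoint V)"
    unfolding X_def using Vd by (subst mat_adjoint_four_block_diag) auto
  have "mat_adjoint X * X = four_block_mat (1\<^sub>m 1) (0\<^sub>m 1 n) (0\<^sub>m n 1) (1\<^sub>m n)"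
    unfolding Xa unfolding X_def using Vd
    by (simp add: mult_four_block_mat[of _ 1 1 _ n _ n _ _ 1 _ n])
  also have "\<dots> = 1\<^sub>m (Suc n)" by (intro eq_matI) auto
  finally have XX: "mat_adjoint X * X = 1\<^sub>m (Suc n)" .
  have XKX: "mat_adjoint X * (K * X) =
      four_block_mat (mat 1 1 (\<lambda>_. e)) (0\<^sub>m 1 n) (0\<^sub>m n 1) (mat_adjoint V * (K' * V))"
    unfolding Xa Kb unfolding X_def using Vd K'
    by (simp add: mult_four_block_mat[of _ 1 1 _ n _ n _ _ 1 _ n] left_add_zero_mat[of _ n n]
        mult_carrier_mat[of _ n n _ n])
  define U where "U = W * X"
  have U: "U \<in> carrier_mat (Suc n) (Suc n)" using Wd X by (simp add: U_def)
  have "mat_adjoint U * U = mat_adjoint X * ((mat_adjoint W * W) * X)"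
    unfolding U_def using Wd(1,2) X
    by (simp add: mat_adjoint_mult[of _ "Suc n" "Suc n" _ "Suc n"]
        assoc_mult_mat[of _ "Suc n" "Suc n" _ "Suc n" _ "Suc n"] mult_carrier_mat[of _ "Suc n" "Suc n" _ "Suc n"])
  also have "\<dots> = 1\<^sub>m (Suc n)" using Wd X XX by simp
  finally have "unitary_mat (Suc n) U" by (rule unitary_matI[OF U])
  moreover have "mat_adjoint U * H * U = mat_adjoint X * (K * X)"
    unfolding U_def K_def using Wd X H
    by (simp add: mat_adjoint_mult[of _ "Suc n" "Suc n" _ "Suc n"]
        assoc_mult_mat[of _ "Suc n" "Suc n" _ "Suc n" _ "Suc n"] mult_carrier_mat[of _ "Suc n" "Suc n" _ "Suc n"])
  moreover have "diagonal_mat (mat_adjoint X * (K * X))"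
    unfolding XKX diagonal_mat_def
  proof (intro allI impI)
    fix i j
    let ?D = "mat_adjoint V * (K' * V)"
    let ?M = "four_block_mat (mat 1 1 (\<lambda>_. e)) (0\<^sub>m 1 n) (0\<^sub>m n 1) ?D"
    assume ij: "i < dim_row ?M" "j < dim_col ?M" "i \<noteq> j"
    have D: "?D \<in> carrier_mat n n" using Vd K' by auto
    have "diagonal_mat ?D"
      using dV by (simp only: assoc_mult_mat[OF Vd(2) K' Vd(1)])
    then have off: "?D $$ (k, l) = 0" if "k < n" "l < n" "k \<noteq> l" for k l
      using D that unfolding diagonal_mat_def by blast
    show "?M $$ (i, j) = 0"
      using ij D off by (cases i; cases j) (auto simp del: index_mult_mat)
  qed
  ultimately show ?case by auto
qed

text \<open>The eigenvalues are listed with multiplicity. The factorization of the characteristic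
  polynomial belongs to the conclusion because algebraic simplicity of an eigenvalue has to be
  turned into a count of indices.\<close>

lemma hermitian_eigenbasis:
  fixes H :: "complex mat"
  assumes H: "H \<in> carrier_mat n n" and herm: "mat_adjoint H = H"
  obtains U e where "unitary_mat n U"
    "\<And>j. j < n \<Longrightarrow> H *\<^sub>v col U j = complex_of_real (e j) \<cdot>\<^sub>v col U j"
    "char_poly H = (\<Prod>j\<leftarrow>[0..<n]. [:- complex_of_real (e j), 1:])"
proof -
  obtain U where U: "unitary_mat n U" and diag: "diagonal_mat (mat_adjoint U * H * U)"
    using hermitian_unitary_diagonalization[OF H herm] by blast
  note Ud = unitary_matD[OF U]
  define D where "D = mat_adjoint U * H * U"
  have D: "D \<in> carrier_mat n n" using Ud H by (auto simp: D_def)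
  have "mat_adjoint D = D"
    unfolding D_def using Ud H herm
    by (simp add: mat_adjoint_mult[of _ n n _ n] assoc_mult_mat[of _ n n _ n _ n])
  have off: "D $$ (i, j) = 0" if "i < n" "j < n" "i \<noteq> j" for i j
    using diag that D by (auto simp: diagonal_mat_def D_def[symmetric])
  define e where "e j = Re (D $$ (j, j))" for j
  have De: "D $$ (j, j) = complex_of_real (e j)" if "j < n" for j
  proof -
    have "cnj (D $$ (j, j)) = mat_adjoint D $$ (j, j)"
      using D that by (intro mat_adjoint_index[symmetric]) auto
    also have "\<dots> = D $$ (j, j)" by (simp only: \<open>mat_adjoint D = D\<close>)
    finally show ?thesis by (simp add: e_def complex_eq_iff)
  qed
  have HU: "H * U = U * D"
  proof -
    have "U * D = (U * mat_adjoint U) * (H * U)"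
      unfolding D_def using Ud(1,2) H by (simp add: assoc_mult_mat[of _ n n _ n _ n])
    then show ?thesis using Ud H by simp
  qed
  have "H *\<^sub>v col U j = complex_of_real (e j) \<cdot>\<^sub>v col U j" if j: "j < n" for j
  proof -
    have "H *\<^sub>v col U j = col (H * U) j"
      using Ud H j by (intro col_mult2[symmetric]) auto
    also have "\<dots> = U *\<^sub>v col D j"
      unfolding HU using Ud D j by (intro col_mult2) auto
    also have "col D j = complex_of_real (e j) \<cdot>\<^sub>v unit_vec n j"
      using D j off De by (intro eq_vecI) auto
    also have "U *\<^sub>v \<dots> = complex_of_real (e j) \<cdot>\<^sub>v (U *\<^sub>v unit_vec n j)"
      using Ud by (intro mult_mat_vec) auto
    also have "U *\<^sub>v unit_vec n j = col U j"
      using Ud j by (auto intro!: eq_vecI)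
    finally show ?thesis .
  qed
  moreover have "char_poly H = (\<Prod>j\<leftarrow>[0..<n]. [:- complex_of_real (e j), 1:])"
  proof -
    have "H = U * D * mat_adjoint U"
      using Ud H by (simp add: HU[symmetric] assoc_mult_mat[of _ n n _ n _ n])
    then have "similar_mat_wit H D U (mat_adjoint U)"
      by (rule similar_mat_witI[OF Ud(4,3) _ H D Ud(1,2)])
    then have "char_poly H = char_poly D"
      by (intro char_poly_similar) (auto simp: similar_mat_def)
    also have "\<dots> = (\<Prod>a\<leftarrow>diag_mat D. [:- a, 1:])"
      using D off by (intro char_poly_upper_triangular[of _ n]) (auto simp: upper_triangular_def)
    also have "map (\<lambda>a. [:- a, 1:]) (diag_mat D) = map (\<lambda>j. [:- complex_of_real (e j), 1:]) [0..<n]"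
      using D De by (auto simp: diag_mat_def)
    finally show ?thesis .
  qed
  ultimately show ?thesis using that U by blast
qed

section \<open>Expansion in a unitary eigenbasis\<close>

lemma adjoint_mult_vec_index:
  fixes U :: "complex mat"
  assumes "U \<in> carrier_mat n m" "w \<in> carrier_vec n" "j < m"
  shows "(mat_adjoint U *\<^sub>v w) $ j = w \<bullet>c col U j"
  using assms by (auto simp: cscalar_prod_sum scalar_prod_def atLeast0LessThan mult.commute
      intro!: sum.cong)

lemma Parseval:
  assumes U: "unitary_mat n U" and w: "w \<in> carrier_vec n"
  shows "(\<Sum>j<n. (cmod (w \<bullet>c col U j))\<^sup>2) = (vec_norm2 w)\<^sup>2"
proof -
  note Ud = unitary_matD[OF U]
  have "vec_norm2 (mat_adjoint U *\<^sub>v w) = vec_norm2 w"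
    using Ud w by (intro isometry_norm[of _ n n]) auto
  then show ?thesis
    using vec_norm2_sq_sum[of "mat_adjoint U *\<^sub>v w"] Ud
    by (simp add: adjoint_mult_vec_index[OF Ud(1) w] del: index_mult_mat_vec)
qed

text \<open>Multiplying \<open>M * U = U * mat_diag n c\<close> by \<open>mat_adjoint U\<close> on
  both sides makes \<open>M\<close> diagonal in the basis. \<open>M\<close> is an arbitrary matrix
  with this eigenbasis and \<open>c\<close> may be complex, so that one lemma covers
  \<open>H\<close>, its shifts and \<open>1 - A f(A)\<close>.\<close>

lemma eigenbasis_coefficient:
  assumes U: "unitary_mat n U" and M: "M \<in> carrier_mat n n"
    and eig: "\<And>j. j < n \<Longrightarrow> M *\<^sub>v col U j = c j \<cdot>\<^sub>v col U j"
    and w: "w \<in> carrier_vec n" and j: "j < n"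
  shows "(M *\<^sub>v w) \<bullet>c col U j = c j * (w \<bullet>c col U j)"
proof -
  note Ud = unitary_matD[OF U]
  have MU: "M * U = U * mat_diag n c"
  proof (rule eq_matI)
    fix i j assume ij: "i < dim_row (U * mat_diag n c)" "j < dim_col (U * mat_diag n c)"
    then have j: "i < n" "j < n" using Ud by (auto simp: mat_diag_def)
    have "(M * U) $$ (i, j) = (M *\<^sub>v col U j) $ i" using M Ud j by auto
    then show "(M * U) $$ (i, j) = (U * mat_diag n c) $$ (i, j)"
      using eig[OF j(2)] Ud j by (simp add: mat_diag_mult_right[of _ n])
  qed (use M Ud in \<open>auto simp: mat_diag_def\<close>)
  have "mat_adjoint U * M = mat_adjoint U * ((M * U) * mat_adjoint U)"
    using Ud M by (simp add: assoc_mult_mat[of _ n n _ n _ n])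
  also have "\<dots> = (mat_adjoint U * U) * (mat_diag n c * mat_adjoint U)"
    unfolding MU using Ud(1,2)
    by (simp add: assoc_mult_mat[of _ n n _ n _ n] mult_carrier_mat[of _ n n _ n])
  also have "\<dots> = mat_diag n c * mat_adjoint U" 
    using Ud by (simp add: left_mult_one_mat[of _ n n] mult_carrier_mat[of _ n n _ n])
  finally have UM: "mat_adjoint U * M = mat_diag n c * mat_adjoint U" .
  have "(M *\<^sub>v w) \<bullet>c col U j = ((mat_adjoint U * M) *\<^sub>v w) $ j"
    using Ud M w j by (simp add: adjoint_mult_vec_index[of _ n n] assoc_mult_mat_vec[of _ n n _ n]
        del: index_mult_mat_vec)
  also have "\<dots> = (\<Sum>k<n. (if j = k then c k else 0) * (mat_adjoint U *\<^sub>v w) $ k)"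
    unfolding UM using Ud w j
    by (subst assoc_mult_mat_vec[of _ n n _ n])
      (auto simp: mat_diag_def scalar_prod_def atLeast0LessThan intro!: sum.cong)
  also have "\<dots> = (\<Sum>k<n. if j = k then c k * (mat_adjoint U *\<^sub>v w) $ k else 0)"
    by (rule sum.cong) auto
  also have "\<dots> = c j * (w \<bullet>c col U j)"
    using j by (simp add: adjoint_mult_vec_index[OF Ud(1) w])
  finally show ?thesis .
qed

lemma eigenbasis_norm:
  assumes U: "unitary_mat n U" and M: "M \<in> carrier_mat n n"
    and eig: "\<And>j. j < n \<Longrightarrow> M *\<^sub>v col U j = c j \<cdot>\<^sub>v col U j"
    and w: "w \<in> carrier_vec n"
  shows "(vec_norm2 (M *\<^sub>v w))\<^sup>2 = (\<Sum>j<n. (cmod (c j))\<^sup>2 * (cmod (w \<bullet>c col U j))\<^sup>2)"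
  using eigenbasis_coefficient[OF U M eig w] M w
  by (simp add: Parseval[OF U, symmetric] norm_mult power_mult_distrib)

lemma eigenbasis_col:
  assumes "unitary_mat n U" "j < n"
  shows "col U j \<in> carrier_vec n" "vec_norm2 (col U j) = 1" "col U j \<noteq> 0\<^sub>v n"
proof -
  note Ud = unitary_matD[OF assms(1)]
  show c: "col U j \<in> carrier_vec n" using Ud assms(2) by auto
  have "complex_of_real ((vec_norm2 (col U j))\<^sup>2) = (mat_adjoint U * U) $$ (j, j)"
    using Ud(1) assms(2) by (simp only: vec_norm2_sq mat_adjoint_mult_index)
  also have "\<dots> = of_real (1\<^sup>2)" using Ud assms(2) by simp
  finally have "(vec_norm2 (col U j))\<^sup>2 = 1\<^sup>2" by (simp only: of_real_eq_iff)
  then show "vec_norm2 (col U j) = 1"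
    by (metis power2_eq_imp_eq vec_norm2_nonneg zero_le_one)
  then show "col U j \<noteq> 0\<^sub>v n" by auto
qed

section \<open>Lower bounds from a spectral gap, and simple eigenvalues\<close>

lemma shift_mult_mat_vec:
  fixes H :: "complex mat"
  assumes H: "H \<in> carrier_mat n n" and v: "v \<in> carrier_vec n"
  shows "(H - c \<cdot>\<^sub>m 1\<^sub>m n) *\<^sub>v v = H *\<^sub>v v - c \<cdot>\<^sub>v v"
proof -
  have "(c \<cdot>\<^sub>m 1\<^sub>m n) *\<^sub>v v = c \<cdot>\<^sub>v v"
    using v by (intro eq_vecI) (auto simp: scalar_prod_left_unit[of _ n] row_smult)
  then show ?thesis using H v by (subst minus_mult_distrib_mat_vec[of _ n n]) auto
qed

text \<open>By Parseval, an eigenvector orthogonal to \<open>w\<close> contributes nothing to either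
  side, so the gap has to be known only for eigenvectors with a nonzero coefficient. This weak form
  of the gap is what an invariant subspace can supply, since the eigenbasis chosen here need not be
  adapted to that subspace.\<close>

lemma hermitian_shift_lower_bound:
  fixes H :: "complex mat"
  assumes H: "H \<in> carrier_mat n n" and herm: "mat_adjoint H = H"
    and w: "w \<in> carrier_vec n" and "0 \<le> \<delta>"
    and gap: "\<And>u \<mu>. eigenvector H u \<mu> \<Longrightarrow> w \<bullet>c u \<noteq> 0 \<Longrightarrow> \<delta> \<le> cmod (of_real l - \<mu>)"
  shows "\<delta>\<^sup>2 * (vec_norm2 w)\<^sup>2 \<le> (vec_norm2 (H *\<^sub>v w - complex_of_real l \<cdot>\<^sub>v w))\<^sup>2"
proof -
  obtain U e where U: "unitary_mat n U"
    and eig: "\<And>j. j < n \<Longrightarrow> H *\<^sub>v col U j = complex_of_real (e j) \<cdot>\<^sub>v col U j"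
    using hermitian_eigenbasis[OF H herm] by blast
  define M where "M = H - complex_of_real l \<cdot>\<^sub>m 1\<^sub>m n"
  have M: "M \<in> carrier_mat n n" using H by (auto simp: M_def)
  have Mv: "M *\<^sub>v v = H *\<^sub>v v - complex_of_real l \<cdot>\<^sub>v v" if "v \<in> carrier_vec n" for v
    unfolding M_def by (rule shift_mult_mat_vec[OF H that])
  have eigM: "M *\<^sub>v col U j = (complex_of_real (e j) - of_real l) \<cdot>\<^sub>v col U j" if "j < n" for j
    using Mv[OF eigenbasis_col(1)[OF U that]] eig[OF that] 
      by (auto simp: algebra_simps intro!: eq_vecI)
  have "\<delta>\<^sup>2 * (vec_norm2 w)\<^sup>2 = (\<Sum>j<n. \<delta>\<^sup>2 * (cmod (w \<bullet>c col U j))\<^sup>2)"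
    by (simp add: Parseval[OF U w, symmetric] sum_distrib_left)
  also have "\<dots> \<le> (\<Sum>j<n. (cmod (of_real (e j) - of_real l))\<^sup>2 * (cmod (w \<bullet>c col U j))\<^sup>2)"
  proof (rule sum_mono)
    fix j assume "j \<in> {..<n}"
    then have j: "j < n" by simp
    show "\<delta>\<^sup>2 * (cmod (w \<bullet>c col U j))\<^sup>2
        \<le> (cmod (of_real (e j) - of_real l))\<^sup>2 * (cmod (w \<bullet>c col U j))\<^sup>2"
    proof (cases "w \<bullet>c col U j = 0")
      case False
      have "eigenvector H (col U j) (of_real (e j))"
        using H eig[OF j] eigenbasis_col[OF U j] by (auto simp: eigenvector_def)
      from gap[OF this False] have "\<delta> \<le> cmod (of_real (e j) - of_real l)"
        by (simp add: norm_minus_commute)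
      then show ?thesis using \<open>0 \<le> \<delta>\<close> by (intro mult_right_mono power_mono) auto
    qed simp
  qed
  also have "\<dots> = (vec_norm2 (M *\<^sub>v w))\<^sup>2"
    by (rule eigenbasis_norm[OF U M eigM w, symmetric])
  finally show ?thesis by (simp add: Mv[OF w])
qed

text \<open>The order of the root \<open>\<mu>\<close> counts the columns of the eigenbasis with
  that eigenvalue. With exactly one such column, every eigenvector for \<open>\<mu>\<close> is a
  nonzero multiple of it, and two nonzero multiples of one unit vector are not orthogonal.\<close>

lemma simple_eigenvalue_eigenvectors_parallel:
  fixes H :: "complex mat"
  assumes H: "H \<in> carrier_mat n n" and herm: "mat_adjoint H = H"
    and simple: "simple_eigenvalue H \<mu>"
    and v: "eigenvector H v \<mu>" and u: "eigenvector H u \<mu>"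
  shows "u \<bullet>c v \<noteq> 0"
proof
  assume orth: "u \<bullet>c v = 0"
  obtain U e where U: "unitary_mat n U"
    and eig: "\<And>j. j < n \<Longrightarrow> H *\<^sub>v col U j = complex_of_real (e j) \<cdot>\<^sub>v col U j"
    and cp: "char_poly H = (\<Prod>j\<leftarrow>[0..<n]. [:- complex_of_real (e j), 1:])"
    using hermitian_eigenbasis[OF H herm] by blast
  note Ud = unitary_matD[OF U]
  let ?J = "{j. j < n \<and> complex_of_real (e j) = \<mu>}"
  have "Polynomial.order \<mu> (char_poly H) = card ?J"
  proof -
    have "Polynomial.order \<mu> (char_poly H) =
        (\<Sum>p\<leftarrow>map (\<lambda>j. [:- complex_of_real (e j), 1:]) [0..<n]. Polynomial.order \<mu> p)"
      unfolding cp by (rule order_prod_list) auto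
    also have "\<dots> = (\<Sum>j<n. if complex_of_real (e j) = \<mu> then 1 else 0)"
      by (auto simp: o_def order_linear' sum_list_distinct_conv_sum_set atLeast0LessThan intro!: sum.cong)
    also have "\<dots> = card ?J" by (simp add: sum.If_cases Int_def)
    finally show ?thesis .
  qed
  then have "card ?J = 1" using simple by (simp add: simple_eigenvalue_def)
  then obtain k where k: "?J = {k}" by (auto simp: card_1_singleton_iff)
  have coeff: "w \<bullet>c col U j = 0" if w: "eigenvector H w \<mu>" and j: "j < n" "j \<noteq> k" for w j
  proof -
    have wc: "w \<in> carrier_vec n" "H *\<^sub>v w = \<mu> \<cdot>\<^sub>v w" using w H by (auto simp: eigenvector_def)
    have "\<mu> * (w \<bullet>c col U j) = of_real (e j) * (w \<bullet>c col U j)"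
      using eigenbasis_coefficient[OF U H eig wc(1) j(1)] wc eigenbasis_col[OF U j(1)] by simp
    moreover have "of_real (e j) \<noteq> \<mu>" using k j by auto
    ultimately show ?thesis by auto
  qed
  have kn: "k < n" using k by auto
  have rep: "w = (w \<bullet>c col U k) \<cdot>\<^sub>v col U k" "w \<bullet>c col U k \<noteq> 0" if w: "eigenvector H w \<mu>" for w
  proof -
    have wc: "w \<in> carrier_vec n" "w \<noteq> 0\<^sub>v n" using w H by (auto simp: eigenvector_def)
    have "mat_adjoint U *\<^sub>v w = (w \<bullet>c col U k) \<cdot>\<^sub>v unit_vec n k"
      using coeff[OF w] wc Ud kn
      by (intro eq_vecI) (auto simp: adjoint_mult_vec_index[OF Ud(1) wc(1)] simp del: index_mult_mat_vec)
    then have "U *\<^sub>v (mat_adjoint U *\<^sub>v w) = (w \<bullet>c col U k) \<cdot>\<^sub>v (U *\<^sub>v unit_vec n k)"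
      using Ud by (simp add: mult_mat_vec[of _ n n])
    moreover have "U *\<^sub>v unit_vec n k = col U k"
      using Ud kn by (auto intro!: eq_vecI)
    moreover have "U *\<^sub>v (mat_adjoint U *\<^sub>v w) = w"
      using Ud wc by (simp flip: assoc_mult_mat_vec[of _ n n _ n])
    ultimately show r: "w = (w \<bullet>c col U k) \<cdot>\<^sub>v col U k" by simp
    show "w \<bullet>c col U k \<noteq> 0"
    proof
      assume "w \<bullet>c col U k = 0"
      moreover have "0 \<cdot>\<^sub>v col U k = 0\<^sub>v n"
        using Ud by (intro eq_vecI) auto
      ultimately show False using r wc by simp
    qed
  qed
  have "u \<bullet>c v = (u \<bullet>c col U k) * cnj (v \<bullet>c col U k) * (col U k \<bullet>c col U k)"
    using eigenbasis_col[OF U kn]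
    by (subst (1) rep(1)[OF u], subst (1) rep(1)[OF v]) (simp add: conjugate_smult_vec)
  moreover have "col U k \<bullet>c col U k = 1"
    using vec_norm2_sq[of "col U k"] eigenbasis_col[OF U kn] by simp
  ultimately show False using rep(2)[OF u] rep(2)[OF v] orth by simp
qed

section \<open>Residuals and invariant subspaces\<close>

lemma vec_norm2_Pythagoras:
  assumes v: "v \<in> carrier_vec n" and w: "w \<in> carrier_vec n" and orth: "v \<bullet>c w = 0"
  shows "(vec_norm2 (v + w))\<^sup>2 = (vec_norm2 v)\<^sup>2 + (vec_norm2 w)\<^sup>2"
proof -
  have "w \<bullet>c v = 0" using cscalar_prod_commute[OF v w] orth by simp
  then have "(v + w) \<bullet>c (v + w) = v \<bullet>c v + w \<bullet>c w"
    using v w orth by (simp add: conjugate_add_vec[of _ n] add_scalar_prod_distrib[of _ n]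
        scalar_prod_add_distrib[of _ n])
  then show ?thesis by (simp add: vec_norm2_sq_Re)
qed

lemma mult_mat_zero_vec:
  fixes A :: "complex mat"
  assumes "A \<in> carrier_mat n m"
  shows "A *\<^sub>v 0\<^sub>v m = 0\<^sub>v n"
  using assms by (intro eq_vecI) (auto simp: scalar_prod_def)

text \<open>\<open>A * mat_adjoint A\<close> is the projector onto the column span. Taking adjoints
  in \<open>H * A = A * L\<close> shows that \<open>H\<close> also preserves the orthogonal
  complement, so the residual of \<open>b\<close> is the orthogonal sum of the residuals of its two
  components. The gap bounds the complementary one from below, and adding the other back can only
  increase the right-hand side.\<close>

lemma invariant_subspace_residual:
  fixes H A :: "complex mat"
  assumes H: "H \<in> carrier_mat n n" and herm: "mat_adjoint H = H"
    and A: "A \<in> carrier_mat n m" and iso: "mat_adjoint A * A = 1\<^sub>m m"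
    and L: "L \<in> carrier_mat m m" and inv: "H * A = A * L"
    and b: "b \<in> carrier_vec n" and "0 \<le> \<delta>"
    and gap: "\<And>u \<mu>. eigenvector H u \<mu> \<Longrightarrow> mat_adjoint A *\<^sub>v u = 0\<^sub>v m
      \<Longrightarrow> \<delta> \<le> cmod (of_real l - \<mu>)"
  shows "\<delta>\<^sup>2 * ((vec_norm2 b)\<^sup>2 - (vec_norm2 (mat_adjoint A *\<^sub>v b))\<^sup>2)
    \<le> (vec_norm2 (H *\<^sub>v b - complex_of_real l \<cdot>\<^sub>v b))\<^sup>2"
proof -
  note Aa = mat_adjoint_carrier[OF A]
  have A_iso: "mat_adjoint A *\<^sub>v (A *\<^sub>v y) = y" if "y \<in> carrier_vec m" for y
    using that A Aa iso by (simp flip: assoc_mult_mat_vec[of _ m n _ m])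
  define E where "E x = A *\<^sub>v (mat_adjoint A *\<^sub>v x)" for x
  have E: "E x \<in> carrier_vec n" "mat_adjoint A *\<^sub>v (x - E x) = 0\<^sub>v m" if "x \<in> carrier_vec n" for x
  proof -
    have z: "mat_adjoint A *\<^sub>v x \<in> carrier_vec m" by (rule mult_mat_vec_carrier[OF Aa that])
    show Ex: "E x \<in> carrier_vec n" unfolding E_def by (rule mult_mat_vec_carrier[OF A z])
    show "mat_adjoint A *\<^sub>v (x - E x) = 0\<^sub>v m"
      unfolding mult_minus_distrib_mat_vec[OF Aa that Ex] using A_iso[OF z] z by (simp add: E_def)
  qed
  \<comment> \<open>The shift \<open>c\<close> is left free: it is the working energy for the
    residual of \<open>b\<close>, and an eigenvalue \<open>\<mu>\<close> when eigenvectors are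
    projected.\<close>
  define R where "R c x = H *\<^sub>v x - c \<cdot>\<^sub>v x" for c x
  have Rc: "R c x \<in> carrier_vec n" if "x \<in> carrier_vec n" for c x
    using that H by (simp add: R_def)
  have Radd: "R c (x + y) = R c x + R c y" if "x \<in> carrier_vec n" "y \<in> carrier_vec n" for c x y
    unfolding R_def mult_add_distrib_mat_vec[OF H that] using that H
    by (intro eq_vecI) (auto simp: algebra_simps simp del: index_mult_mat_vec)
  have RE: "\<exists>y\<in>carrier_vec m. R c (E x) = A *\<^sub>v y" if x: "x \<in> carrier_vec n" for c x
  proof
    let ?z = "mat_adjoint A *\<^sub>v x"
    have z: "?z \<in> carrier_vec m" using Aa x by auto
    show "L *\<^sub>v ?z - c \<cdot>\<^sub>v ?z \<in> carrier_vec m" using L z by simp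
    have "H *\<^sub>v (A *\<^sub>v ?z) = A *\<^sub>v (L *\<^sub>v ?z)"
      using assoc_mult_mat_vec[OF H A z] assoc_mult_mat_vec[OF A L z] inv by simp
    then show "R c (E x) = A *\<^sub>v (L *\<^sub>v ?z - c \<cdot>\<^sub>v ?z)"
      using A L z by (simp add: R_def E_def mult_minus_distrib_mat_vec[of _ n m] mult_mat_vec[of _ n m]
          del: index_mult_mat_vec)
  qed
  have Rperp: "mat_adjoint A *\<^sub>v R c x = 0\<^sub>v m"
    if x: "x \<in> carrier_vec n" and Ax: "mat_adjoint A *\<^sub>v x = 0\<^sub>v m" for c x
  proof -
    have "mat_adjoint A * H = mat_adjoint L * mat_adjoint A"
      using mat_adjoint_mult[OF H A] mat_adjoint_mult[OF A L] inv herm by simp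
    then have "mat_adjoint A *\<^sub>v (H *\<^sub>v x) = mat_adjoint L *\<^sub>v (mat_adjoint A *\<^sub>v x)"
      using assoc_mult_mat_vec[OF Aa H x] assoc_mult_mat_vec[OF mat_adjoint_carrier[OF L] Aa x] by simp
    also have "\<dots> = 0\<^sub>v m" using L by (simp add: Ax mult_mat_zero_vec[of _ m m] del: index_mult_mat_vec)
    finally have "mat_adjoint A *\<^sub>v (H *\<^sub>v x) = 0\<^sub>v m" .
    moreover have "c \<cdot>\<^sub>v 0\<^sub>v m = 0\<^sub>v m" by (intro eq_vecI) auto
    ultimately show ?thesis
      using Aa x H Ax by (simp add: R_def mult_minus_distrib_mat_vec[of _ m n] mult_mat_vec[of _ m n]
          del: index_mult_mat_vec)
  qed
  have orth: "(A *\<^sub>v y) \<bullet>c x = 0"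
    if "y \<in> carrier_vec m" "x \<in> carrier_vec n" "mat_adjoint A *\<^sub>v x = 0\<^sub>v m" for x y
    using cscalar_prod_adjoint[OF A that(1,2)] that by simp
  define w where "w = b - E b"
  have w: "w \<in> carrier_vec n" "mat_adjoint A *\<^sub>v w = 0\<^sub>v m" using E[OF b] b by (auto simp: w_def)
  have bsum: "b = E b + w" using b E(1)[OF b] by (auto simp: w_def)
  \<comment> \<open>An eigenvector \<open>u\<close> met by \<open>w\<close> need not lie in the
    complement, but its component \<open>v\<close> there satisfies the same eigenvalue equation and
    is nonzero, so \<open>gap\<close> is applied to \<open>v\<close> instead of
    \<open>u\<close>.\<close>
  have gap_w: "\<delta> \<le> cmod (of_real l - \<mu>)" if u: "eigenvector H u \<mu>" and wu: "w \<bullet>c u \<noteq> 0" for u \<mu>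
  proof -
    have uc: "u \<in> carrier_vec n" "H *\<^sub>v u = \<mu> \<cdot>\<^sub>v u" using u H by (auto simp: eigenvector_def)
    define v where "v = u - E u"
    have v: "v \<in> carrier_vec n" "mat_adjoint A *\<^sub>v v = 0\<^sub>v m"
      using E[OF uc(1)] uc(1) by (auto simp: v_def)
    have usum: "u = E u + v" using uc(1) E(1)[OF uc(1)] by (auto simp: v_def)
    have zc: "mat_adjoint A *\<^sub>v u \<in> carrier_vec m" using Aa uc by auto
    have "w \<bullet>c E u = 0"
      using cscalar_prod_commute[OF E(1)[OF uc(1)] w(1)] orth[OF zc w] by (simp add: E_def)
    then have "w \<bullet>c u = w \<bullet>c v"
      using w v E(1)[OF uc(1)] by (subst usum) (simp add: conjugate_add_vec[of _ n] scalar_prod_add_distrib[of _ n])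
    then have v0: "v \<noteq> 0\<^sub>v n" using wu w by auto
    obtain y where y: "y \<in> carrier_vec m" "R \<mu> (E u) = A *\<^sub>v y" using RE[OF uc(1)] by blast
    have "R \<mu> u = 0\<^sub>v n" using uc by (simp add: R_def)
    then have sum0: "A *\<^sub>v y + R \<mu> v = 0\<^sub>v n"
      using Radd[OF E(1)[OF uc(1)] v(1), of \<mu>] y usum by simp
    \<comment> \<open>The vanishing residual of \<open>u\<close> is an orthogonal sum of a term in
      the column span and a term in the complement, so both terms vanish.\<close>
    have "(vec_norm2 (A *\<^sub>v y + R \<mu> v))\<^sup>2 = (vec_norm2 (A *\<^sub>v y))\<^sup>2 + (vec_norm2 (R \<mu> v))\<^sup>2"
      using A y(1) by (intro vec_norm2_Pythagoras[OF _ Rc[OF v(1)] orth[OF y(1) Rc[OF v(1)] Rperp[OF v]]]) auto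
    then have "0 = (vec_norm2 (A *\<^sub>v y))\<^sup>2 + (vec_norm2 (R \<mu> v))\<^sup>2"
      unfolding sum0 by simp
    then have "(vec_norm2 (R \<mu> v))\<^sup>2 \<le> 0" using zero_le_power2[of "vec_norm2 (A *\<^sub>v y)"] by linarith
    then have "vec_norm2 (R \<mu> v) = 0" by simp
    then have "R \<mu> v = 0\<^sub>v n" using vec_norm2_eq_0[OF Rc[OF v(1)]] by simp
    then have "H *\<^sub>v v = \<mu> \<cdot>\<^sub>v v"
      using v H unfolding R_def by (auto simp: vec_eq_iff simp del: index_mult_mat_vec)
    then have "eigenvector H v \<mu>" using H v v0 by (auto simp: eigenvector_def)
    then show ?thesis using gap v(2) by blast
  qed
  have Eb: "vec_norm2 (E b) = vec_norm2 (mat_adjoint A *\<^sub>v b)"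
    unfolding E_def using Aa b by (intro isometry_norm[OF A iso]) auto
  have zb: "mat_adjoint A *\<^sub>v b \<in> carrier_vec m" using Aa b by auto
  have "(vec_norm2 b)\<^sup>2 = (vec_norm2 (E b))\<^sup>2 + (vec_norm2 w)\<^sup>2"
    using vec_norm2_Pythagoras[OF E(1)[OF b] w(1)] orth[OF zb w] bsum by (simp add: E_def)
  then have "\<delta>\<^sup>2 * ((vec_norm2 b)\<^sup>2 - (vec_norm2 (mat_adjoint A *\<^sub>v b))\<^sup>2) = \<delta>\<^sup>2 * (vec_norm2 w)\<^sup>2"
    by (simp add: Eb)
  also have "\<dots> \<le> (vec_norm2 (R (of_real l) w))\<^sup>2"
    unfolding R_def by (rule hermitian_shift_lower_bound[OF H herm w(1) \<open>0 \<le> \<delta>\<close> gap_w])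
  also have "\<dots> \<le> (vec_norm2 (R (of_real l) b))\<^sup>2"
  proof -
    obtain y where y: "y \<in> carrier_vec m" "R (of_real l) (E b) = A *\<^sub>v y" using RE[OF b] by blast
    have "R (of_real l) b = A *\<^sub>v y + R (of_real l) w"
      using Radd[OF E(1)[OF b] w(1), of "of_real l"] bsum y by simp
    then show ?thesis
      using vec_norm2_Pythagoras[OF _ Rc[OF w(1)] orth[OF y(1) Rc[OF w(1)] Rperp[OF w]]] A y(1) by simp
  qed
  finally show ?thesis by (simp add: R_def)
qed

text \<open>The distance to an empty spectrum is infinite, and the quotient on the right is then 0.
  Quantifying over all real \<open>\<delta>\<close> up to \<open>\<Delta>\<close> keeps the analytic
  arguments in the reals; in the infinite case arbitrarily large \<open>\<delta>\<close> force
  \<open>x\<close> to be at most 0.\<close>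

lemma ereal_le_divide_square:
  fixes \<Delta> :: ereal
  assumes "0 < \<Delta>" and bound: "\<And>\<delta>. 0 \<le> \<delta> \<Longrightarrow> ereal \<delta> \<le> \<Delta> \<Longrightarrow> \<delta>\<^sup>2 * x \<le> y"
  shows "ereal x \<le> ereal y / \<Delta>\<^sup>2"
proof (cases \<Delta>)
  case (real r)
  then have "0 < r" "r\<^sup>2 * x \<le> y" using assms by auto
  then have "x \<le> y / r\<^sup>2" by (simp add: pos_le_divide_eq mult.commute)
  moreover have "ereal y / \<Delta>\<^sup>2 = ereal (y / r\<^sup>2)"
    using \<open>0 < r\<close> real by (simp add: divide_ereal_def power2_eq_square divide_inverse)
  ultimately show ?thesis by simp
next
  case PInf
  have "x \<le> 0"
  proof (rule ccontr)
    assume "\<not> x \<le> 0"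
    then have x: "0 < x" by simp
    \<comment> \<open>Chosen so that the left-hand side of \<open>bound\<close> equals |y| + 1,
      which exceeds y.\<close>
    let ?\<delta> = "sqrt ((\<bar>y\<bar> + 1) / x)"
    have "?\<delta>\<^sup>2 * x \<le> y" using bound[of ?\<delta>] PInf x by simp
    moreover have "?\<delta>\<^sup>2 * x = \<bar>y\<bar> + 1" using x by simp
    ultimately show False by simp
  qed
  then show ?thesis using PInf by (simp add: power2_eq_square zero_ereal_def[symmetric])
qed (use assms in simp)

lemma spec_dist_le:
  assumes "ereal \<delta> \<le> spec_dist l X" and "\<mu> \<in> X"
  shows "\<delta> \<le> cmod (of_real l - \<mu>)"
proof -
  have "ereal \<delta> \<le> ereal (cmod (of_real l - \<mu>))"
    using assms(1) unfolding spec_dist_def by (rule order_trans) (rule INF_lower[OF assms(2)])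
  then show ?thesis by simp
qed

section \<open>Polynomials of a compressed operator\<close>

lemma poly_on_carrier [simp]: "A \<in> carrier_mat n n \<Longrightarrow> poly_on Q f A \<in> carrier_mat n n"
  by (auto simp: poly_on_def)

lemma mult_mat_vec_index_sum:
  assumes "M \<in> carrier_mat n m" "x \<in> carrier_vec m" "i < n"
  shows "(M *\<^sub>v x) $ i = (\<Sum>j<m. M $$ (i, j) * x $ j)"
  using assms by (simp add: scalar_prod_def atLeast0LessThan)

lemma poly_on_mult_vec_index:
  assumes A: "A \<in> carrier_mat n n" and Q: "Q \<in> carrier_mat n n" and x: "x \<in> carrier_vec n"
    and i: "i < n"
  shows "(poly_on Q f A *\<^sub>v x) $ i =
    (\<Sum>k\<le>degree f. complex_of_real (coeff f k) * (Q *\<^sub>v (A ^\<^sub>m k *\<^sub>v x)) $ i)"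
proof -
  have Ak: "A ^\<^sub>m k \<in> carrier_mat n n" for k using A by simp
  have "(poly_on Q f A *\<^sub>v x) $ i =
      (\<Sum>j<n. (\<Sum>k\<le>degree f. complex_of_real (coeff f k) * (Q * A ^\<^sub>m k) $$ (i, j)) * x $ j)"
    using A x i by (simp add: poly_on_def scalar_prod_def atLeast0LessThan)
  also have "\<dots> = (\<Sum>k\<le>degree f. \<Sum>j<n. complex_of_real (coeff f k) * (Q * A ^\<^sub>m k) $$ (i, j) * x $ j)"
    unfolding sum_distrib_right by (rule sum.swap)
  also have "\<dots> = (\<Sum>k\<le>degree f. complex_of_real (coeff f k) * ((Q * A ^\<^sub>m k) *\<^sub>v x) $ i)"
  proof (rule sum.cong[OF refl])
    fix k
    have "((Q * A ^\<^sub>m k) *\<^sub>v x) $ i = (\<Sum>j<n. (Q * A ^\<^sub>m k) $$ (i, j) * x $ j)"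
      by (rule mult_mat_vec_index_sum[OF mult_carrier_mat[OF Q Ak] x i])
    then show "(\<Sum>j<n. complex_of_real (coeff f k) * (Q * A ^\<^sub>m k) $$ (i, j) * x $ j)
        = complex_of_real (coeff f k) * ((Q * A ^\<^sub>m k) *\<^sub>v x) $ i"
      by (simp only: sum_distrib_left mult.assoc)
  qed
  also have "\<dots> = (\<Sum>k\<le>degree f. complex_of_real (coeff f k) * (Q *\<^sub>v (A ^\<^sub>m k *\<^sub>v x)) $ i)"
    by (simp only: assoc_mult_mat_vec[OF Q Ak x])
  finally show ?thesis .
qed

text \<open>Every term of \<open>poly_on\<close> carries the factor \<open>Q\<close> on the left,
  the constant one included. Hence the right-hand side contains \<open>Q *\<^sub>v u\<close> and not
  \<open>u\<close>: an eigenbasis of an operator extended by zero may contain vectors outside the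
  range of \<open>Q\<close>.\<close>

lemma poly_on_eigenvector:
  fixes A Q :: "complex mat"
  assumes A: "A \<in> carrier_mat n n" and Q: "Q \<in> carrier_mat n n" and u: "u \<in> carrier_vec n"
    and eig: "A *\<^sub>v u = complex_of_real a \<cdot>\<^sub>v u"
  shows "poly_on Q f A *\<^sub>v u = complex_of_real (poly f a) \<cdot>\<^sub>v (Q *\<^sub>v u)"
proof (rule eq_vecI)
  have pow: "A ^\<^sub>m k *\<^sub>v u = complex_of_real (a ^ k) \<cdot>\<^sub>v u" for k
  proof (induction k)
    case 0
    then show ?case using A u by simp
  next
    case (Suc k)
    have "A ^\<^sub>m Suc k *\<^sub>v u = A ^\<^sub>m k *\<^sub>v (A *\<^sub>v u)"
      using assoc_mult_mat_vec[of "A ^\<^sub>m k" n n A n u] A u by simp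
    also have "\<dots> = complex_of_real a \<cdot>\<^sub>v (A ^\<^sub>m k *\<^sub>v u)"
      unfolding eig using A u by (intro mult_mat_vec) auto
    finally show ?case by (simp add: Suc.IH smult_smult_assoc del: index_mult_mat_vec)
  qed
  fix i assume "i < dim_vec (complex_of_real (poly f a) \<cdot>\<^sub>v (Q *\<^sub>v u))"
  then have i: "i < n" using Q by simp
  have Qp: "(Q *\<^sub>v (A ^\<^sub>m k *\<^sub>v u)) $ i = complex_of_real (a ^ k) * (Q *\<^sub>v u) $ i" for k
    unfolding pow mult_mat_vec[OF Q u] using Q i by (simp del: index_mult_mat_vec)
  have "(poly_on Q f A *\<^sub>v u) $ i =
      (\<Sum>k\<le>degree f. complex_of_real (coeff f k) * (complex_of_real (a ^ k) * (Q *\<^sub>v u) $ i))"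
    unfolding poly_on_mult_vec_index[OF A Q u i] Qp ..
  also have "\<dots> = complex_of_real (poly f a) * (Q *\<^sub>v u) $ i"
    unfolding poly_altdef of_real_sum sum_distrib_right of_real_mult mult.assoc ..
  finally show "(poly_on Q f A *\<^sub>v u) $ i = (complex_of_real (poly f a) \<cdot>\<^sub>v (Q *\<^sub>v u)) $ i"
    using Q i by (simp del: index_mult_mat_vec)
qed (use A Q in \<open>auto simp: poly_on_def\<close>)

lemma proj_mult_poly_on:
  fixes A Q :: "complex mat"
  assumes A: "A \<in> carrier_mat n n" and Q: "Q \<in> carrier_mat n n" and QQ: "Q * Q = Q"
    and x: "x \<in> carrier_vec n"
  shows "Q *\<^sub>v (poly_on Q f A *\<^sub>v x) = poly_on Q f A *\<^sub>v x"
proof (rule eq_vecI)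
  let ?c = "\<lambda>k. complex_of_real (coeff f k)"
  let ?y = "\<lambda>k. Q *\<^sub>v (A ^\<^sub>m k *\<^sub>v x)"
  have Akx: "A ^\<^sub>m k *\<^sub>v x \<in> carrier_vec n" for k
    by (rule mult_mat_vec_carrier[OF pow_carrier_mat[OF A] x])
  have y: "?y k \<in> carrier_vec n" for k by (rule mult_mat_vec_carrier[OF Q Akx])
  have Qy: "Q *\<^sub>v ?y k = ?y k" for k
    using assoc_mult_mat_vec[OF Q Q Akx, of k] QQ by simp
  fix i assume "i < dim_vec (poly_on Q f A *\<^sub>v x)"
  then have i: "i < n" using A by (simp add: poly_on_def)
  have "(Q *\<^sub>v (poly_on Q f A *\<^sub>v x)) $ i = (\<Sum>j<n. Q $$ (i, j) * (poly_on Q f A *\<^sub>v x) $ j)"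
    using Q A i by (simp add: scalar_prod_def atLeast0LessThan poly_on_def)
  also have "\<dots> = (\<Sum>j<n. Q $$ (i, j) * (\<Sum>k\<le>degree f. ?c k * ?y k $ j))"
    by (rule sum.cong[OF refl]) (simp add: poly_on_mult_vec_index[OF A Q x] del: index_mult_mat_vec)
  also have "\<dots> = (\<Sum>j<n. \<Sum>k\<le>degree f. ?c k * (Q $$ (i, j) * ?y k $ j))"
    by (simp only: sum_distrib_left mult.left_commute)
  also have "\<dots> = (\<Sum>k\<le>degree f. \<Sum>j<n. ?c k * (Q $$ (i, j) * ?y k $ j))"
    by (rule sum.swap)
  also have "\<dots> = (\<Sum>k\<le>degree f. ?c k * (Q *\<^sub>v ?y k) $ i)"
  proof (rule sum.cong[OF refl])
    fix k
    from mult_mat_vec_index_sum[OF Q y i] show "(\<Sum>j<n. ?c k * (Q $$ (i, j) * ?y k $ j)) = ?c k * (Q *\<^sub>v ?y k) $ i"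
      by (simp only: sum_distrib_left)
  qed
  also have "\<dots> = (poly_on Q f A *\<^sub>v x) $ i"
    unfolding Qy by (rule poly_on_mult_vec_index[OF A Q x i, symmetric])
  finally show "(Q *\<^sub>v (poly_on Q f A *\<^sub>v x)) $ i = (poly_on Q f A *\<^sub>v x) $ i" .
qed (use A Q in \<open>auto simp: poly_on_def\<close>)

text \<open>A nonzero vector in the range of \<open>Q\<close> has a nonzero coefficient along some
  eigenvector, which therefore has a nonzero component in that range. It serves to find at least one
  eigenvalue to which a pointwise error bound applies, so that the bound is seen to be
  nonnegative.\<close>

lemma hermitian_eigenvector_meets_projector:
  fixes A Q :: "complex mat"
  assumes A: "A \<in> carrier_mat n n" "mat_adjoint A = A" and Q: "Q \<in> carrier_mat n n" "mat_adjoint Q = Q"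
    and w: "w \<in> carrier_vec n" "Q *\<^sub>v w = w" "w \<noteq> 0\<^sub>v n"
  obtains u a where "u \<in> carrier_vec n" "A *\<^sub>v u = complex_of_real a \<cdot>\<^sub>v u" "Q *\<^sub>v u \<noteq> 0\<^sub>v n"
proof -
  obtain U e where U: "unitary_mat n U"
    and eig: "\<And>j. j < n \<Longrightarrow> A *\<^sub>v col U j = complex_of_real (e j) \<cdot>\<^sub>v col U j"
    using hermitian_eigenbasis[OF A] by blast
  have "(vec_norm2 w)\<^sup>2 \<noteq> 0" using vec_norm2_eq_0[OF w(1)] w(3) by simp
  then obtain j where j: "j < n" "w \<bullet>c col U j \<noteq> 0"
    unfolding Parseval[OF U w(1), symmetric] by (force intro: sum.neutral)
  have "w \<bullet>c (Q *\<^sub>v col U j) \<noteq> 0"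
    using cscalar_prod_adjoint[OF Q(1) w(1) eigenbasis_col(1)[OF U j(1)]] Q(2) w(2) j(2) by simp
  then have "Q *\<^sub>v col U j \<noteq> 0\<^sub>v n" using w(1) by auto
  then show ?thesis using that eig j(1) eigenbasis_col(1)[OF U j(1)] by blast
qed

text \<open>\<open>1 - A f(A)\<close> is diagonal in an eigenbasis of \<open>A\<close>, with entries
  \<open>1 - a * poly f a\<close>; here \<open>A * Q = A\<close> removes the factor \<open>Q\<close>
  that \<open>poly_on\<close> introduces. The bound is demanded only for eigenvectors that meet the
  range of \<open>Q\<close>, because \<open>A\<close> has the eigenvalue 0 on the kernel of
  \<open>Q\<close>, where the entry is 1.\<close>

lemma approximate_inverse_bound:
  fixes A Q :: "complex mat"
  assumes A: "A \<in> carrier_mat n n" "mat_adjoint A = A" and Q: "Q \<in> carrier_mat n n" "mat_adjoint Q = Q"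
    and AQ: "A * Q = A" and w: "w \<in> carrier_vec n" "Q *\<^sub>v w = w"
    and bound: "\<And>u a. u \<in> carrier_vec n \<Longrightarrow> A *\<^sub>v u = complex_of_real a \<cdot>\<^sub>v u \<Longrightarrow> Q *\<^sub>v u \<noteq> 0\<^sub>v n
      \<Longrightarrow> \<bar>1 - a * poly f a\<bar> \<le> \<kappa>"
  shows "vec_norm2 (w - A *\<^sub>v (poly_on Q f A *\<^sub>v w)) \<le> \<kappa> * vec_norm2 w"
proof (cases "w = 0\<^sub>v n")
  case True
  have "A *\<^sub>v (poly_on Q f A *\<^sub>v 0\<^sub>v n) = 0\<^sub>v n"
    using A(1) by (simp only: mult_mat_zero_vec[OF poly_on_carrier[OF A(1)]] mult_mat_zero_vec[OF A(1)])
  then show ?thesis using True by simp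
next
  case False
  \<comment> \<open>\<open>\<kappa>\<close> carries no sign assumption; a nonzero \<open>w\<close>
    yields an eigenvector to which \<open>bound\<close> applies, and an absolute value below
    \<open>\<kappa>\<close> settles the sign.\<close>
  obtain u a where "u \<in> carrier_vec n" "A *\<^sub>v u = complex_of_real a \<cdot>\<^sub>v u" "Q *\<^sub>v u \<noteq> 0\<^sub>v n"
    by (rule hermitian_eigenvector_meets_projector[OF A Q w False])
  from bound[OF this] have \<kappa>: "0 \<le> \<kappa>" by linarith
  obtain U e where U: "unitary_mat n U"
    and eig: "\<And>j. j < n \<Longrightarrow> A *\<^sub>v col U j = complex_of_real (e j) \<cdot>\<^sub>v col U j"
    using hermitian_eigenbasis[OF A] by blast
  define T where "T = poly_on Q f A"
  have T: "T \<in> carrier_mat n n" using A by (simp add: T_def)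
  define M where "M = 1\<^sub>m n - A * T"
  have M: "M \<in> carrier_mat n n" using A T by (auto simp: M_def)
  have Mv: "M *\<^sub>v v = v - A *\<^sub>v (T *\<^sub>v v)" if "v \<in> carrier_vec n" for v
    unfolding M_def using minus_mult_distrib_mat_vec[OF _ mult_carrier_mat[OF A(1) T] that, of "1\<^sub>m n"]
      assoc_mult_mat_vec[OF A(1) T that] that by simp
  have eigM: "M *\<^sub>v col U j = complex_of_real (1 - e j * poly f (e j)) \<cdot>\<^sub>v col U j" if j: "j < n" for j
  proof -
    let ?u = "col U j"
    have u: "?u \<in> carrier_vec n" by (rule eigenbasis_col(1)[OF U j])
    have "A *\<^sub>v (T *\<^sub>v ?u) = complex_of_real (poly f (e j)) \<cdot>\<^sub>v (A *\<^sub>v (Q *\<^sub>v ?u))"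
      unfolding T_def poly_on_eigenvector[OF A(1) Q(1) u eig[OF j]]
      using Q u by (intro mult_mat_vec[OF A(1)]) auto
    also have "A *\<^sub>v (Q *\<^sub>v ?u) = complex_of_real (e j) \<cdot>\<^sub>v ?u"
      using assoc_mult_mat_vec[OF A(1) Q(1) u] AQ eig[OF j] by simp
    finally show ?thesis
      unfolding Mv[OF u] using u by (intro eq_vecI) (auto simp: algebra_simps)
  qed
  have "(vec_norm2 (M *\<^sub>v w))\<^sup>2 =
      (\<Sum>j<n. (cmod (complex_of_real (1 - e j * poly f (e j))))\<^sup>2 * (cmod (w \<bullet>c col U j))\<^sup>2)"
    by (rule eigenbasis_norm[OF U M eigM w(1)])
  also have "\<dots> \<le> (\<Sum>j<n. \<kappa>\<^sup>2 * (cmod (w \<bullet>c col U j))\<^sup>2)"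
  proof (rule sum_mono)
    fix j assume "j \<in> {..<n}"
    then have j: "j < n" by simp
    note u = eigenbasis_col(1)[OF U j]
    show "(cmod (complex_of_real (1 - e j * poly f (e j))))\<^sup>2 * (cmod (w \<bullet>c col U j))\<^sup>2
        \<le> \<kappa>\<^sup>2 * (cmod (w \<bullet>c col U j))\<^sup>2"
    proof (cases "w \<bullet>c col U j = 0")
      case False
      then have "w \<bullet>c (Q *\<^sub>v col U j) \<noteq> 0"
        using cscalar_prod_adjoint[OF Q(1) w(1) u] Q(2) w(2) by simp
      then have "Q *\<^sub>v col U j \<noteq> 0\<^sub>v n" using w(1) by auto
      from bound[OF u eig[OF j] this]
      have "\<bar>1 - e j * poly f (e j)\<bar> \<le> \<bar>\<kappa>\<bar>" by simp
      then have "(1 - e j * poly f (e j))\<^sup>2 \<le> \<kappa>\<^sup>2" by (rule abs_le_square_iff[THEN iffD1])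
      then show ?thesis by (intro mult_right_mono) (auto simp only: norm_of_real power2_abs zero_le_power2)
    qed simp
  qed
  also have "\<dots> = (\<kappa> * vec_norm2 w)\<^sup>2"
    by (simp add: Parseval[OF U w(1), symmetric] sum_distrib_left power_mult_distrib)
  finally have "vec_norm2 (M *\<^sub>v w) \<le> \<kappa> * vec_norm2 w"
    by (rule power2_le_imp_le) (use \<kappa> in simp)
  then show ?thesis by (simp only: Mv[OF w(1)] T_def)
qed

lemma orth_projector_facts:
  assumes "orth_projector n d P"
  defines "Q \<equiv> compl_proj P"
  shows "P \<in> carrier_mat n n" "mat_adjoint P = P" "P * P = P"
    "Q \<in> carrier_mat n n" "mat_adjoint Q = Q" "Q * Q = Q" "P * Q = 0\<^sub>m n n"
    "\<And>v. v \<in> carrier_vec n \<Longrightarrow> Q *\<^sub>v v = v - P *\<^sub>v v"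
proof -
  show P: "P \<in> carrier_mat n n" and Pa: "mat_adjoint P = P" and PP: "P * P = P"
    using assms by (auto simp: orth_projector_def hermitian_mat_def)
  have Qd: "Q = 1\<^sub>m n - P" using P by (simp add: Q_def compl_proj_def)
  show Q: "Q \<in> carrier_mat n n" unfolding Qd by (rule minus_carrier_mat[OF P])
  show "mat_adjoint Q = Q" unfolding Qd using P Pa by (simp add: mat_adjoint_minus[of _ n n])
  show PQ: "P * Q = 0\<^sub>m n n" unfolding Qd using P PP by (simp add: mult_minus_distrib_mat[of _ n n _ n])
  have "Q * Q = 1\<^sub>m n * Q - P * Q" unfolding Qd using P by (intro minus_mult_distrib_mat) auto
  also have "\<dots> = Q" unfolding PQ using Q by (intro eq_matI) auto
  finally show "Q * Q = Q" .
  show "Q *\<^sub>v v = v - P *\<^sub>v v" if "v \<in> carrier_vec n" for v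
    unfolding Qd using P that by (simp add: minus_mult_distrib_mat_vec[of _ n n])
qed

section \<open>The residual of the approximate wave operator\<close>

lemma H_QQ_mult_vec:
  assumes proj: "orth_projector n d P" and H: "H \<in> carrier_mat n n" and v: "v \<in> carrier_vec n"
  shows "H_QQ H P *\<^sub>v v = compl_proj P *\<^sub>v (H *\<^sub>v (compl_proj P *\<^sub>v v))"
proof -
  note pf = orth_projector_facts[OF proj]
  show ?thesis
    unfolding H_QQ_def assoc_mult_mat_vec[OF mult_carrier_mat[OF pf(4) H] pf(4) v]
    by (rule assoc_mult_mat_vec[OF pf(4) H mult_mat_vec_carrier[OF pf(4) v]])
qed

text \<open>The shift subtracts \<open>l\<close> times \<open>Q\<close> and not \<open>l\<close>
  times the identity, so \<open>A\<close> is the zero extension of an operator on the range of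
  \<open>Q\<close>. The absorption laws \<open>A * Q = A\<close> and \<open>Q * A = A\<close>
  express this and let eigenvectors of \<open>A\<close> be projected to that range.\<close>

lemma H_QQ_shift_facts:
  fixes l :: real
  assumes proj: "orth_projector n d P" and H: "H \<in> carrier_mat n n" "mat_adjoint H = H"
  defines "Q \<equiv> compl_proj P" and "A \<equiv> H_QQ_shift H P l"
  shows "A \<in> carrier_mat n n" "mat_adjoint A = A" "A * Q = A" "Q * A = A"
    "\<And>v. v \<in> carrier_vec n \<Longrightarrow>
      A *\<^sub>v v = Q *\<^sub>v (H *\<^sub>v (Q *\<^sub>v v)) - complex_of_real l \<cdot>\<^sub>v (Q *\<^sub>v v)"
proof -
  note pf = orth_projector_facts[OF proj, folded Q_def]
  have QHQ: "H_QQ H P = Q * H * Q" by (simp add: H_QQ_def Q_def)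
  have c: "H_QQ H P \<in> carrier_mat n n" unfolding QHQ using pf(4) H(1) by auto
  have Ad: "A = H_QQ H P - complex_of_real l \<cdot>\<^sub>m Q" by (simp add: A_def H_QQ_shift_def Q_def)
  have lQ: "complex_of_real l \<cdot>\<^sub>m Q \<in> carrier_mat n n" using pf(4) by simp
  show A: "A \<in> carrier_mat n n" unfolding Ad by (rule minus_carrier_mat[OF lQ])
  have QH: "Q * H \<in> carrier_mat n n" by (rule mult_carrier_mat[OF pf(4) H(1)])
  have "mat_adjoint (H_QQ H P) = Q * (H * Q)"
    unfolding QHQ mat_adjoint_mult[OF QH pf(4)] mat_adjoint_mult[OF pf(4) H(1)] pf(5) H(2) ..
  also have "\<dots> = H_QQ H P" unfolding QHQ by (rule assoc_mult_mat[OF pf(4) H(1) pf(4), symmetric])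
  finally show "mat_adjoint A = A"
    unfolding Ad mat_adjoint_minus[OF c lQ] mat_adjoint_smult pf(5) by simp
  have "H_QQ H P * Q = H_QQ H P"
    unfolding QHQ assoc_mult_mat[OF QH pf(4) pf(4)] pf(6) ..
  then show "A * Q = A"
    unfolding Ad minus_mult_distrib_mat[OF c lQ pf(4)] mult_smult_assoc_mat[OF pf(4) pf(4)] pf(6)
    by simp
  have "Q * H_QQ H P = H_QQ H P"
    unfolding QHQ assoc_mult_mat[OF pf(4) H(1) pf(4)]
      assoc_mult_mat[OF pf(4) pf(4) mult_carrier_mat[OF H(1) pf(4)], symmetric] pf(6) ..
  then show "Q * A = A"
    unfolding Ad mult_minus_distrib_mat[OF pf(4) c lQ] mult_smult_distrib[OF pf(4) pf(4)] pf(6)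
    by simp
  show "A *\<^sub>v v = Q *\<^sub>v (H *\<^sub>v (Q *\<^sub>v v)) - complex_of_real l \<cdot>\<^sub>v (Q *\<^sub>v v)"
    if v: "v \<in> carrier_vec n" for v
  proof -
    have "(complex_of_real l \<cdot>\<^sub>m Q) *\<^sub>v v = complex_of_real l \<cdot>\<^sub>v (Q *\<^sub>v v)"
      using pf(4) v by (intro eq_vecI) (auto simp: row_smult)
    then show ?thesis
      unfolding Ad minus_mult_distrib_mat_vec[OF c lQ v] by (simp only: H_QQ_mult_vec[OF proj H(1) v, folded Q_def])
  qed
qed

text \<open>On the eigenvalues \<open>a\<close> that meet the range of \<open>Q\<close>, the safe region gives
  \<open>g / 2 \<le> \<bar>a\<bar> \<le> \<alpha>\<^sub>W l\<close>, so the polynomial approximates \<open>1 / a\<close> there.\<close>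

lemma approx_setting_polynomial:
  assumes ap: "approx_setting c\<alpha> n d H P g \<alpha> \<alpha>\<^sub>W f \<epsilon>f \<epsilon>est Hhat W" and l: "l \<in> W"
    and u: "u \<in> carrier_vec n" and eig: "H_QQ_shift H P l *\<^sub>v u = complex_of_real a \<cdot>\<^sub>v u"
    and Qu: "compl_proj P *\<^sub>v u \<noteq> 0\<^sub>v n"
  shows "0 \<le> \<epsilon>f" "\<bar>1 - a * poly f a\<bar> \<le> c\<alpha> * \<alpha> * \<epsilon>f"
proof -
  define Q where "Q = compl_proj P"
  define A where "A = H_QQ_shift H P l"
  have H: "H \<in> carrier_mat n n" "mat_adjoint H = H" and proj: "orth_projector n d P"
    and g: "0 < g"
    and gap: "ereal (g / 2) \<le> spec_dist l (spectrum_on (H_QQ H P) (column_span Q))"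
    and aW: "\<alpha>\<^sub>W l \<le> c\<alpha> * \<alpha>" and opA: "op_norm A \<le> \<alpha>\<^sub>W l"
    and approx: "\<forall>x \<in> {- \<alpha>\<^sub>W l .. \<alpha>\<^sub>W l} - {- (g / 2) <..< g / 2}. \<bar>poly f x - 1 / x\<bar> \<le> \<epsilon>f"
    using ap l by (auto simp: approx_setting_def hermitian_mat_def Q_def A_def)
  note pf = orth_projector_facts[OF proj, folded Q_def]
  note A = H_QQ_shift_facts[OF proj H, where l = l, folded Q_def A_def]
  \<comment> \<open>An eigenvector of the zero extension may have a part outside the range of
    \<open>Q\<close>. Since \<open>A\<close> commutes with \<open>Q\<close>, its projection is an
    eigenvector for the same \<open>a\<close> inside the range, and the safe region speaks about the
    eigenvalue \<open>l + a\<close> of the block.\<close>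
  define v where "v = Q *\<^sub>v u"
  have v: "v \<in> carrier_vec n" "v \<noteq> 0\<^sub>v n" using pf(4) u Qu by (auto simp: v_def Q_def)
  have Qv: "Q *\<^sub>v v = v"
    unfolding v_def using assoc_mult_mat_vec[OF pf(4) pf(4) u] pf(6) by simp
  have Av: "A *\<^sub>v v = complex_of_real a \<cdot>\<^sub>v v"
  proof -
    have Au: "A *\<^sub>v u = complex_of_real a \<cdot>\<^sub>v u" using eig by (simp add: A_def)
    have "A *\<^sub>v v = A *\<^sub>v u"
      unfolding v_def using assoc_mult_mat_vec[OF A(1) pf(4) u] A(3) by simp
    also have "\<dots> = Q *\<^sub>v (A *\<^sub>v u)"
      using assoc_mult_mat_vec[OF pf(4) A(1) u] A(4) by simp
    also have "\<dots> = complex_of_real a \<cdot>\<^sub>v v"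
      unfolding Au v_def by (rule mult_mat_vec[OF pf(4) u])
    finally show ?thesis .
  qed
  have "H_QQ H P *\<^sub>v v = complex_of_real (l + a) \<cdot>\<^sub>v v"
  proof -
    have c: "H_QQ H P *\<^sub>v v \<in> carrier_vec n"
      unfolding H_QQ_mult_vec[OF proj H(1) v(1), folded Q_def] using pf(4) H(1) v(1) by auto
    have "H_QQ H P *\<^sub>v v - complex_of_real l \<cdot>\<^sub>v v = complex_of_real a \<cdot>\<^sub>v v"
      using A(5)[OF v(1)] H_QQ_mult_vec[OF proj H(1) v(1), folded Q_def] Av Qv by simp
    then have "(H_QQ H P *\<^sub>v v - complex_of_real l \<cdot>\<^sub>v v) + complex_of_real l \<cdot>\<^sub>v v
        = complex_of_real a \<cdot>\<^sub>v v + complex_of_real l \<cdot>\<^sub>v v" by simp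
    moreover have "(x - y) + y = x" if "x \<in> carrier_vec n" "y \<in> carrier_vec n" for x y :: "complex vec"
      using that by (intro eq_vecI) auto
    ultimately show ?thesis
      using c v(1) by (simp add: add_smult_distrib_vec add.commute del: index_mult_mat_vec)
  qed
  moreover have "dim_row (H_QQ H P) = n" using pf(4) by (simp add: H_QQ_def Q_def)
  ultimately have "eigenvector (H_QQ H P) v (of_real (l + a))"
    using v by (simp add: eigenvector_def)
  moreover have "v \<in> column_span Q" using pf(4) u by (auto simp: column_span_def v_def)
  ultimately have "of_real (l + a) \<in> spectrum_on (H_QQ H P) (column_span Q)"
    by (auto simp: spectrum_on_def)
  from spec_dist_le[OF gap this] have ga: "g / 2 \<le> \<bar>a\<bar>"
    by (simp flip: of_real_diff)
  have "\<bar>a\<bar> * vec_norm2 v \<le> \<alpha>\<^sub>W l * vec_norm2 v"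
    using op_norm_bound[OF A(1) v(1)] opA mult_right_mono[OF opA vec_norm2_nonneg[of v]]
    by (simp add: Av vec_norm2_smult)
  moreover have "0 < vec_norm2 v" using vec_norm2_eq_0[OF v(1)] v(2) vec_norm2_nonneg[of v] by linarith
  ultimately have aa: "\<bar>a\<bar> \<le> \<alpha>\<^sub>W l" by simp
  have "a \<in> {- \<alpha>\<^sub>W l .. \<alpha>\<^sub>W l} - {- (g / 2) <..< g / 2}"
    using ga aa by (auto simp: abs_if split: if_splits)
  with approx have "\<bar>poly f a - 1 / a\<bar> \<le> \<epsilon>f" by blast
  then show e: "0 \<le> \<epsilon>f" by linarith
  have a0: "a \<noteq> 0" using ga g by auto
  \<comment> \<open>The error of \<open>f\<close> at \<open>a\<close> is multiplied by
    \<open>a\<close>, whose modulus is at most the normalization; this is the origin of the factor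
    \<open>\<alpha>\<close> in the total error.\<close>
  have "1 - a * poly f a = - (a * (poly f a - 1 / a))" using a0 by (simp add: algebra_simps)
  then have "\<bar>1 - a * poly f a\<bar> = \<bar>a\<bar> * \<bar>poly f a - 1 / a\<bar>" by (simp add: abs_mult)
  also have "\<dots> \<le> (c\<alpha> * \<alpha>) * \<epsilon>f"
    using \<open>\<bar>poly f a - 1 / a\<bar> \<le> \<epsilon>f\<close> aa aW by (intro mult_mono) auto
  finally show "\<bar>1 - a * poly f a\<bar> \<le> c\<alpha> * \<alpha> * \<epsilon>f" .
qed

section \<open>The off-diagonal block and the sign of its error term\<close>

lemma H_QP_mult_vec:
  assumes proj: "orth_projector n d P" and H: "H \<in> carrier_mat n n" and v: "v \<in> carrier_vec n"
  shows "H_QP H P \<in> carrier_mat n n"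
    "H_QP H P *\<^sub>v v = compl_proj P *\<^sub>v (H *\<^sub>v (P *\<^sub>v v))"
    "compl_proj P *\<^sub>v (H_QP H P *\<^sub>v v) = H_QP H P *\<^sub>v v"
proof -
  note pf = orth_projector_facts[OF proj]
  have QH: "compl_proj P * H \<in> carrier_mat n n" by (rule mult_carrier_mat[OF pf(4) H])
  show "H_QP H P \<in> carrier_mat n n" unfolding H_QP_def by (rule mult_carrier_mat[OF QH pf(1)])
  have Pv: "P *\<^sub>v v \<in> carrier_vec n" by (rule mult_mat_vec_carrier[OF pf(1) v])
  show eq: "H_QP H P *\<^sub>v v = compl_proj P *\<^sub>v (H *\<^sub>v (P *\<^sub>v v))"
    unfolding H_QP_def assoc_mult_mat_vec[OF QH pf(1) v] by (rule assoc_mult_mat_vec[OF pf(4) H Pv])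
  show "compl_proj P *\<^sub>v (H_QP H P *\<^sub>v v) = H_QP H P *\<^sub>v v"
    unfolding eq assoc_mult_mat_vec[OF pf(4) pf(4) mult_mat_vec_carrier[OF H Pv], symmetric] pf(6) ..
qed

text \<open>\<open>\<epsilon>f\<close> has no sign hypothesis, and the approximation condition says
  nothing if its set of points is empty. A nonzero \<open>H_QP H P\<close> has a nonzero image
  vector in the range of \<open>Q\<close>, hence there is an eigenvalue of the block at which an
  absolute error is bounded by \<open>\<epsilon>f\<close>; otherwise the operator norm is 0.\<close>

lemma approx_setting_error_nonneg:
  assumes ap: "approx_setting c\<alpha> n d H P g \<alpha> \<alpha>\<^sub>W f \<epsilon>f \<epsilon>est Hhat W" and l: "l \<in> W"
  shows "0 \<le> op_norm (H_QP H P) * \<epsilon>f"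
proof (cases "\<exists>x\<in>carrier_vec n. H_QP H P *\<^sub>v x \<noteq> 0\<^sub>v n")
  case True
  then obtain x where x: "x \<in> carrier_vec n" "H_QP H P *\<^sub>v x \<noteq> 0\<^sub>v n" by blast
  have H: "H \<in> carrier_mat n n" "mat_adjoint H = H" and proj: "orth_projector n d P"
    using ap by (auto simp: approx_setting_def hermitian_mat_def)
  note A = H_QQ_shift_facts[OF proj H, where l = l]
  note pf = orth_projector_facts[OF proj]
  note hx = H_QP_mult_vec[OF proj H(1) x(1)]
  obtain u a where "u \<in> carrier_vec n" "H_QQ_shift H P l *\<^sub>v u = complex_of_real a \<cdot>\<^sub>v u"
    "compl_proj P *\<^sub>v u \<noteq> 0\<^sub>v n"
    by (rule hermitian_eigenvector_meets_projector[OF A(1,2) pf(4,5) mult_mat_vec_carrier[OF hx(1) x(1)] hx(3) x(2)])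
  from approx_setting_polynomial(1)[OF ap l this] show ?thesis by simp
next
  case False
  have H: "H \<in> carrier_mat n n" and proj: "orth_projector n d P"
    using ap by (auto simp: approx_setting_def)
  have c: "H_QP H P \<in> carrier_mat n n"
    by (rule H_QP_mult_vec(1)[OF proj H zero_carrier_vec])
  have "H_QP H P = 0\<^sub>m n n"
  proof (rule eq_matI)
    fix i j assume "i < dim_row (0\<^sub>m n n :: complex mat)" "j < dim_col (0\<^sub>m n n :: complex mat)"
    then have ij: "i < n" "j < n" by auto
    have "H_QP H P $$ (i, j) = (H_QP H P *\<^sub>v unit_vec n j) $ i" using c ij by simp
    also have "H_QP H P *\<^sub>v unit_vec n j = 0\<^sub>v n" using False by auto
    finally show "H_QP H P $$ (i, j) = 0\<^sub>m n n $$ (i, j)" using ij by simp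
  qed (use c in auto)
  then show ?thesis by (simp add: op_norm_zero_mat)
qed

text \<open>The component of the residual in the range of \<open>P\<close> is that of the effective Hamiltonian, while the
  component in the range of \<open>Q\<close> is \<open>(1 - A f(A)) H\<^sub>Q\<^sub>P \<phi>\<close> for the shifted block \<open>A\<close>.\<close>

lemma wave_op_residual:
  assumes c\<alpha>: "0 < c\<alpha>"
    and ap: "approx_setting c\<alpha> n d H P g \<alpha> \<alpha>\<^sub>W f \<epsilon>f \<epsilon>est Hhat W" and l: "l \<in> W"
    and \<phi>: "\<phi> \<in> carrier_vec n" and P\<phi>: "P *\<^sub>v \<phi> = \<phi>"
    and est: "vec_norm2 (Hhat l *\<^sub>v \<phi> - complex_of_real l \<cdot>\<^sub>v \<phi>) \<le> eps_app H P \<epsilon>est \<epsilon>f * vec_norm2 \<phi>"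
  shows "vec_norm2 (H *\<^sub>v wave_op H P f l \<phi> - complex_of_real l \<cdot>\<^sub>v wave_op H P f l \<phi>)
    \<le> max 1 c\<alpha> * eps_total H P \<alpha> \<epsilon>est \<epsilon>f * vec_norm2 \<phi>"
    and "P *\<^sub>v wave_op H P f l \<phi> = \<phi>"
proof -
  define Q where "Q = compl_proj P"
  define A where "A = H_QQ_shift H P l"
  define T where "T = poly_on Q f A"
  define s where "s = H_QP H P *\<^sub>v \<phi>"
  define z where "z = T *\<^sub>v s"
  have H: "H \<in> carrier_mat n n" "mat_adjoint H = H" and proj: "orth_projector n d P"
    and aW: "\<alpha>\<^sub>W l \<le> c\<alpha> * \<alpha>" and opA: "op_norm A \<le> \<alpha>\<^sub>W l"
    and Hh: "Hhat l \<in> carrier_mat n n" and opest: "op_norm (Hhat l - Heff_poly H P f l) \<le> \<epsilon>est"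
    using ap l by (auto simp: approx_setting_def hermitian_mat_def Q_def A_def)
  note pf = orth_projector_facts[OF proj, folded Q_def]
  note A = H_QQ_shift_facts[OF proj H, where l = l, folded Q_def A_def]
  note hqp = H_QP_mult_vec[OF proj H(1) \<phi>, folded Q_def]
  have T: "T \<in> carrier_mat n n" unfolding T_def by (rule poly_on_carrier[OF A(1)])
  have s: "s \<in> carrier_vec n" unfolding s_def by (rule mult_mat_vec_carrier[OF hqp(1) \<phi>])
  have z: "z \<in> carrier_vec n" unfolding z_def by (rule mult_mat_vec_carrier[OF T s])
  have Qs: "Q *\<^sub>v s = s" unfolding s_def by (rule hqp(3))
  have sH: "s = Q *\<^sub>v (H *\<^sub>v \<phi>)" unfolding s_def hqp(2) P\<phi> ..
  have Qz: "Q *\<^sub>v z = z" unfolding z_def T_def by (rule proj_mult_poly_on[OF A(1) pf(4,6) s])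
  have wave: "wave_op H P f l \<phi> = \<phi> - z"
    unfolding wave_op_def z_def s_def T_def A_def Q_def
    using assoc_mult_mat_vec[OF T hqp(1) \<phi>] by (simp add: T_def A_def Q_def)
  have Pz: "P *\<^sub>v z = 0\<^sub>v n"
  proof -
    have "P *\<^sub>v z = (P * Q) *\<^sub>v z" using assoc_mult_mat_vec[OF pf(1,4) z] Qz by simp
    then show ?thesis unfolding pf(7) using z by (auto intro!: eq_vecI)
  qed
  show "P *\<^sub>v wave_op H P f l \<phi> = \<phi>"
    unfolding wave mult_minus_distrib_mat_vec[OF pf(1) \<phi> z] P\<phi> Pz using \<phi> by simp
  define K where "K = Heff_poly H P f l"
  have PQm: "H_PQ H P = P * (H * Q)"
    unfolding H_PQ_def H_QP_def Q_def[symmetric] mat_adjoint_mult[OF mult_carrier_mat[OF pf(4) H(1)] pf(1)]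
      mat_adjoint_mult[OF pf(4) H(1)] pf(2,5) H(2) ..
  have HQ: "H * Q \<in> carrier_mat n n" by (rule mult_carrier_mat[OF H(1) pf(4)])
  have PQc: "H_PQ H P \<in> carrier_mat n n" unfolding PQm by (rule mult_carrier_mat[OF pf(1) HQ])
  have PPc: "H_PP H P \<in> carrier_mat n n" unfolding H_PP_def using pf(1) H(1) by auto
  have Kd: "K = H_PP H P - H_PQ H P * T * H_QP H P"
    by (simp add: K_def Heff_poly_def T_def A_def Q_def)
  have PQT: "H_PQ H P * T \<in> carrier_mat n n" by (rule mult_carrier_mat[OF PQc T])
  have Kc: "K \<in> carrier_mat n n" unfolding Kd by (rule minus_carrier_mat[OF mult_carrier_mat[OF PQT hqp(1)]])
  have H\<phi>: "H *\<^sub>v \<phi> \<in> carrier_vec n" and Hz: "H *\<^sub>v z \<in> carrier_vec n"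
    using H(1) \<phi> z by auto
  have PHz: "P *\<^sub>v (H *\<^sub>v z) \<in> carrier_vec n" "P *\<^sub>v (H *\<^sub>v \<phi>) \<in> carrier_vec n"
    using pf(1) Hz H\<phi> by auto
  have K\<phi>: "K *\<^sub>v \<phi> = P *\<^sub>v (H *\<^sub>v \<phi>) - P *\<^sub>v (H *\<^sub>v z)"
  proof -
    have "H_PP H P *\<^sub>v \<phi> = P *\<^sub>v (H *\<^sub>v \<phi>)"
      unfolding H_PP_def assoc_mult_mat_vec[OF mult_carrier_mat[OF pf(1) H(1)] pf(1) \<phi>] P\<phi>
      by (rule assoc_mult_mat_vec[OF pf(1) H(1) \<phi>])
    moreover have "(H_PQ H P * T * H_QP H P) *\<^sub>v \<phi> = P *\<^sub>v (H *\<^sub>v z)"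
    proof -
      have "(H_PQ H P * T * H_QP H P) *\<^sub>v \<phi> = H_PQ H P *\<^sub>v z"
        unfolding assoc_mult_mat_vec[OF PQT hqp(1) \<phi>] s_def[symmetric] assoc_mult_mat_vec[OF PQc T s]
        by (simp only: z_def)
      then show ?thesis
        unfolding PQm assoc_mult_mat_vec[OF pf(1) HQ z] assoc_mult_mat_vec[OF H(1) pf(4) z] Qz .
    qed
    ultimately show ?thesis
      unfolding Kd minus_mult_distrib_mat_vec[OF PPc mult_carrier_mat[OF PQT hqp(1)] \<phi>] by simp
  qed
  let ?l = "complex_of_real l"
  define x where "x = Hhat l *\<^sub>v \<phi> - ?l \<cdot>\<^sub>v \<phi>"
  define y where "y = (Hhat l - K) *\<^sub>v \<phi>"
  define t where "t = s - A *\<^sub>v z"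
  have x: "x \<in> carrier_vec n" using Hh \<phi> by (simp add: x_def)
  have HK: "Hhat l - K \<in> carrier_mat n n" by (rule minus_carrier_mat[OF Kc])
  have y: "y \<in> carrier_vec n" unfolding y_def by (rule mult_mat_vec_carrier[OF HK \<phi>])
  have t: "t \<in> carrier_vec n" using s A(1) z by (simp add: t_def)
  have Az: "A *\<^sub>v z = H *\<^sub>v z - P *\<^sub>v (H *\<^sub>v z) - ?l \<cdot>\<^sub>v z"
    unfolding A(5)[OF z] Qz pf(8)[OF Hz] ..
  have s': "s = H *\<^sub>v \<phi> - P *\<^sub>v (H *\<^sub>v \<phi>)" unfolding sH pf(8)[OF H\<phi>] ..
  have y': "y = Hhat l *\<^sub>v \<phi> - (P *\<^sub>v (H *\<^sub>v \<phi>) - P *\<^sub>v (H *\<^sub>v z))"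
    unfolding y_def minus_mult_distrib_mat_vec[OF Hh Kc \<phi>] K\<phi> ..
  have Hh\<phi>: "Hhat l *\<^sub>v \<phi> \<in> carrier_vec n" using Hh \<phi> by auto
  \<comment> \<open>The vector \<open>h\<close>, later \<open>Hhat l *\<^sub>v \<phi>\<close>, is
    inserted and cancels. This splits the \<open>P\<close> part into the eigenpair error
    \<open>x\<close> and the estimation error \<open>y\<close>, which is why
    \<open>\<epsilon>est\<close> stands beside \<open>eps_app\<close> in the total error;
    \<open>v3\<close> and \<open>v4\<close> are the \<open>P\<close> parts of \<open>v1\<close> and
    \<open>v2\<close>, and the remainder is the \<open>Q\<close> part \<open>t\<close>.\<close>
  have alg: "(v1 - v2) - ?l \<cdot>\<^sub>v (p - w) =
      ((h - ?l \<cdot>\<^sub>v p) + (- 1) \<cdot>\<^sub>v (h - (v3 - v4))) + ((v1 - v3) - (v2 - v4 - ?l \<cdot>\<^sub>v w))"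
    if "v1 \<in> carrier_vec n" "v2 \<in> carrier_vec n" "v3 \<in> carrier_vec n" "v4 \<in> carrier_vec n"
      "h \<in> carrier_vec n" "p \<in> carrier_vec n" "w \<in> carrier_vec n" for v1 v2 v3 v4 h p w
    using that by (intro eq_vecI) (auto simp: algebra_simps)
  have "H *\<^sub>v (\<phi> - z) - ?l \<cdot>\<^sub>v (\<phi> - z) = (x + (- 1) \<cdot>\<^sub>v y) + t"
    unfolding mult_minus_distrib_mat_vec[OF H(1) \<phi> z] x_def y' t_def s' Az
    by (rule alg[OF H\<phi> Hz PHz(2,1) Hh\<phi> \<phi> z])
  then have "vec_norm2 (H *\<^sub>v (\<phi> - z) - ?l \<cdot>\<^sub>v (\<phi> - z)) = vec_norm2 ((x + (- 1) \<cdot>\<^sub>v y) + t)"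
    by simp
  also have "\<dots> \<le> vec_norm2 x + vec_norm2 y + vec_norm2 t"
    using vec_norm2_triangle[of "x + (- 1) \<cdot>\<^sub>v y" n t] vec_norm2_triangle[of x n "(- 1) \<cdot>\<^sub>v y"] x y t
    by (simp add: vec_norm2_smult)
  finally have sum: "vec_norm2 (H *\<^sub>v (\<phi> - z) - ?l \<cdot>\<^sub>v (\<phi> - z)) \<le> vec_norm2 x + vec_norm2 y + vec_norm2 t" .
  define q where "q = op_norm (H_QP H P)"
  have qe: "0 \<le> q * \<epsilon>f" unfolding q_def by (rule approx_setting_error_nonneg[OF ap l])
  have est0: "0 \<le> \<epsilon>est" using op_norm_nonneg opest by (rule order_trans)
  \<comment> \<open>The sign of \<open>\<alpha>\<close> is inherited from the operator norm that the
    normalization dominates.\<close>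
  have "0 \<le> c\<alpha> * \<alpha>" using op_norm_nonneg[of A] opA aW by linarith
  then have \<alpha>0: "0 \<le> \<alpha>" using c\<alpha> by (simp add: zero_le_mult_iff)
  have "0 \<le> q" by (simp add: q_def)
  have app0: "0 \<le> eps_app H P \<epsilon>est \<epsilon>f"
    using est0 mult_nonneg_nonneg[OF \<open>0 \<le> q\<close> qe] by (simp add: eps_app_def q_def power2_eq_square mult.assoc)
  have yb: "vec_norm2 y \<le> \<epsilon>est * vec_norm2 \<phi>"
    using op_norm_bound[OF HK \<phi>] mult_right_mono[OF opest vec_norm2_nonneg[of \<phi>]]
    by (simp add: y_def K_def)
  have "vec_norm2 t \<le> c\<alpha> * \<alpha> * \<epsilon>f * vec_norm2 s"
    unfolding t_def z_def T_def
    by (rule approximate_inverse_bound[OF A(1,2) pf(4,5) A(3) s Qs])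
      (rule approx_setting_polynomial(2)[OF ap l], auto simp: A_def Q_def)
  \<comment> \<open>Monotonicity needs \<open>0 \<le> \<epsilon>f\<close> itself, which a nonzero
    \<open>s\<close> supplies. For \<open>s = 0\<close> the right-hand side only has to be
    nonnegative, and the sign of the product with \<open>q\<close> is enough.\<close>
  also have "\<dots> \<le> c\<alpha> * (\<alpha> * q * \<epsilon>f) * vec_norm2 \<phi>"
  proof (cases "s = 0\<^sub>v n")
    case True
    have "0 \<le> c\<alpha> * (\<alpha> * (q * \<epsilon>f)) * vec_norm2 \<phi>"
      using c\<alpha> mult_nonneg_nonneg[OF \<alpha>0 qe] by simp
    then show ?thesis using True by (simp add: mult.assoc)
  next
    case False
    obtain u a where "u \<in> carrier_vec n" "A *\<^sub>v u = complex_of_real a \<cdot>\<^sub>v u" "Q *\<^sub>v u \<noteq> 0\<^sub>v n"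
      by (rule hermitian_eigenvector_meets_projector[OF A(1,2) pf(4,5) s Qs False])
    then have "0 \<le> \<epsilon>f" using approx_setting_polynomial(1)[OF ap l] by (auto simp: A_def Q_def)
    then have "c\<alpha> * \<alpha> * \<epsilon>f * vec_norm2 s \<le> c\<alpha> * \<alpha> * \<epsilon>f * (q * vec_norm2 \<phi>)"
      using op_norm_bound[OF hqp(1) \<phi>] c\<alpha> \<alpha>0 by (intro mult_left_mono) (auto simp: s_def q_def)
    then show ?thesis by (simp add: ac_simps)
  qed
  finally have tb: "vec_norm2 t \<le> c\<alpha> * (\<alpha> * q * \<epsilon>f) * vec_norm2 \<phi>" .
  have e: "eps_total H P \<alpha> \<epsilon>est \<epsilon>f = \<epsilon>est + eps_app H P \<epsilon>est \<epsilon>f + \<alpha> * q * \<epsilon>f"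
    by (simp add: eps_total_def q_def)
  have "vec_norm2 x + vec_norm2 y + vec_norm2 t
      \<le> (eps_app H P \<epsilon>est \<epsilon>f + \<epsilon>est + c\<alpha> * (\<alpha> * q * \<epsilon>f)) * vec_norm2 \<phi>"
    using est yb tb by (simp add: x_def algebra_simps)
  also have "\<dots> \<le> max 1 c\<alpha> * eps_total H P \<alpha> \<epsilon>est \<epsilon>f * vec_norm2 \<phi>"
  proof (rule mult_right_mono)
    \<comment> \<open>Two of the three terms come with the constant 1 and the third with
      \<open>c\<alpha>\<close>, so the maximum is a common factor.\<close>
    have "1 * (eps_app H P \<epsilon>est \<epsilon>f + \<epsilon>est) \<le> max 1 c\<alpha> * (eps_app H P \<epsilon>est \<epsilon>f + \<epsilon>est)"
      using app0 est0 by (intro mult_right_mono) auto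
    moreover have "c\<alpha> * (\<alpha> * q * \<epsilon>f) \<le> max 1 c\<alpha> * (\<alpha> * q * \<epsilon>f)"
      using mult_nonneg_nonneg[OF \<alpha>0 qe] by (intro mult_right_mono) (auto simp: mult.assoc)
    ultimately show "eps_app H P \<epsilon>est \<epsilon>f + \<epsilon>est + c\<alpha> * (\<alpha> * q * \<epsilon>f)
        \<le> max 1 c\<alpha> * eps_total H P \<alpha> \<epsilon>est \<epsilon>f"
      unfolding e by (simp add: algebra_simps)
  qed simp
  finally show "vec_norm2 (H *\<^sub>v wave_op H P f l \<phi> - ?l \<cdot>\<^sub>v wave_op H P f l \<phi>)
      \<le> max 1 c\<alpha> * eps_total H P \<alpha> \<epsilon>est \<epsilon>f * vec_norm2 \<phi>"
    unfolding wave using sum by linarith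
qed

section \<open>Non-degenerate case\<close>

lemma isometry_cscalar_prod:
  fixes A :: "complex mat"
  assumes A: "A \<in> carrier_mat n m" and iso: "mat_adjoint A * A = 1\<^sub>m m"
    and x: "x \<in> carrier_vec m" and y: "y \<in> carrier_vec m"
  shows "(A *\<^sub>v x) \<bullet>c (A *\<^sub>v y) = x \<bullet>c y"
  using cscalar_prod_adjoint[OF A x mult_mat_vec_carrier[OF A y]]
    assoc_mult_mat_vec[OF mat_adjoint_carrier[OF A] A y] iso y by simp

lemma column_span_proj:
  assumes "orth_projector n d P" and "v \<in> column_span P"
  shows "v \<in> carrier_vec n" "P *\<^sub>v v = v"
proof -
  note pf = orth_projector_facts[OF assms(1)]
  obtain x where x: "x \<in> carrier_vec n" "v = P *\<^sub>v x"
    using assms(2) pf(1) by (auto simp: column_span_def)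
  show "v \<in> carrier_vec n" unfolding x(2) by (rule mult_mat_vec_carrier[OF pf(1) x(1)])
  show "P *\<^sub>v v = v" unfolding x(2) using assoc_mult_mat_vec[OF pf(1,1) x(1)] pf(3) by simp
qed

lemma columns_carrier [simp]: "columns n m v \<in> carrier_mat n m"
  by (auto simp: columns_def)

lemma columns_dim [simp]: "dim_row (columns n m v) = n" "dim_col (columns n m v) = m"
  by (simp_all add: columns_def)

lemma col_columns: "k < m \<Longrightarrow> v k \<in> carrier_vec n \<Longrightarrow> col (columns n m v) k = v k"
  by (simp add: columns_def)

text \<open>\<open>P\<close> maps the wave vector back to the unit vector \<open>\<phi>\<close>, so
  the wave vector cannot vanish. This excludes the degenerate reading of \<open>\<eta>_wave\<close>,
  in which a quotient with denominator 0 has the value 0.\<close>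

lemma lifted_state_norm:
  assumes c\<alpha>: "0 < c\<alpha>"
    and ap: "approx_setting c\<alpha> n d H P g \<alpha> \<alpha>\<^sub>W f \<epsilon>f \<epsilon>est Hhat W" and l: "l \<in> W"
    and \<phi>: "\<phi> \<in> carrier_vec n" "P *\<^sub>v \<phi> = \<phi>" "vec_norm2 \<phi> = 1"
    and est: "vec_norm2 (Hhat l *\<^sub>v \<phi> - complex_of_real l \<cdot>\<^sub>v \<phi>) \<le> eps_app H P \<epsilon>est \<epsilon>f * vec_norm2 \<phi>"
  shows "vec_norm2 (lifted_state H P f l \<phi>) = 1"
proof -
  have proj: "orth_projector n d P" and H: "H \<in> carrier_mat n n"
    using ap by (auto simp: approx_setting_def)
  note pf = orth_projector_facts[OF proj]
  let ?w = "wave_op H P f l \<phi>"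
  have w: "?w \<in> carrier_vec n"
    using \<phi>(1) pf(4) H H_QP_mult_vec(1)[OF proj H \<phi>(1)]
    by (auto simp: wave_op_def H_QQ_shift_def H_QQ_def poly_on_def intro!: carrier_vecI)
  have "vec_norm2 ?w \<noteq> 0"
  proof
    assume "vec_norm2 ?w = 0"
    then have "?w = 0\<^sub>v n" using vec_norm2_eq_0[OF w] by simp
    then have "\<phi> = P *\<^sub>v 0\<^sub>v n" using wave_op_residual(2)[OF c\<alpha> ap l \<phi>(1,2) est] by simp
    then have "\<phi> = 0\<^sub>v n" unfolding mult_mat_zero_vec[OF pf(1)] .
    then show False using \<phi>(3) by simp
  qed
  then show ?thesis
    by (simp add: lifted_state_def \<eta>_wave_def vec_norm2_smult real_sqrt_divide norm_divide)
qed

text \<open>This is \<open>invariant_subspace_residual\<close> with a single column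
  \<open>\<Psi>\<close>, where the projected norm squared is the fidelity. Simplicity supplies the
  gap: an eigenvector orthogonal to \<open>\<Psi>\<close> must belong to another eigenvalue.\<close>

lemma nondegenerate_fidelity:
  assumes c\<alpha>: "0 < c\<alpha>"
    and ap: "approx_setting c\<alpha> n d H P g \<alpha> \<alpha>\<^sub>W f \<epsilon>f \<epsilon>est Hhat W" and l: "l \<in> W"
    and \<phi>: "\<phi> \<in> column_span P" "vec_norm2 \<phi> = 1"
    and eig: "Hhat l *\<^sub>v \<phi> = complex_of_real \<xi> \<cdot>\<^sub>v \<phi>" and \<xi>: "\<bar>\<xi> - l\<bar> \<le> eps_app H P \<epsilon>est \<epsilon>f"
    and \<Psi>: "eigenvector H \<Psi> (complex_of_real lam)" "vec_norm2 \<Psi> = 1"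
    and \<eta>: "\<eta>_wave H P f l \<phi> \<le> c\<eta> * P_weight P \<Psi>"
    and simple: "simple_eigenvalue H (complex_of_real lam)"
    and \<Delta>: "\<Delta> = spec_dist l (spectrum H - {complex_of_real lam})" "0 < \<Delta>"
  shows "ereal (1 - fidelity \<Psi> (lifted_state H P f l \<phi>))
    \<le> ereal (c\<eta> * (max 1 c\<alpha>)\<^sup>2 * (P_weight P \<Psi> * (eps_total H P \<alpha> \<epsilon>est \<epsilon>f)\<^sup>2)) / \<Delta>\<^sup>2"
proof -
  have H: "H \<in> carrier_mat n n" "mat_adjoint H = H" and proj: "orth_projector n d P"
    using ap by (auto simp: approx_setting_def hermitian_mat_def)
  note \<phi>c = column_span_proj[OF proj \<phi>(1)]
  have \<Psi>c: "\<Psi> \<in> carrier_vec n" "H *\<^sub>v \<Psi> = complex_of_real lam \<cdot>\<^sub>v \<Psi>"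
    using \<Psi>(1) H(1) by (auto simp: eigenvector_def)
  define \<omega> where "\<omega> = wave_op H P f l \<phi>"
  define b where "b = lifted_state H P f l \<phi>"
  define \<eta>' where "\<eta>' = \<eta>_wave H P f l \<phi>"
  have \<eta>0: "0 \<le> \<eta>'" by (simp add: \<eta>'_def \<eta>_wave_def)
  have bd: "b = complex_of_real (sqrt \<eta>') \<cdot>\<^sub>v \<omega>" by (simp add: b_def lifted_state_def \<eta>'_def \<omega>_def)
  have "Hhat l *\<^sub>v \<phi> - complex_of_real l \<cdot>\<^sub>v \<phi> = complex_of_real (\<xi> - l) \<cdot>\<^sub>v \<phi>"
    unfolding eig using \<phi>c by (auto simp: algebra_simps intro!: eq_vecI)
  then have est: "vec_norm2 (Hhat l *\<^sub>v \<phi> - complex_of_real l \<cdot>\<^sub>v \<phi>) \<le> eps_app H P \<epsilon>est \<epsilon>f * vec_norm2 \<phi>"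
    using \<xi> \<phi>(2) by (simp add: vec_norm2_smult flip: of_real_diff)
  have b1: "vec_norm2 b = 1" unfolding b_def by (rule lifted_state_norm[OF c\<alpha> ap l \<phi>c \<phi>(2) est])
  have \<omega>: "\<omega> \<in> carrier_vec n"
    using \<phi>c(1) orth_projector_facts(4)[OF proj] H(1) H_QP_mult_vec(1)[OF proj H(1) \<phi>c(1)]
    by (auto simp: \<omega>_def wave_op_def H_QQ_shift_def H_QQ_def poly_on_def intro!: carrier_vecI)
  have b: "b \<in> carrier_vec n" using \<omega> by (simp add: bd)
  define \<kappa> where "\<kappa> = max 1 c\<alpha> * eps_total H P \<alpha> \<epsilon>est \<epsilon>f"
  have "vec_norm2 (H *\<^sub>v \<omega> - complex_of_real l \<cdot>\<^sub>v \<omega>) \<le> \<kappa>"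
    using wave_op_residual(1)[OF c\<alpha> ap l \<phi>c est] \<phi>(2) by (simp add: \<omega>_def \<kappa>_def)
  then have r\<omega>: "(vec_norm2 (H *\<^sub>v \<omega> - complex_of_real l \<cdot>\<^sub>v \<omega>))\<^sup>2 \<le> \<kappa>\<^sup>2"
    by (intro power_mono) auto
  \<comment> \<open>Normalization scales the residual by the square root of \<open>\<eta>'\<close>,
    so the squared residual gains the factor \<open>\<eta>'\<close>, which is bounded by the weight
    of \<open>\<Psi>\<close>.\<close>
  have "H *\<^sub>v b - complex_of_real l \<cdot>\<^sub>v b =
      complex_of_real (sqrt \<eta>') \<cdot>\<^sub>v (H *\<^sub>v \<omega> - complex_of_real l \<cdot>\<^sub>v \<omega>)"
    unfolding bd mult_mat_vec[OF H(1) \<omega>] using H(1) \<omega>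
    by (intro eq_vecI) (auto simp: algebra_simps simp del: index_mult_mat_vec)
  then have "(vec_norm2 (H *\<^sub>v b - complex_of_real l \<cdot>\<^sub>v b))\<^sup>2
      = \<eta>' * (vec_norm2 (H *\<^sub>v \<omega> - complex_of_real l \<cdot>\<^sub>v \<omega>))\<^sup>2"
    using \<eta>0 by (simp add: vec_norm2_smult power_mult_distrib)
  also have "\<dots> \<le> (c\<eta> * P_weight P \<Psi>) * \<kappa>\<^sup>2"
    using r\<omega> \<eta> \<eta>0 by (intro mult_mono) (auto simp: \<eta>'_def)
  finally have res: "(vec_norm2 (H *\<^sub>v b - complex_of_real l \<cdot>\<^sub>v b))\<^sup>2 \<le> (c\<eta> * P_weight P \<Psi>) * \<kappa>\<^sup>2" .
  define A where "A = columns n 1 (\<lambda>_. \<Psi>)"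
  have A: "A \<in> carrier_mat n 1" by (simp add: A_def)
  have A0: "col A 0 = \<Psi>" unfolding A_def by (rule col_columns[OF _ \<Psi>c(1)]) simp
  have "\<Psi> \<bullet>c \<Psi> = 1" using vec_norm2_sq[of \<Psi>] \<Psi>(2) by simp
  then have iso: "mat_adjoint A * A = 1\<^sub>m 1"
    using A by (intro eq_matI) (auto simp: mat_adjoint_mult_index[OF A A] A0 simp del: index_mult_mat(1))
  have adjA: "(mat_adjoint A *\<^sub>v v) $ 0 = v \<bullet>c \<Psi>" if "v \<in> carrier_vec n" for v
    using adjoint_mult_vec_index[OF A that, of 0] A0 by simp
  define L where "L = mat 1 1 (\<lambda>_. complex_of_real lam)"
  have inv: "H * A = A * L"
  proof (rule eq_matI)
    fix i j assume "i < dim_row (A * L)" "j < dim_col (A * L)"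
    then have ij: "i < n" "j = 0" using A by (auto simp: L_def)
    have "(H * A) $$ (i, 0) = (H *\<^sub>v col A 0) $ i" using H(1) A ij by simp
    also have "\<dots> = complex_of_real lam * A $$ (i, 0)"
      unfolding A0 \<Psi>c(2) using \<Psi>c(1) A ij by (simp flip: A0)
    also have "\<dots> = (A * L) $$ (i, 0)" using A ij by (simp add: L_def scalar_prod_def)
    finally show "(H * A) $$ (i, j) = (A * L) $$ (i, j)" using ij by simp
  qed (use A H(1) in \<open>auto simp: L_def\<close>)
  have gap: "\<delta> \<le> cmod (of_real l - \<mu>)"
    if \<delta>: "ereal \<delta> \<le> \<Delta>" and u: "eigenvector H u \<mu>" and Au: "mat_adjoint A *\<^sub>v u = 0\<^sub>v 1" for \<delta> u \<mu>
  proof -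
    have uc: "u \<in> carrier_vec n" using u H(1) by (auto simp: eigenvector_def)
    have "u \<bullet>c \<Psi> = 0" using adjA[OF uc] Au by simp
    then have "\<mu> \<noteq> complex_of_real lam"
      using simple_eigenvalue_eigenvectors_parallel[OF H simple \<Psi>(1)] u by blast
    then have "\<mu> \<in> spectrum H - {complex_of_real lam}"
      using u by (auto simp: spectrum_def eigenvalue_def)
    then show ?thesis using spec_dist_le \<delta> \<Delta>(1) by blast
  qed
  have Ab: "(vec_norm2 (mat_adjoint A *\<^sub>v b))\<^sup>2 = fidelity \<Psi> b"
    using A adjA[OF b] by (simp add: vec_norm2_sq_sum fidelity_def del: index_mult_mat_vec)
  have L: "L \<in> carrier_mat 1 1" by (simp add: L_def)
  show ?thesis unfolding b_def[symmetric]
  proof (rule ereal_le_divide_square[OF \<Delta>(2)])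
    fix \<delta> :: real assume \<delta>: "0 \<le> \<delta>" "ereal \<delta> \<le> \<Delta>"
    have "\<delta>\<^sup>2 * (1 - fidelity \<Psi> b) \<le> (vec_norm2 (H *\<^sub>v b - complex_of_real l \<cdot>\<^sub>v b))\<^sup>2"
      using invariant_subspace_residual[OF H A iso L inv b \<delta>(1) gap[OF \<delta>(2)]] b1 Ab by simp
    with res show "\<delta>\<^sup>2 * (1 - fidelity \<Psi> b)
        \<le> c\<eta> * (max 1 c\<alpha>)\<^sup>2 * (P_weight P \<Psi> * (eps_total H P \<alpha> \<epsilon>est \<epsilon>f)\<^sup>2)"
      by (simp add: \<kappa>_def power_mult_distrib algebra_simps)
  qed
qed

section \<open>Subspace case\<close>

text \<open>It turns invariance of a set into the matrix form that
  \<open>invariant_subspace_residual\<close> requires. If \<open>H A e = A z\<close>, then the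
  isometry property recovers \<open>z\<close> by applying \<open>mat_adjoint A\<close>, so the
  matrix of \<open>H\<close> on the subspace is its compression.\<close>

lemma invariant_column_span:
  fixes H A B :: "complex mat"
  assumes H: "H \<in> carrier_mat n n" and A: "A \<in> carrier_mat n m" and iso: "mat_adjoint A * A = 1\<^sub>m m"
    and inv: "\<And>v. v \<in> column_span A \<Longrightarrow> H *\<^sub>v v \<in> column_span A"
  shows "H * A = A * (mat_adjoint A * (H * A))"
proof -
  note Aa = mat_adjoint_carrier[OF A]
  have HA: "H * A \<in> carrier_mat n m" by (rule mult_carrier_mat[OF H A])
  have AHA: "mat_adjoint A * (H * A) \<in> carrier_mat m m" by (rule mult_carrier_mat[OF Aa HA])
  have "(H * A) *\<^sub>v e = (A * (mat_adjoint A * (H * A))) *\<^sub>v e" if e: "e \<in> carrier_vec m" for e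
  proof -
    have "A *\<^sub>v e \<in> column_span A" using A e by (auto simp: column_span_def)
    from inv[OF this] obtain z where z: "z \<in> carrier_vec m" "H *\<^sub>v (A *\<^sub>v e) = A *\<^sub>v z"
      using A by (auto simp: column_span_def)
    have HAe: "(H * A) *\<^sub>v e = A *\<^sub>v z" using assoc_mult_mat_vec[OF H A e] z(2) by simp
    have "mat_adjoint A *\<^sub>v (A *\<^sub>v z) = z"
      using assoc_mult_mat_vec[OF Aa A z(1)] iso z(1) by simp
    then show ?thesis
      unfolding assoc_mult_mat_vec[OF A AHA e] assoc_mult_mat_vec[OF Aa HA e] HAe by simp
  qed
  note eq = this
  show ?thesis
  proof (rule eq_matI)
    fix i j assume "i < dim_row (A * (mat_adjoint A * (H * A)))" "j < dim_col (A * (mat_adjoint A * (H * A)))"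
    then have ij: "i < n" "j < m" using A H by auto
    have idx: "(M *\<^sub>v unit_vec m j) $ i = M $$ (i, j)" if "M \<in> carrier_mat n m" for M :: "complex mat"
      using that ij by simp
    have "((H * A) *\<^sub>v unit_vec m j) $ i = ((A * (mat_adjoint A * (H * A))) *\<^sub>v unit_vec m j) $ i"
      by (rule arg_cong[OF eq]) simp
    then show "(H * A) $$ (i, j) = (A * (mat_adjoint A * (H * A))) $$ (i, j)"
      by (simp only: idx[OF HA] idx[OF mult_carrier_mat[OF A AHA]])
  qed (use A H in auto)
qed

text \<open>The target eigenvectors come without an orthogonality assumption, while the residual
  estimate works with an orthonormal basis of their span; invariance of the set is what passes from
  one to the other.\<close>

lemma eigenvector_columns_span_invariant:
  assumes H: "H \<in> carrier_mat n n"
    and \<Psi>: "\<And>k. k < m \<Longrightarrow> eigenvector H (\<Psi> k) (\<mu> k)" and v: "v \<in> column_span (columns n m \<Psi>)"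
  shows "H *\<^sub>v v \<in> column_span (columns n m \<Psi>)"
proof -
  let ?M = "columns n m \<Psi>"
  have M: "?M \<in> carrier_mat n m" by simp
  have \<Psi>c: "\<Psi> k \<in> carrier_vec n" "H *\<^sub>v \<Psi> k = \<mu> k \<cdot>\<^sub>v \<Psi> k" if "k < m" for k
    using \<Psi>[OF that] H by (auto simp: eigenvector_def)
  obtain y where y: "y \<in> carrier_vec m" "v = ?M *\<^sub>v y" using v M by (auto simp: column_span_def)
  have HM: "H * ?M = ?M * mat_diag m \<mu>"
  proof (rule eq_matI)
    fix i j assume "i < dim_row (?M * mat_diag m \<mu>)" "j < dim_col (?M * mat_diag m \<mu>)"
    then have ij: "i < n" "j < m" using M by (auto simp: mat_diag_def)
    have "(H * ?M) $$ (i, j) = (H *\<^sub>v col ?M j) $ i" using H M ij by auto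
    also have "\<dots> = \<mu> j * col ?M j $ i"
      unfolding col_columns[where v = \<Psi>, OF ij(2) \<Psi>c(1)[OF ij(2)]] \<Psi>c(2)[OF ij(2)] using \<Psi>c(1)[OF ij(2)] ij by simp
    also have "\<dots> = (?M * mat_diag m \<mu>) $$ (i, j)"
      using ij M by (simp add: mat_diag_mult_right[OF M])
    finally show "(H * ?M) $$ (i, j) = (?M * mat_diag m \<mu>) $$ (i, j)" .
  qed (use H M in \<open>auto simp: mat_diag_def\<close>)
  have "H *\<^sub>v v = ?M *\<^sub>v (mat_diag m \<mu> *\<^sub>v y)"
    unfolding y(2) assoc_mult_mat_vec[OF H M y(1), symmetric] HM
    by (rule assoc_mult_mat_vec[OF M mat_diag_dim y(1)])
  moreover have "mat_diag m \<mu> *\<^sub>v y \<in> carrier_vec m" by (rule mult_mat_vec_carrier[OF mat_diag_dim y(1)])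
  ultimately show ?thesis using M by (auto simp: column_span_def)
qed

lemma mat_diag_mult_vec_index:
  assumes "x \<in> carrier_vec m" "k < m"
  shows "(mat_diag m c *\<^sub>v x) $ k = c k * x $ k"
proof -
  have "(mat_diag m c *\<^sub>v x) $ k = (\<Sum>j<m. (if k = j then c j else 0) * x $ j)"
    using assms by (auto simp: mat_diag_def scalar_prod_def atLeast0LessThan intro!: sum.cong)
  also have "\<dots> = (\<Sum>j<m. if k = j then c j * x $ j else 0)" by (rule sum.cong) auto
  finally show ?thesis using assms by simp
qed

text \<open>A bound for each column followed by the triangle inequality would cost a factor
  depending on \<open>m\<close>. At a common energy the wave operator is one linear map
  \<open>M\<close>, so a combination of lifted states is \<open>M\<close> applied to
  \<open>\<Phi> *\<^sub>v y\<close>, where \<open>y\<close> has the entries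
  \<open>sqrt (\<eta> k) * z $ k\<close>. The residual estimate is applied once, to this vector, and
  since \<open>\<Phi>\<close> is an isometry its squared norm is the weighted sum on the
  right.\<close>

lemma lifted_columns_residual:
  assumes c\<alpha>: "0 < c\<alpha>"
    and ap: "approx_setting c\<alpha> n d H P g \<alpha> \<alpha>\<^sub>W f \<epsilon>f \<epsilon>est Hhat W" and l: "l \<in> W"
    and \<phi>: "\<And>k. k < m \<Longrightarrow> \<phi> k \<in> column_span P"
  defines "\<Phi> \<equiv> columns n m \<phi>"
  assumes iso: "mat_adjoint \<Phi> * \<Phi> = 1\<^sub>m m" and \<Xi>: "\<Xi> \<in> carrier_mat m m" "Hhat l * \<Phi> = \<Phi> * \<Xi>"
    and op: "op_norm (\<Xi> - complex_of_real l \<cdot>\<^sub>m 1\<^sub>m m) \<le> eps_app H P \<epsilon>est \<epsilon>f"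
    and z: "z \<in> carrier_vec m"
  defines "b \<equiv> columns n m (\<lambda>k. lifted_state H P f l (\<phi> k)) *\<^sub>v z"
  shows "(vec_norm2 (H *\<^sub>v b - complex_of_real l \<cdot>\<^sub>v b))\<^sup>2
    \<le> (max 1 c\<alpha> * eps_total H P \<alpha> \<epsilon>est \<epsilon>f)\<^sup>2 * (\<Sum>k<m. \<eta>_wave H P f l (\<phi> k) * (cmod (z $ k))\<^sup>2)"
proof -
  have H: "H \<in> carrier_mat n n" and proj: "orth_projector n d P" and Hh: "Hhat l \<in> carrier_mat n n"
    using ap l by (auto simp: approx_setting_def)
  note pf = orth_projector_facts[OF proj]
  have \<phi>c: "\<phi> k \<in> carrier_vec n" "P *\<^sub>v \<phi> k = \<phi> k" if "k < m" for k
    using column_span_proj[OF proj \<phi>[OF that]] by auto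
  define \<eta> where "\<eta> k = \<eta>_wave H P f l (\<phi> k)" for k
  have \<eta>0: "0 \<le> \<eta> k" for k by (simp add: \<eta>_def \<eta>_wave_def)
  have \<Phi>: "\<Phi> \<in> carrier_mat n m" by (simp add: \<Phi>_def)
  have col\<Phi>: "col \<Phi> k = \<phi> k" if "k < m" for k
    unfolding \<Phi>_def by (rule col_columns[where v = \<phi>, OF that \<phi>c(1)[OF that]])
  define K where "K = poly_on (compl_proj P) f (H_QQ_shift H P l) * H_QP H P"
  have QQs: "H_QQ_shift H P l \<in> carrier_mat n n"
    using pf(4) H by (auto simp: H_QQ_shift_def H_QQ_def intro!: carrier_matI)
  have K: "K \<in> carrier_mat n n"
    unfolding K_def by (rule mult_carrier_mat[OF poly_on_carrier[OF QQs] H_QP_mult_vec(1)[OF proj H zero_carrier_vec]])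
  define M where "M = 1\<^sub>m n - K"
  have M: "M \<in> carrier_mat n n" unfolding M_def by (rule minus_carrier_mat[OF K])
  have wave: "wave_op H P f l v = M *\<^sub>v v" if "v \<in> carrier_vec n" for v
    unfolding wave_op_def K_def[symmetric] M_def minus_mult_distrib_mat_vec[OF one_carrier_mat K that]
    using that by simp
  let ?s = "\<lambda>k. complex_of_real (sqrt (\<eta> k))"
  define y where "y = mat_diag m ?s *\<^sub>v z"
  have y: "y \<in> carrier_vec m" unfolding y_def by (rule mult_mat_vec_carrier[OF mat_diag_dim z])
  define Bt where "Bt = columns n m (\<lambda>k. lifted_state H P f l (\<phi> k))"
  have Bt: "Bt = M * (\<Phi> * mat_diag m ?s)"
  proof (rule eq_matI)
    fix i j assume "i < dim_row (M * (\<Phi> * mat_diag m ?s))" "j < dim_col (M * (\<Phi> * mat_diag m ?s))"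
    then have ij: "i < n" "j < m" using M by (auto simp: mat_diag_def)
    have lc: "lifted_state H P f l (\<phi> j) = ?s j \<cdot>\<^sub>v (M *\<^sub>v \<phi> j)"
      unfolding lifted_state_def wave[OF \<phi>c(1)[OF ij(2)]] \<eta>_def ..
    have "Bt $$ (i, j) = col Bt j $ i" using ij by (simp add: Bt_def columns_def)
    also have "col Bt j = ?s j \<cdot>\<^sub>v (M *\<^sub>v \<phi> j)"
      unfolding Bt_def using lc mult_mat_vec_carrier[OF M \<phi>c(1)[OF ij(2)]]
      by (subst col_columns[OF ij(2)]) (auto simp del: mult_mat_vec_carrier)
    also have "\<dots> = M *\<^sub>v (?s j \<cdot>\<^sub>v \<phi> j)" by (rule mult_mat_vec[OF M \<phi>c(1)[OF ij(2)], symmetric])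
    also have "?s j \<cdot>\<^sub>v \<phi> j = col (\<Phi> * mat_diag m ?s) j"
      unfolding mat_diag_mult_right[OF \<Phi>] using ij \<Phi> \<phi>c(1)[OF ij(2)]
      by (intro eq_vecI) (auto simp: col\<Phi>[symmetric])
    also have "(M *\<^sub>v col (\<Phi> * mat_diag m ?s) j) $ i = (M * (\<Phi> * mat_diag m ?s)) $$ (i, j)"
      using M ij by (simp add: mat_diag_def)
    finally show "Bt $$ (i, j) = (M * (\<Phi> * mat_diag m ?s)) $$ (i, j)" .
  qed (use M in \<open>auto simp: Bt_def mat_diag_def columns_def\<close>)
  define \<psi> where "\<psi> = \<Phi> *\<^sub>v y"
  have \<psi>: "\<psi> \<in> carrier_vec n" unfolding \<psi>_def by (rule mult_mat_vec_carrier[OF \<Phi> y])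
  have \<psi>n: "vec_norm2 \<psi> = vec_norm2 y" unfolding \<psi>_def by (rule isometry_norm[OF \<Phi> iso y])
  have "b = M *\<^sub>v \<psi>"
    unfolding b_def Bt_def[symmetric] Bt \<psi>_def y_def
      assoc_mult_mat_vec[OF M mult_carrier_mat[OF \<Phi> mat_diag_dim] z]
      assoc_mult_mat_vec[OF \<Phi> mat_diag_dim z] ..
  then have b: "b = wave_op H P f l \<psi>" using wave[OF \<psi>] by simp
  have P\<Phi>: "P * \<Phi> = \<Phi>"
  proof (rule eq_matI)
    fix i j assume "i < dim_row \<Phi>" "j < dim_col \<Phi>"
    then have ij: "i < n" "j < m" using \<Phi> by auto
    have "(P * \<Phi>) $$ (i, j) = (P *\<^sub>v col \<Phi> j) $ i" using pf(1) \<Phi> ij by simp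
    then show "(P * \<Phi>) $$ (i, j) = \<Phi> $$ (i, j)"
      using \<phi>c(2)[OF ij(2)] \<Phi> ij by (simp add: col\<Phi>[OF ij(2)] del: index_mult_mat_vec) (simp flip: col\<Phi>[OF ij(2)])
  qed (use pf(1) \<Phi> in auto)
  have P\<psi>: "P *\<^sub>v \<psi> = \<psi>"
    unfolding \<psi>_def using assoc_mult_mat_vec[OF pf(1) \<Phi> y] P\<Phi> by simp
  let ?D = "\<Xi> - complex_of_real l \<cdot>\<^sub>m 1\<^sub>m m"
  have D: "?D \<in> carrier_mat m m" by (rule minus_carrier_mat) simp
  have \<Xi>y: "\<Xi> *\<^sub>v y \<in> carrier_vec m" by (rule mult_mat_vec_carrier[OF \<Xi>(1) y])
  \<comment> \<open>A combination of the selected eigenvectors is in general not an eigenvector of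
    \<open>Hhat l\<close>. The operator bound on \<open>\<Xi> - l\<close> takes the place of the
    scalar bounds on the individual eigenvalues.\<close>
  have "Hhat l *\<^sub>v \<psi> - complex_of_real l \<cdot>\<^sub>v \<psi> = \<Phi> *\<^sub>v (?D *\<^sub>v y)"
  proof -
    have "Hhat l *\<^sub>v \<psi> = \<Phi> *\<^sub>v (\<Xi> *\<^sub>v y)"
      unfolding \<psi>_def assoc_mult_mat_vec[OF Hh \<Phi> y, symmetric] \<Xi>(2)
      by (rule assoc_mult_mat_vec[OF \<Phi> \<Xi>(1) y])
    then show ?thesis
      unfolding shift_mult_mat_vec[OF \<Xi>(1) y] \<psi>_def
      using mult_minus_distrib_mat_vec[OF \<Phi> \<Xi>y, of "complex_of_real l \<cdot>\<^sub>v y"] mult_mat_vec[OF \<Phi> y] y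
      by simp
  qed
  then have "vec_norm2 (Hhat l *\<^sub>v \<psi> - complex_of_real l \<cdot>\<^sub>v \<psi>) = vec_norm2 (?D *\<^sub>v y)"
    using isometry_norm[OF \<Phi> iso mult_mat_vec_carrier[OF D y]] by simp
  also have "\<dots> \<le> eps_app H P \<epsilon>est \<epsilon>f * vec_norm2 \<psi>"
    using op_norm_bound[OF D y] mult_right_mono[OF op vec_norm2_nonneg[of y]] unfolding \<psi>n by linarith
  finally have "vec_norm2 (H *\<^sub>v b - complex_of_real l \<cdot>\<^sub>v b)
      \<le> max 1 c\<alpha> * eps_total H P \<alpha> \<epsilon>est \<epsilon>f * vec_norm2 y"
    using wave_op_residual(1)[OF c\<alpha> ap l \<psi> P\<psi>] unfolding b \<psi>n by simp
  then have "(vec_norm2 (H *\<^sub>v b - complex_of_real l \<cdot>\<^sub>v b))\<^sup>2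
      \<le> (max 1 c\<alpha> * eps_total H P \<alpha> \<epsilon>est \<epsilon>f * vec_norm2 y)\<^sup>2" by (intro power_mono) auto
  also have "\<dots> = (max 1 c\<alpha> * eps_total H P \<alpha> \<epsilon>est \<epsilon>f)\<^sup>2 * (vec_norm2 y)\<^sup>2" by (simp add: power_mult_distrib)
  also have "(vec_norm2 y)\<^sup>2 = (\<Sum>k<m. (cmod (y $ k))\<^sup>2)" using y by (simp add: vec_norm2_sq_sum)
  also have "\<dots> = (\<Sum>k<m. \<eta> k * (cmod (z $ k))\<^sup>2)"
    using \<eta>0 by (intro sum.cong)
      (auto simp: y_def mat_diag_mult_vec_index[OF z] norm_mult power_mult_distrib simp del: index_mult_mat_vec)
  finally show ?thesis by (simp add: \<eta>_def)
qed

lemma subspace_fidelities: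
  assumes c\<alpha>: "0 < c\<alpha>" and c\<eta>: "0 < c\<eta>" and m: "1 \<le> m"
    and ap: "approx_setting c\<alpha> n d H P g \<alpha> \<alpha>\<^sub>W f \<epsilon>f \<epsilon>est Hhat W" and l: "l \<in> W"
    and \<phi>: "\<And>k. k < m \<Longrightarrow> \<phi> k \<in> column_span P"
    and \<Psi>: "\<And>k. k < m \<Longrightarrow> eigenvector H (\<Psi> k) (complex_of_real (lam k))"
    and \<eta>: "\<And>k. k < m \<Longrightarrow> \<eta>_wave H P f l (\<phi> k) \<le> c\<eta> * P_weight P (\<Psi> k)"
    and S: "S = column_span (columns n m \<Psi>)"
    and iso: "mat_adjoint (columns n m \<phi>) * columns n m \<phi> = 1\<^sub>m m"
    and \<Xi>: "\<Xi> \<in> carrier_mat m m" "Hhat l * columns n m \<phi> = columns n m \<phi> * \<Xi>"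
    and op: "op_norm (\<Xi> - complex_of_real l \<cdot>\<^sub>m 1\<^sub>m m) \<le> eps_app H P \<epsilon>est \<epsilon>f"
    and \<Delta>: "\<Delta> = spec_dist l (spectrum_on H (orth_complement n S))" "0 < \<Delta>"
    and Bt: "Bt = columns n m (\<lambda>k. lifted_state H P f l (\<phi> k))"
    and G: "G = mat_adjoint Bt * Bt"
    and R: "inv_sqrt_mat G Ginv R" and B: "B = Bt * R"
    and pa: "principal_angles n m S (column_span B) \<theta>"
  defines "C \<equiv> c\<eta> * (max 1 c\<alpha>)\<^sup>2" and "\<epsilon> \<equiv> eps_total H P \<alpha> \<epsilon>est \<epsilon>f"
  shows "ereal (1 - F_min m \<theta>)
      \<le> ereal (C * (op_norm Ginv * Max ((\<lambda>k. P_weight P (\<Psi> k)) ` {..<m}) * \<epsilon>\<^sup>2)) / \<Delta>\<^sup>2"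
    and "ereal (1 - F_avg m \<theta>)
      \<le> ereal (C * (op_norm Ginv * ((\<Sum>k<m. P_weight P (\<Psi> k)) / real m) * \<epsilon>\<^sup>2)) / \<Delta>\<^sup>2"
proof -
  have H: "H \<in> carrier_mat n n" "mat_adjoint H = H"
    using ap by (auto simp: approx_setting_def hermitian_mat_def)
  define \<eta>' where "\<eta>' k = \<eta>_wave H P f l (\<phi> k)" for k
  have \<eta>0: "0 \<le> \<eta>' k" for k by (simp add: \<eta>'_def \<eta>_wave_def)
  define p where "p k = P_weight P (\<Psi> k)" for k
  have \<eta>p: "\<eta>' k \<le> c\<eta> * p k" if "k < m" for k using \<eta>[OF that] by (simp add: \<eta>'_def p_def)
  define \<kappa> where "\<kappa> = max 1 c\<alpha> * \<epsilon>"

  have Btc: "Bt \<in> carrier_mat n m" by (simp add: Bt)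
  have Gc: "G \<in> carrier_mat m m" unfolding G by (rule mult_carrier_mat[OF mat_adjoint_carrier[OF Btc] Btc])
  have Rc: "R \<in> carrier_mat m m" and RR: "R * R = Ginv" and GGinv: "G * Ginv = 1\<^sub>m m"
    and Ra: "mat_adjoint R = R"
    using R Gc by (auto simp: inv_sqrt_mat_def inverts_mat_def pos_def_mat_def hermitian_mat_def)
  have Ginv: "Ginv \<in> carrier_mat m m" unfolding RR[symmetric] by (rule mult_carrier_mat[OF Rc Rc])
  have Bc: "B \<in> carrier_mat n m" unfolding B by (rule mult_carrier_mat[OF Btc Rc])
  have GR: "G * R \<in> carrier_mat m m" by (rule mult_carrier_mat[OF Gc Rc])
  \<comment> \<open>A one-sided inverse of a square matrix is two-sided, so one factor
    \<open>R\<close> can be moved to the left of \<open>G\<close>; together with \<open>R\<close>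
    being self-adjoint this makes \<open>B\<close> an isometry.\<close>
  have "(G * R) * R = 1\<^sub>m m" unfolding assoc_mult_mat[OF Gc Rc Rc] RR by (rule GGinv)
  then have RGR: "R * (G * R) = 1\<^sub>m m" by (rule mat_mult_left_right_inverse[OF GR Rc])
  have Biso: "mat_adjoint B * B = 1\<^sub>m m"
  proof -
    have "mat_adjoint B * B = R * (mat_adjoint Bt * (Bt * R))"
      unfolding B mat_adjoint_mult[OF Btc Rc] Ra
      by (rule assoc_mult_mat[OF Rc mat_adjoint_carrier[OF Btc] mult_carrier_mat[OF Btc Rc]])
    also have "mat_adjoint Bt * (Bt * R) = G * R"
      unfolding G by (rule assoc_mult_mat[OF mat_adjoint_carrier[OF Btc] Btc Rc, symmetric])
    finally show ?thesis by (simp only: RGR)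
  qed
  \<comment> \<open>Since \<open>R\<close> is self-adjoint, the left-hand side is the quadratic form
    of \<open>R * R = Ginv\<close>.\<close>
  have Rnorm: "(vec_norm2 (R *\<^sub>v x))\<^sup>2 \<le> op_norm Ginv * (vec_norm2 x)\<^sup>2" if x: "x \<in> carrier_vec m" for x
  proof -
    have "(R *\<^sub>v x) \<bullet>c (R *\<^sub>v x) = x \<bullet>c (Ginv *\<^sub>v x)"
      using cscalar_prod_adjoint[OF Rc x mult_mat_vec_carrier[OF Rc x]] assoc_mult_mat_vec[OF Rc Rc x]
      unfolding Ra RR by simp
    then have "(vec_norm2 (R *\<^sub>v x))\<^sup>2 \<le> cmod (x \<bullet>c (Ginv *\<^sub>v x))"
      unfolding vec_norm2_sq_Re using complex_Re_le_cmod by simp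
    also have "\<dots> \<le> vec_norm2 x * vec_norm2 (Ginv *\<^sub>v x)"
      by (rule Cauchy_Schwarz_vec[OF x mult_mat_vec_carrier[OF Ginv x]])
    also have "\<dots> \<le> vec_norm2 x * (op_norm Ginv * vec_norm2 x)"
      by (intro mult_left_mono op_norm_bound[OF Ginv x]) simp
    finally show ?thesis by (simp add: power2_eq_square mult.left_commute)
  qed

  obtain A B' U V where A: "orthonormal_basis_mat n m S A"
    and B': "orthonormal_basis_mat n m (column_span B) B'"
    and U: "unitary_mat m U" and V: "unitary_mat m V"
    and svd: "mat_adjoint A * B' = U * mat_diag m (\<lambda>j. complex_of_real (cos (\<theta> j))) * mat_adjoint V"
    using pa by (auto simp: principal_angles_def)
  have Ac: "A \<in> carrier_mat n m" and Aiso: "mat_adjoint A * A = 1\<^sub>m m" and Aspan: "column_span A = S"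
    using A by (auto simp: orthonormal_basis_mat_def)
  have B'c: "B' \<in> carrier_mat n m" and B'iso: "mat_adjoint B' * B' = 1\<^sub>m m"
    and B'span: "column_span B' = column_span B"
    using B' by (auto simp: orthonormal_basis_mat_def)
  note Ud = unitary_matD[OF U]
  note Vd = unitary_matD[OF V]
  define v where "v j = col V j" for j
  have v: "v j \<in> carrier_vec m" "vec_norm2 (v j) = 1" if "j < m" for j
    unfolding v_def by (rule eigenbasis_col[OF V that])+

  \<comment> \<open>\<open>principal_angles\<close> supplies some orthonormal basis
    \<open>B'\<close> of the span, while the weights are attached to the columns of
    \<open>Bt\<close>. The principal vectors are therefore re-expanded in \<open>B\<close>; as
    \<open>B'\<close> and \<open>B\<close> are both isometries, the coordinate vectors
    \<open>x j\<close> are again orthonormal.\<close>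
  have "\<exists>x\<in>carrier_vec m. B' *\<^sub>v v j = B *\<^sub>v x" if "j < m" for j
  proof -
    have "B' *\<^sub>v v j \<in> column_span B"
      using v(1)[OF that] B'c unfolding B'span[symmetric] by (auto simp: column_span_def)
    then show ?thesis using Bc by (auto simp: column_span_def)
  qed
  then obtain x where x: "\<And>j. j < m \<Longrightarrow> x j \<in> carrier_vec m" "\<And>j. j < m \<Longrightarrow> B' *\<^sub>v v j = B *\<^sub>v x j"
    by metis
  have x_orth: "x j \<bullet>c x i = (if i = j then 1 else 0)" if ij: "i < m" "j < m" for i j
  proof -
    have "x j \<bullet>c x i = (B' *\<^sub>v v j) \<bullet>c (B' *\<^sub>v v i)"
      unfolding x(2)[OF ij(1)] x(2)[OF ij(2)]
      by (rule isometry_cscalar_prod[OF Bc Biso x(1)[OF ij(2)] x(1)[OF ij(1)], symmetric])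
    also have "\<dots> = v j \<bullet>c v i"
      by (rule isometry_cscalar_prod[OF B'c B'iso v(1)[OF ij(2)] v(1)[OF ij(1)]])
    also have "\<dots> = (mat_adjoint V * V) $$ (i, j)"
      unfolding v_def by (rule mat_adjoint_mult_index[OF Vd(1,1) ij, symmetric])
    also have "\<dots> = (if i = j then 1 else 0)" unfolding Vd(3) using ij by simp
    finally show ?thesis .
  qed
  define X where "X = columns m m x"
  have Xcol: "col X j = x j" if "j < m" for j
    unfolding X_def by (rule col_columns[where v = x, OF that x(1)[OF that]])
  have Xc: "X \<in> carrier_mat m m" by (simp add: X_def)
  have X: "unitary_mat m X"
  proof (rule unitary_matI[OF Xc], rule eq_matI)
    fix i j assume "i < dim_row (1\<^sub>m m :: complex mat)" "j < dim_col (1\<^sub>m m :: complex mat)"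
    then have ij: "i < m" "j < m" by auto
    show "(mat_adjoint X * X) $$ (i, j) = 1\<^sub>m m $$ (i, j)"
      unfolding mat_adjoint_mult_index[OF Xc Xc ij] Xcol[OF ij(1)] Xcol[OF ij(2)] x_orth[OF ij]
      using ij by simp
  qed (use Xc in auto)
  have xn: "vec_norm2 (x j) = 1" if "j < m" for j
    using eigenbasis_col(2)[OF X that] Xcol[OF that] by simp
  define z where "z j = R *\<^sub>v x j" for j
  have z: "z j \<in> carrier_vec m" if "j < m" for j
    unfolding z_def by (rule mult_mat_vec_carrier[OF Rc x(1)[OF that]])
  have z_norm: "(\<Sum>k<m. (cmod (z j $ k))\<^sup>2) \<le> op_norm Ginv" if j: "j < m" for j
    using Rnorm[OF x(1)[OF j]] xn[OF j] Rc by (simp add: z_def vec_norm2_sq_sum del: index_mult_mat_vec)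
  have z_sum: "(\<Sum>j<m. (cmod (z j $ k))\<^sup>2) \<le> op_norm Ginv" if k: "k < m" for k
  proof -
    let ?e = "unit_vec m k :: complex vec"
    have Re: "R *\<^sub>v ?e \<in> carrier_vec m" by (rule mult_mat_vec_carrier[OF Rc unit_vec_carrier])
    \<comment> \<open>Moving the self-adjoint \<open>R\<close> to the other side turns an entry of
      \<open>z j\<close> into a coefficient of one fixed vector in the basis
      \<open>X\<close>.\<close>
    have "cmod (z j $ k) = cmod ((R *\<^sub>v ?e) \<bullet>c col X j)" if j: "j < m" for j
    proof -
      have "z j $ k = z j \<bullet>c ?e"
        using z[OF j] k by (simp add: cscalar_prod_sum if_distrib cong: if_cong)
      also have "\<dots> = x j \<bullet>c (R *\<^sub>v ?e)"
        unfolding z_def using cscalar_prod_adjoint[OF Rc x(1)[OF j], of ?e] Ra by simp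
      also have "\<dots> = cnj ((R *\<^sub>v ?e) \<bullet>c x j)" by (rule cscalar_prod_commute[OF Re x(1)[OF j]])
      finally show ?thesis using Xcol[OF j] by simp
    qed
    then have "(\<Sum>j<m. (cmod (z j $ k))\<^sup>2) = (vec_norm2 (R *\<^sub>v ?e))\<^sup>2"
      by (simp add: Parseval[OF X Re, symmetric])
    also have "\<dots> \<le> op_norm Ginv * (vec_norm2 ?e)\<^sup>2" by (rule Rnorm) simp
    also have "(vec_norm2 ?e)\<^sup>2 = (\<Sum>i<m. if k = i then 1 else 0)"
      unfolding vec_norm2_sq_sum using k by (intro sum.cong) auto
    finally show ?thesis using k by simp
  qed

  define b where "b j = B' *\<^sub>v v j" for j
  have b: "b j \<in> carrier_vec n" "vec_norm2 (b j) = 1" if "j < m" for j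
    using v[OF that] isometry_norm[OF B'c B'iso v(1)[OF that]] mult_mat_vec_carrier[OF B'c v(1)[OF that]]
    by (auto simp: b_def)
  have bz: "b j = Bt *\<^sub>v z j" if "j < m" for j
    unfolding b_def x(2)[OF that] B z_def by (rule assoc_mult_mat_vec[OF Btc Rc x(1)[OF that]])
  \<comment> \<open>\<open>v j\<close> is a right singular vector: \<open>mat_adjoint V\<close>
    sends it to a unit vector, the diagonal scales that by the cosine, and \<open>U\<close>
    preserves the norm.\<close>
  have Ab: "vec_norm2 (mat_adjoint A *\<^sub>v b j) = \<bar>cos (\<theta> j)\<bar>" if j: "j < m" for j
  proof -
    let ?D = "mat_diag m (\<lambda>j. complex_of_real (cos (\<theta> j)))"
    have UD: "U * ?D \<in> carrier_mat m m" by (rule mult_carrier_mat[OF Ud(1) mat_diag_dim])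
    have Vv: "mat_adjoint V *\<^sub>v v j = unit_vec m j"
    proof (rule eq_vecI)
      fix i assume "i < dim_vec (unit_vec m j :: complex vec)"
      then have i: "i < m" by simp
      have "(mat_adjoint V *\<^sub>v v j) $ i = v j \<bullet>c col V i"
        by (rule adjoint_mult_vec_index[OF Vd(1) v(1)[OF j] i])
      also have "\<dots> = (mat_adjoint V * V) $$ (i, j)"
        unfolding v_def by (rule mat_adjoint_mult_index[OF Vd(1,1) i j, symmetric])
      finally show "(mat_adjoint V *\<^sub>v v j) $ i = unit_vec m j $ i" unfolding Vd(3) using i j by simp
    qed (use Vd in simp)
    have De: "?D *\<^sub>v unit_vec m j = complex_of_real (cos (\<theta> j)) \<cdot>\<^sub>v unit_vec m j"
    proof (rule eq_vecI)
      fix i assume "i < dim_vec (complex_of_real (cos (\<theta> j)) \<cdot>\<^sub>v unit_vec m j)"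
      then have i: "i < m" by simp
      then show "(?D *\<^sub>v unit_vec m j) $ i = (complex_of_real (cos (\<theta> j)) \<cdot>\<^sub>v unit_vec m j) $ i"
        using j by (simp add: mat_diag_mult_vec_index del: index_mult_mat_vec)
    qed (simp add: mat_diag_def)
    have "mat_adjoint A *\<^sub>v b j = (mat_adjoint A * B') *\<^sub>v v j"
      unfolding b_def by (rule assoc_mult_mat_vec[OF mat_adjoint_carrier[OF Ac] B'c v(1)[OF j], symmetric])
    also have "\<dots> = U *\<^sub>v (complex_of_real (cos (\<theta> j)) \<cdot>\<^sub>v unit_vec m j)"
      unfolding svd assoc_mult_mat_vec[OF UD Vd(2) v(1)[OF j]] Vv
        assoc_mult_mat_vec[OF Ud(1) mat_diag_dim unit_vec_carrier] De ..
    finally have "vec_norm2 (mat_adjoint A *\<^sub>v b j) = vec_norm2 (complex_of_real (cos (\<theta> j)) \<cdot>\<^sub>v unit_vec m j)"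
      using isometry_norm[OF Ud(1,3), of "complex_of_real (cos (\<theta> j)) \<cdot>\<^sub>v unit_vec m j"] by simp
    also have "\<dots> = \<bar>cos (\<theta> j)\<bar> * vec_norm2 (unit_vec m j :: complex vec)"
      by (simp add: vec_norm2_smult)
    also have "vec_norm2 (unit_vec m j :: complex vec) = 1"
      using vec_norm2_sq[of "unit_vec m j"] vec_norm2_sq_Re[of "unit_vec m j"] eigenbasis_col(2)[OF _ j, of "1\<^sub>m m"] j
      by (simp add: unitary_mat_def)
    finally show ?thesis by simp
  qed

  define L where "L = mat_adjoint A * (H * A)"
  have L: "L \<in> carrier_mat m m"
    unfolding L_def by (rule mult_carrier_mat[OF mat_adjoint_carrier[OF Ac] mult_carrier_mat[OF H(1) Ac]])
  have inv: "H * A = A * L"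
    unfolding L_def
    by (rule invariant_column_span[OF H(1) Ac Aiso])
      (simp only: Aspan S eigenvector_columns_span_invariant[OF H(1) \<Psi>])
  have gap: "\<delta> \<le> cmod (of_real l - \<mu>)"
    if \<delta>: "ereal \<delta> \<le> \<Delta>" and u: "eigenvector H u \<mu>" and Au: "mat_adjoint A *\<^sub>v u = 0\<^sub>v m" for \<delta> u \<mu>
  proof -
    have uc: "u \<in> carrier_vec n" using u H(1) by (auto simp: eigenvector_def)
    have "u \<bullet>c w = 0" if wS: "w \<in> S" for w
    proof -
      obtain y where y: "y \<in> carrier_vec m" "w = A *\<^sub>v y"
        using wS Ac unfolding Aspan[symmetric] by (auto simp: column_span_def)
      have w: "w \<in> carrier_vec n" unfolding y(2) by (rule mult_mat_vec_carrier[OF Ac y(1)])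
      have "w \<bullet>c u = 0" unfolding y(2) cscalar_prod_adjoint[OF Ac y(1) uc] Au using y(1) by simp
      then show ?thesis using cscalar_prod_commute[OF w uc] by simp
    qed
    then have "u \<in> orth_complement n S" using uc by (simp add: orth_complement_def)
    then have "\<mu> \<in> spectrum_on H (orth_complement n S)" using u by (auto simp: spectrum_on_def)
    then show ?thesis using spec_dist_le \<delta> \<Delta>(1) by blast
  qed
  have key: "\<delta>\<^sup>2 * (1 - (cos (\<theta> j))\<^sup>2) \<le> \<kappa>\<^sup>2 * (\<Sum>k<m. \<eta>' k * (cmod (z j $ k))\<^sup>2)"
    if j: "j < m" and \<delta>: "0 \<le> \<delta>" "ereal \<delta> \<le> \<Delta>" for j \<delta>
  proof -
    have "\<delta>\<^sup>2 * (1 - (cos (\<theta> j))\<^sup>2) \<le> (vec_norm2 (H *\<^sub>v b j - complex_of_real l \<cdot>\<^sub>v b j))\<^sup>2"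
      using invariant_subspace_residual[OF H Ac Aiso L inv b(1)[OF j] \<delta>(1) gap[OF \<delta>(2)]]
      unfolding b(2)[OF j] Ab[OF j] by simp
    also have "\<dots> \<le> \<kappa>\<^sup>2 * (\<Sum>k<m. \<eta>' k * (cmod (z j $ k))\<^sup>2)"
      unfolding bz[OF j] Bt \<kappa>_def \<epsilon>_def \<eta>'_def
      by (rule lifted_columns_residual[OF c\<alpha> ap l \<phi> iso \<Xi> op z[OF j]])
    finally show ?thesis .
  qed
  have C: "C * \<epsilon>\<^sup>2 = c\<eta> * \<kappa>\<^sup>2" by (simp add: C_def \<kappa>_def power_mult_distrib)
  define pm where "pm = Max (p ` {..<m})"
  have pm: "p k \<le> pm" if "k < m" for k unfolding pm_def using that by (intro Max_ge) auto
  \<comment> \<open>Nonnegativity is inherited from \<open>\<eta>'\<close>; the index 0 exists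
    because \<open>m\<close> is at least 1.\<close>
  have pm0: "0 \<le> c\<eta> * pm"
  proof -
    have "0 \<le> \<eta>' 0" "\<eta>' 0 \<le> c\<eta> * p 0" "c\<eta> * p 0 \<le> c\<eta> * pm"
      using \<eta>0 \<eta>p[of 0] pm[of 0] c\<eta> m by auto
    then show ?thesis by linarith
  qed

  \<comment> \<open>The largest angle is attained, so \<open>F_min\<close> is governed by the
    residual of a single principal vector.\<close>
  have "Max (\<theta> ` {..<m}) \<in> \<theta> ` {..<m}" using m by (intro Max_in) (auto simp: lessThan_empty_iff)
  then obtain j where j: "j < m" "Max (\<theta> ` {..<m}) = \<theta> j" by auto
  show "ereal (1 - F_min m \<theta>)
      \<le> ereal (C * (op_norm Ginv * Max ((\<lambda>k. P_weight P (\<Psi> k)) ` {..<m}) * \<epsilon>\<^sup>2)) / \<Delta>\<^sup>2"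
    unfolding p_def[symmetric] F_min_def j(2)
  proof (rule ereal_le_divide_square[OF \<Delta>(2)])
    fix \<delta> :: real assume \<delta>: "0 \<le> \<delta>" "ereal \<delta> \<le> \<Delta>"
    have "(\<Sum>k<m. \<eta>' k * (cmod (z j $ k))\<^sup>2) \<le> (\<Sum>k<m. (c\<eta> * pm) * (cmod (z j $ k))\<^sup>2)"
    proof (intro sum_mono mult_right_mono)
      fix k assume "k \<in> {..<m}"
      then show "\<eta>' k \<le> c\<eta> * pm"
        using \<eta>p[of k] pm[of k] c\<eta> by (auto intro: order_trans mult_left_mono)
    qed simp
    also have "\<dots> \<le> (c\<eta> * pm) * op_norm Ginv"
      unfolding sum_distrib_left[symmetric] by (rule mult_left_mono[OF z_norm[OF j(1)] pm0])
    finally have "\<kappa>\<^sup>2 * (\<Sum>k<m. \<eta>' k * (cmod (z j $ k))\<^sup>2) \<le> \<kappa>\<^sup>2 * ((c\<eta> * pm) * op_norm Ginv)"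
      by (rule mult_left_mono) simp
    also have "\<dots> = (C * \<epsilon>\<^sup>2) * (op_norm Ginv * pm)" unfolding C by simp
    finally show "\<delta>\<^sup>2 * (1 - (cos (\<theta> j))\<^sup>2) \<le> C * (op_norm Ginv * Max (p ` {..<m}) * \<epsilon>\<^sup>2)"
      using key[OF j(1) \<delta>] unfolding pm_def[symmetric] by (simp add: ac_simps)
  qed
  show "ereal (1 - F_avg m \<theta>)
      \<le> ereal (C * (op_norm Ginv * ((\<Sum>k<m. P_weight P (\<Psi> k)) / real m) * \<epsilon>\<^sup>2)) / \<Delta>\<^sup>2"
    unfolding p_def[symmetric]
  proof (rule ereal_le_divide_square[OF \<Delta>(2)])
    fix \<delta> :: real assume \<delta>: "0 \<le> \<delta>" "ereal \<delta> \<le> \<Delta>"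
    have "real m * (1 - F_avg m \<theta>) = (\<Sum>j<m. 1 - (cos (\<theta> j))\<^sup>2)"
      using m by (simp add: F_avg_def sum_subtractf right_diff_distrib)
    then have "real m * (\<delta>\<^sup>2 * (1 - F_avg m \<theta>)) = (\<Sum>j<m. \<delta>\<^sup>2 * (1 - (cos (\<theta> j))\<^sup>2))"
      by (simp add: sum_distrib_left[symmetric] mult.left_commute)
    also have "\<dots> \<le> (\<Sum>j<m. \<kappa>\<^sup>2 * (\<Sum>k<m. \<eta>' k * (cmod (z j $ k))\<^sup>2))"
      using key \<delta> by (intro sum_mono) auto
    \<comment> \<open>With the sum over the angles innermost, the weights \<open>\<eta>' k\<close>
      are added up and not replaced by their maximum, which gives the average weight.\<close>
    also have "\<dots> = \<kappa>\<^sup>2 * (\<Sum>k<m. \<eta>' k * (\<Sum>j<m. (cmod (z j $ k))\<^sup>2))"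
      unfolding sum_distrib_left[symmetric] by (subst sum.swap) (simp add: sum_distrib_left)
    also have "\<dots> \<le> \<kappa>\<^sup>2 * (\<Sum>k<m. (c\<eta> * p k) * op_norm Ginv)"
    proof (intro mult_left_mono sum_mono)
      fix k assume "k \<in> {..<m}"
      then have k: "k < m" by simp
      show "\<eta>' k * (\<Sum>j<m. (cmod (z j $ k))\<^sup>2) \<le> (c\<eta> * p k) * op_norm Ginv"
        using \<eta>p[OF k] z_sum[OF k] order_trans[OF \<eta>0 \<eta>p[OF k]] by (intro mult_mono) (auto simp: sum_nonneg)
    qed simp
    also have "\<dots> = (C * \<epsilon>\<^sup>2) * (op_norm Ginv * (\<Sum>k<m. p k))"
      unfolding C by (simp add: sum_distrib_left[symmetric] sum_distrib_right[symmetric] ac_simps)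
    finally have "\<delta>\<^sup>2 * (1 - F_avg m \<theta>) \<le> (C * \<epsilon>\<^sup>2) * (op_norm Ginv * (\<Sum>k<m. p k)) / real m"
      using m by (simp add: pos_le_divide_eq mult.commute)
    then show "\<delta>\<^sup>2 * (1 - F_avg m \<theta>) \<le> C * (op_norm Ginv * ((\<Sum>k<m. p k) / real m) * \<epsilon>\<^sup>2)"
      by (simp add: ac_simps)
  qed
qed

section \<open>A constant uniform in all dimensions and operators\<close>

theorem theorem9:
  fixes c\<alpha> c\<eta> :: real
  assumes "0 < c\<alpha>" and "0 < c\<eta>"
  shows "\<exists>C>0. \<forall>(N::nat) (d::nat) (m::nat) (H::complex mat) (P::complex mat) (g::real) (\<alpha>::real)
      (\<alpha>\<^sub>W::real \<Rightarrow> real) (f::real poly) (\<epsilon>f::real) (\<epsilon>est::real) (Hhat::real \<Rightarrow> complex mat)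
      (lhat::nat \<Rightarrow> real) (\<phi>::nat \<Rightarrow> complex vec) (\<xi>::nat \<Rightarrow> real)
      (lam::nat \<Rightarrow> real) (\<Psi>::nat \<Rightarrow> complex vec).
    approx_setting c\<alpha> N d H P g \<alpha> \<alpha>\<^sub>W f \<epsilon>f \<epsilon>est Hhat (lhat ` {..<m}) \<and>
    approx_eigenpairs c\<eta> N m H P f \<epsilon>f \<epsilon>est Hhat lhat \<phi> \<xi> lam \<Psi>
    \<longrightarrow>
      (\<forall>k<m. \<forall>\<Delta>::ereal.
         simple_eigenvalue H (complex_of_real (lam k)) \<and>
         \<Delta> = spec_dist (lhat k) (spectrum H - {complex_of_real (lam k)}) \<and> 0 < \<Delta>
         \<longrightarrow>
         ereal (1 - fidelity (\<Psi> k) (lifted_state H P f (lhat k) (\<phi> k)))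
           \<le> ereal (C * (P_weight P (\<Psi> k) * (eps_total H P \<alpha> \<epsilon>est \<epsilon>f)\<^sup>2)) / \<Delta>\<^sup>2)
      \<and>
      (\<forall>(lhat0::real) (S::complex vec set) (\<Phi>::complex mat) (\<Xi>::complex mat) (\<Delta>::ereal)
          (Bt::complex mat) (G::complex mat) (Ginv::complex mat) (R::complex mat)
          (B::complex mat) (\<theta>::nat \<Rightarrow> real).
         1 \<le> m \<and>
         S = column_span (columns N m \<Psi>) \<and> vec_space.rank N (columns N m \<Psi>) = m \<and>
         (\<forall>k<m. lhat k = lhat0) \<and>
         \<Phi> = columns N m \<phi> \<and> mat_adjoint \<Phi> * \<Phi> = 1\<^sub>m m \<and>
         \<Xi> \<in> carrier_mat m m \<and> Hhat lhat0 * \<Phi> = \<Phi> * \<Xi> \<and>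
         op_norm (\<Xi> - complex_of_real lhat0 \<cdot>\<^sub>m 1\<^sub>m m) \<le> eps_app H P \<epsilon>est \<epsilon>f \<and>
         \<Delta> = spec_dist lhat0 (spectrum_on H (orth_complement N S)) \<and> 0 < \<Delta> \<and>
         Bt = columns N m (\<lambda>k. lifted_state H P f (lhat k) (\<phi> k)) \<and>
         G = mat_adjoint Bt * Bt \<and> pos_def_mat G \<and>
         inv_sqrt_mat G Ginv R \<and> B = Bt * R \<and>
         principal_angles N m S (column_span B) \<theta>
         \<longrightarrow>
         ereal (1 - F_min m \<theta>)
           \<le> ereal (C * (op_norm Ginv * Max ((\<lambda>k. P_weight P (\<Psi> k)) ` {..<m})
                         * (eps_total H P \<alpha> \<epsilon>est \<epsilon>f)\<^sup>2)) / \<Delta>\<^sup>2 \<and>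
         ereal (1 - F_avg m \<theta>)
           \<le> ereal (C * (op_norm Ginv * ((\<Sum>k<m. P_weight P (\<Psi> k)) / real m)
                         * (eps_total H P \<alpha> \<epsilon>est \<epsilon>f)\<^sup>2)) / \<Delta>\<^sup>2)"
\<comment> \<open>The residual constant \<open>max 1 c\<alpha>\<close> enters squared, and
  \<open>c\<eta>\<close> converts the normalization factors into weights.\<close>
proof (intro exI[of _ "c\<eta> * (max 1 c\<alpha>)\<^sup>2"] conjI allI impI)
  show "0 < c\<eta> * (max 1 c\<alpha>)\<^sup>2" using assms by (simp add: max_def)
next
  fix N d m :: nat and H P :: "complex mat" and g \<alpha> :: real and \<alpha>\<^sub>W :: "real \<Rightarrow> real" and f :: "real poly"
    and \<epsilon>f \<epsilon>est :: real and Hhat :: "real \<Rightarrow> complex mat" and lhat :: "nat \<Rightarrow> real"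
    and \<phi> :: "nat \<Rightarrow> complex vec" and \<xi> :: "nat \<Rightarrow> real" and lam :: "nat \<Rightarrow> real"
    and \<Psi> :: "nat \<Rightarrow> complex vec" and k :: nat and \<Delta> :: ereal
  assume A: "approx_setting c\<alpha> N d H P g \<alpha> \<alpha>\<^sub>W f \<epsilon>f \<epsilon>est Hhat (lhat ` {..<m}) \<and>
      approx_eigenpairs c\<eta> N m H P f \<epsilon>f \<epsilon>est Hhat lhat \<phi> \<xi> lam \<Psi>"
    and k: "k < m"
    and D: "simple_eigenvalue H (complex_of_real (lam k)) \<and>
      \<Delta> = spec_dist (lhat k) (spectrum H - {complex_of_real (lam k)}) \<and> 0 < \<Delta>"
  have l: "lhat k \<in> lhat ` {..<m}" using k by simp
  show "ereal (1 - fidelity (\<Psi> k) (lifted_state H P f (lhat k) (\<phi> k)))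
      \<le> ereal (c\<eta> * (max 1 c\<alpha>)\<^sup>2 * (P_weight P (\<Psi> k) * (eps_total H P \<alpha> \<epsilon>est \<epsilon>f)\<^sup>2)) / \<Delta>\<^sup>2"
    using A k D unfolding approx_eigenpairs_def
    by (intro nondegenerate_fidelity[OF assms(1) conjunct1[OF A] l]) auto
next
  fix N d m :: nat and H P :: "complex mat" and g \<alpha> :: real and \<alpha>\<^sub>W :: "real \<Rightarrow> real" and f :: "real poly"
    and \<epsilon>f \<epsilon>est :: real and Hhat :: "real \<Rightarrow> complex mat" and lhat :: "nat \<Rightarrow> real"
    and \<phi> :: "nat \<Rightarrow> complex vec" and \<xi> :: "nat \<Rightarrow> real" and lam :: "nat \<Rightarrow> real"
    and \<Psi> :: "nat \<Rightarrow> complex vec" and lhat0 :: real and S :: "complex vec set"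
    and \<Phi> \<Xi> :: "complex mat" and \<Delta> :: ereal and Bt G Ginv R B :: "complex mat" and \<theta> :: "nat \<Rightarrow> real"
  assume A: "approx_setting c\<alpha> N d H P g \<alpha> \<alpha>\<^sub>W f \<epsilon>f \<epsilon>est Hhat (lhat ` {..<m}) \<and>
      approx_eigenpairs c\<eta> N m H P f \<epsilon>f \<epsilon>est Hhat lhat \<phi> \<xi> lam \<Psi>"
    and D: "1 \<le> m \<and>
         S = column_span (columns N m \<Psi>) \<and> vec_space.rank N (columns N m \<Psi>) = m \<and>
         (\<forall>k<m. lhat k = lhat0) \<and>
         \<Phi> = columns N m \<phi> \<and> mat_adjoint \<Phi> * \<Phi> = 1\<^sub>m m \<and>
         \<Xi> \<in> carrier_mat m m \<and> Hhat lhat0 * \<Phi> = \<Phi> * \<Xi> \<and>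
         op_norm (\<Xi> - complex_of_real lhat0 \<cdot>\<^sub>m 1\<^sub>m m) \<le> eps_app H P \<epsilon>est \<epsilon>f \<and>
         \<Delta> = spec_dist lhat0 (spectrum_on H (orth_complement N S)) \<and> 0 < \<Delta> \<and>
         Bt = columns N m (\<lambda>k. lifted_state H P f (lhat k) (\<phi> k)) \<and>
         G = mat_adjoint Bt * Bt \<and> pos_def_mat G \<and>
         inv_sqrt_mat G Ginv R \<and> B = Bt * R \<and>
         principal_angles N m S (column_span B) \<theta>"
  have m: "1 \<le> m" and lk: "\<And>k. k < m \<Longrightarrow> lhat k = lhat0" using D by auto
  \<comment> \<open>The index 0 shows that the common energy is a working energy.\<close>
  then have l: "lhat0 \<in> lhat ` {..<m}" by (auto intro!: image_eqI[of _ _ 0])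
  have pairs: "\<phi> k \<in> column_span P" "eigenvector H (\<Psi> k) (complex_of_real (lam k))"
    "\<eta>_wave H P f lhat0 (\<phi> k) \<le> c\<eta> * P_weight P (\<Psi> k)" if "k < m" for k
    using A that lk[OF that] by (auto simp: approx_eigenpairs_def)
  \<comment> \<open>\<open>lhat\<close> is known to be constant only below \<open>m\<close>, which
    is the range of indices that \<open>columns\<close> reads.\<close>
  have Bt: "Bt = columns N m (\<lambda>k. lifted_state H P f lhat0 (\<phi> k))"
    using D lk by (auto simp: columns_def intro!: arg_cong[of _ _ "mat_of_cols N"])
  have S: "S = column_span (columns N m \<Psi>)"
    and iso: "mat_adjoint (columns N m \<phi>) * columns N m \<phi> = 1\<^sub>m m"
    and \<Xi>: "\<Xi> \<in> carrier_mat m m" "Hhat lhat0 * columns N m \<phi> = columns N m \<phi> * \<Xi>"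
    and op: "op_norm (\<Xi> - complex_of_real lhat0 \<cdot>\<^sub>m 1\<^sub>m m) \<le> eps_app H P \<epsilon>est \<epsilon>f"
    and \<Delta>: "\<Delta> = spec_dist lhat0 (spectrum_on H (orth_complement N S))" "0 < \<Delta>"
    and G: "G = mat_adjoint Bt * Bt" and R: "inv_sqrt_mat G Ginv R" and B: "B = Bt * R"
    and pa: "principal_angles N m S (column_span B) \<theta>"
    using D by blast+
  note fid = subspace_fidelities[OF assms m conjunct1[OF A] l pairs S iso \<Xi> op \<Delta> Bt G R B pa]
  show "ereal (1 - F_min m \<theta>)
      \<le> ereal (c\<eta> * (max 1 c\<alpha>)\<^sup>2 * (op_norm Ginv * Max ((\<lambda>k. P_weight P (\<Psi> k)) ` {..<m})
          * (eps_total H P \<alpha> \<epsilon>est \<epsilon>f)\<^sup>2)) / \<Delta>\<^sup>2"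
    by (rule fid(1))
  show "ereal (1 - F_avg m \<theta>)
      \<le> ereal (c\<eta> * (max 1 c\<alpha>)\<^sup>2 * (op_norm Ginv * ((\<Sum>k<m. P_weight P (\<Psi> k)) / real m)
          * (eps_total H P \<alpha> \<epsilon>est \<epsilon>f)\<^sup>2)) / \<Delta>\<^sup>2"
    by (rule fid(2))
qed

end
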